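(* (Arithmetical soundness for $\mathbf{IL}^-(\mathbf{P})$.) Let $T$ be a consistent recursively enumerable extension of $\mathrm{PA}$ in the language of arithmetic. Let $A$ be any $\mathcal{L}(\rhd)$-formula and $(\tau_0, \tau_1)$ be any pair of numerations of $T$. If $\mathbf{IL}^-(\mathbf{P}) \vdash A$ and $\tau_0$ satisfies the L\"ob condition, then for any arithmetical interpretation $f$, $\mathrm{PA} \vdash f_{\tau_0, \tau_1}(A)$.
   Context: The language $\mathcal{L}(\rhd)$ has countably many propositional variables, the constant $\bot$, connectives $\neg, \land, \lor, \to$, a unary modal operator $\Box$ and a binary modal operator $\rhd$. The logic $\mathbf{IL}^-(\mathbf{P})$ has as axioms: all tautologies in $\mathcal{L}(\rhd)$; $\Box(A \to B) \to (\Box A \to \Box B)$; $\Box(\Box A \to A) \to \Box A$; $\mathbf{J3}$: $(A \rhd C) \land (B \rhd C) \to (A \lor B) \rhd C$; $\mathbf{J6}$: $\Box A \leftrightarrow (\neg A) \rhd \bot$; and the persistence principle $\mathbf{P}$: $A \rhd B \to \Box(A \rhd B)$ (all as schemes). Its inference rules are Modus Ponens, Necessitation ($A / \Box A$), $\mathbf{R1}$: from $A \to B$ infer $C \rhd A \to C \rhd B$, and $\mathbf{R2}$: from $A \to B$ infer $B \rhd C \to A \rhd C$. $\mathcal{L}_A$ is the language of arithmetic. A formula $\tau(u)$ is a numeration of $T$ if for every natural number $n$: $n$ is the G\"odel number of an element of $T$ iff $\mathrm{PA} \vdash \tau(\overline{n})$. For a numeration $\tau$, $\mathrm{Prf}_\tau(x,y)$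 is the standard (Feferman) formula saying that $y$ is the G\"odel number of a proof of the sentence with G\"odel number $x$ from the theory axiomatized by the set of sentences defined by $\tau$; $\mathrm{Pr}_\tau(x) := \exists y\, \mathrm{Prf}_\tau(x,y)$, and $\mathrm{Con}_\tau := \neg\mathrm{Pr}_\tau(\ulcorner 0=1 \urcorner)$. The numeration $\tau$ satisfies the L\"ob condition if $\mathrm{PA} \vdash \mathrm{Pr}_\tau(\ulcorner\varphi\urcorner) \to \mathrm{Pr}_\tau(\ulcorner\mathrm{Pr}_\tau(\ulcorner\varphi\urcorner)\urcorner)$ for every $\mathcal{L}_A$-formula $\varphi$. For an $\mathcal{L}_A$-sentence $\psi$, $(\tau+\psi)(u)$ is the numeration $\tau(u) \lor u = \ulcorner\psi\urcorner$ of $T + \psi$. An arithmetical interpretation is a mapping $f$ from propositional variables to $\mathcal{L}_A$-sentences. For a pair $(\tau_0,\tau_1)$ of numerations of $T$, $f$ is extended to a mapping $f_{\tau_0,\tau_1}$ from $\mathcal{L}(\rhd)$-formulas to $\mathcal{L}_A$-sentences by: $f_{\tau_0,\tau_1}(p)$ is $f(p)$; $f_{\tau_0,\tau_1}(\bot)$ is $0=1$; $f_{\tau_0,\tau_1}$ commutes with $\neg, \land, \lor, \to$; $f_{\tau_0,\tau_1}(\Box A)$ is $\mathrm{Pr}_{\tau_0}(\ulcorner f_{\tau_0,\tau_1}(A)\urcorner)$; $f_{\tau_0,\tau_1}(A \rhd B)$ is $\mathrm{Pr}_{\tau_0}(\ulcorner f_{\tau_0,\tau_1}(A) \to \mathrm{Con}_{\tau_1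 + f_{\tau_0,\tau_1}(B)}\urcorner)$. *)

theory Defs
  imports Main
begin

section \<open>The language of arithmetic\<close>

text \<open>Bound variables are de Bruijn indices: \<open>Var i\<close> below \<open>n\<close> quantifiers refers to the free
  variable \<open>i - n\<close> when \<open>i \<ge> n\<close>.  Conjunction, disjunction and the existential quantifier are the
  usual classical abbreviations.\<close>

datatype tm = Var nat | Zero | Succ tm | Plus tm tm | Times tm tm

datatype fm =
    Eq tm tm  (infix \<open>\<^bold>=\<close> 60)
  | Neg fm  (\<open>\<^bold>\<not> _\<close> [58] 58)
  | Imp fm fm  (infixr \<open>\<^bold>\<longrightarrow>\<close> 53)
  | Forall fm

abbreviation Disj :: "fm \<Rightarrow> fm \<Rightarrow> fm"  (infixr \<open>\<^bold>\<or>\<close> 55)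
  where "\<phi> \<^bold>\<or> \<psi> \<equiv> \<^bold>\<not> \<phi> \<^bold>\<longrightarrow> \<psi>"

abbreviation Conj :: "fm \<Rightarrow> fm \<Rightarrow> fm"  (infixr \<open>\<^bold>\<and>\<close> 57)
  where "\<phi> \<^bold>\<and> \<psi> \<equiv> \<^bold>\<not> (\<phi> \<^bold>\<longrightarrow> \<^bold>\<not> \<psi>)"

abbreviation Exists :: "fm \<Rightarrow> fm"
  where "Exists \<phi> \<equiv> \<^bold>\<not> Forall (\<^bold>\<not> \<phi>)"

abbreviation Falsum :: fm
  where "Falsum \<equiv> Zero \<^bold>= Succ Zero"

primrec fvt :: "tm \<Rightarrow> nat set" where
  "fvt (Var i) = {i}"
| "fvt Zero = {}"
| "fvt (Succ t) = fvt t"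
| "fvt (Plus s t) = fvt s \<union> fvt t"
| "fvt (Times s t) = fvt s \<union> fvt t"

primrec fv :: "fm \<Rightarrow> nat set" where
  "fv (s \<^bold>= t) = fvt s \<union> fvt t"
| "fv (\<^bold>\<not> \<phi>) = fv \<phi>"
| "fv (\<phi> \<^bold>\<longrightarrow> \<psi>) = fv \<phi> \<union> fv \<psi>"
| "fv (Forall \<phi>) = {i. Suc i \<in> fv \<phi>}"

definition sentence :: "fm \<Rightarrow> bool"
  where "sentence \<phi> \<longleftrightarrow> fv \<phi> = {}"

primrec substt :: "(nat \<Rightarrow> tm) \<Rightarrow> tm \<Rightarrow> tm" where
  "substt \<sigma> (Var i) = \<sigma> i"
| "substt \<sigma> Zero = Zero"
| "substt \<sigma> (Succ t) = Succ (substt \<sigma> t)"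
| "substt \<sigma> (Plus s t) = Plus (substt \<sigma> s) (substt \<sigma> t)"
| "substt \<sigma> (Times s t) = Times (substt \<sigma> s) (substt \<sigma> t)"

definition up :: "(nat \<Rightarrow> tm) \<Rightarrow> nat \<Rightarrow> tm"
  where "up \<sigma> = case_nat (Var 0) (\<lambda>i. substt (\<lambda>j. Var (Suc j)) (\<sigma> i))"

primrec subst :: "(nat \<Rightarrow> tm) \<Rightarrow> fm \<Rightarrow> fm" where
  "subst \<sigma> (s \<^bold>= t) = substt \<sigma> s \<^bold>= substt \<sigma> t"
| "subst \<sigma> (\<^bold>\<not> \<phi>) = \<^bold>\<not> subst \<sigma> \<phi>"
| "subst \<sigma> (\<phi> \<^bold>\<longrightarrow> \<psi>) = subst \<sigma> \<phi> \<^bold>\<longrightarrow> subst \<sigma> \<psi>"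
| "subst \<sigma> (Forall \<phi>) = Forall (subst (up \<sigma>) \<phi>)"

definition lift :: "fm \<Rightarrow> fm"
  where "lift = subst (\<lambda>i. Var (Suc i))"

text \<open>\<open>inst [t\<^sub>0, \<dots>, t\<^sub>n] \<phi>\<close> substitutes \<open>t\<^sub>0, \<dots>, t\<^sub>n\<close> for the variables \<open>0, \<dots>, n\<close> and lowers
  the remaining ones.\<close>

definition inst :: "tm list \<Rightarrow> fm \<Rightarrow> fm"
  where "inst ts = subst (\<lambda>i. if i < length ts then ts ! i else Var (i - length ts))"

definition exs :: "nat \<Rightarrow> fm \<Rightarrow> fm"
  where "exs n = Exists ^^ n"

primrec num :: "nat \<Rightarrow> tm" where
  "num 0 = Zero"
| "num (Suc n) = Succ (num n)"


section \<open>First-order provability and Peano arithmetic\<close>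

inductive logical_axiom :: "fm \<Rightarrow> bool" where
  "logical_axiom (\<phi> \<^bold>\<longrightarrow> \<psi> \<^bold>\<longrightarrow> \<phi>)"
| "logical_axiom ((\<phi> \<^bold>\<longrightarrow> \<psi> \<^bold>\<longrightarrow> \<chi>) \<^bold>\<longrightarrow> (\<phi> \<^bold>\<longrightarrow> \<psi>) \<^bold>\<longrightarrow> \<phi> \<^bold>\<longrightarrow> \<chi>)"
| "logical_axiom ((\<^bold>\<not> \<phi> \<^bold>\<longrightarrow> \<^bold>\<not> \<psi>) \<^bold>\<longrightarrow> \<psi> \<^bold>\<longrightarrow> \<phi>)"
| "logical_axiom (Forall \<phi> \<^bold>\<longrightarrow> inst [t] \<phi>)"
| "logical_axiom (Forall (lift \<phi> \<^bold>\<longrightarrow> \<psi>) \<^bold>\<longrightarrow> \<phi> \<^bold>\<longrightarrow> Forall \<psi>)"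
| "logical_axiom (t \<^bold>= t)"
| "logical_axiom (s \<^bold>= t \<^bold>\<longrightarrow> inst [s] \<phi> \<^bold>\<longrightarrow> inst [t] \<phi>)"

inductive provable :: "fm set \<Rightarrow> fm \<Rightarrow> bool"  (infix \<open>\<turnstile>\<close> 50) for T where
  logical: "logical_axiom \<phi> \<Longrightarrow> T \<turnstile> \<phi>"
| nonlogical: "\<phi> \<in> T \<Longrightarrow> T \<turnstile> \<phi>"
| modus_ponens: "T \<turnstile> \<phi> \<Longrightarrow> T \<turnstile> \<phi> \<^bold>\<longrightarrow> \<psi> \<Longrightarrow> T \<turnstile> \<psi>"
| generalization: "T \<turnstile> \<phi> \<Longrightarrow> T \<turnstile> Forall \<phi>"

definition consistent :: "fm set \<Rightarrow> bool"
  where "consistent T \<longleftrightarrow> \<not> (\<exists>\<phi>. T \<turnstile> \<phi> \<and> T \<turnstile> \<^bold>\<not> \<phi>)"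

text \<open>In the induction scheme, \<open>\<phi>\<close> with \<open>Succ (Var 0)\<close> substituted for its variable \<open>0\<close> is taken under
  the quantifier binding that variable, so the parameters (the variables from \<open>1\<close> on) keep their
  indices.\<close>

inductive PA_matrix :: "fm \<Rightarrow> bool" where
  "PA_matrix (\<^bold>\<not> (Succ (Var 0) \<^bold>= Zero))"
| "PA_matrix (Succ (Var 0) \<^bold>= Succ (Var 1) \<^bold>\<longrightarrow> Var 0 \<^bold>= Var 1)"
| "PA_matrix (Plus (Var 0) Zero \<^bold>= Var 0)"
| "PA_matrix (Plus (Var 0) (Succ (Var 1)) \<^bold>= Succ (Plus (Var 0) (Var 1)))"
| "PA_matrix (Times (Var 0) Zero \<^bold>= Zero)"
| "PA_matrix (Times (Var 0) (Succ (Var 1)) \<^bold>= Plus (Times (Var 0) (Var 1)) (Var 0))"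
| "PA_matrix (inst [Zero] \<phi>
      \<^bold>\<and> Forall (\<phi> \<^bold>\<longrightarrow> subst (case_nat (Succ (Var 0)) (\<lambda>i. Var (Suc i))) \<phi>)
      \<^bold>\<longrightarrow> Forall \<phi>)"

definition PA :: "fm set"
  where "PA = {(Forall ^^ n) \<phi> | n \<phi>. PA_matrix \<phi> \<and> sentence ((Forall ^^ n) \<phi>)}"


section \<open>Goedel numbers\<close>

text \<open>The map \<open>(x, y) \<mapsto> (x + y)\<^sup>2 + x\<close> is an injection (not a bijection) given by a term of the
  language.\<close>

definition pair :: "nat \<Rightarrow> nat \<Rightarrow> nat"
  where "pair x y = (x + y) * (x + y) + x"

primrec gnt :: "tm \<Rightarrow> nat" where
  "gnt (Var i) = pair 0 i"
| "gnt Zero = pair 1 0"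
| "gnt (Succ t) = pair 2 (gnt t)"
| "gnt (Plus s t) = pair 3 (pair (gnt s) (gnt t))"
| "gnt (Times s t) = pair 4 (pair (gnt s) (gnt t))"

primrec gn :: "fm \<Rightarrow> nat" where
  "gn (s \<^bold>= t) = pair 5 (pair (gnt s) (gnt t))"
| "gn (\<^bold>\<not> \<phi>) = pair 6 (gn \<phi>)"
| "gn (\<phi> \<^bold>\<longrightarrow> \<psi>) = pair 7 (pair (gn \<phi>) (gn \<psi>))"
| "gn (Forall \<phi>) = pair 8 (gn \<phi>)"

definition quot :: "fm \<Rightarrow> tm"
  where "quot \<phi> = num (gn \<phi>)"


section \<open>Arithmetization of syntax\<close>

text \<open>Each arithmetical predicate is a function from its argument terms to formulas: the body of its
  definition is a formula whose free variables \<open>0, 1, \<dots>\<close> stand for the arguments, into which the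
  argument terms are substituted by \<open>inst\<close>.  Inside the body, \<open>let\<close> names the de Bruijn indices
  after each block of quantifiers.\<close>

definition Less :: "tm \<Rightarrow> tm \<Rightarrow> fm" where
  "Less x y = inst [x, y] (exs 1
     (let z = Var 0; x = Var 1; y = Var 2 in Plus x (Succ z) \<^bold>= y))"

text \<open>Goedel's beta function: \<open>x\<close> is the remainder of \<open>a\<close> modulo \<open>1 + (i + 1) b\<close>.\<close>

definition Beta :: "tm \<Rightarrow> tm \<Rightarrow> tm \<Rightarrow> tm \<Rightarrow> fm" where
  "Beta a b i x = inst [a, b, i, x] (exs 1
     (let q = Var 0; a = Var 1; b = Var 2; i = Var 3; x = Var 4; m = Succ (Times (Succ i) b) in
        a \<^bold>= Plus (Times q m) x \<^bold>\<and> Less x m))"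

definition Pair :: "tm \<Rightarrow> tm \<Rightarrow> tm"  (\<open>\<langle>_, _\<rangle>\<close>)
  where "\<langle>x, y\<rangle> = Plus (Times (Plus x y) (Plus x y)) x"

text \<open>A number \<open>\<langle>l, \<langle>a, b\<rangle>\<rangle>\<close> codes the sequence of length \<open>l\<close> of the values \<open>\<beta>(a, b, i)\<close>, \<open>i < l\<close>.
  A sequence has many codes.\<close>

definition Len :: "tm \<Rightarrow> tm \<Rightarrow> fm" where
  "Len s l = inst [s, l] (exs 2
     (let a = Var 0; b = Var 1; s = Var 2; l = Var 3 in s \<^bold>= \<langle>l, \<langle>a, b\<rangle>\<rangle>))"

definition Entry :: "tm \<Rightarrow> tm \<Rightarrow> tm \<Rightarrow> fm" where
  "Entry s i x = inst [s, i, x] (exs 3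
     (let l = Var 0; a = Var 1; b = Var 2; s = Var 3; i = Var 4; x = Var 5 in
        s \<^bold>= \<langle>l, \<langle>a, b\<rangle>\<rangle> \<^bold>\<and> Less i l \<^bold>\<and> Beta a b i x))"

text \<open>\<open>x\<close> occurs in the sequence \<open>s\<close> before position \<open>i\<close>.\<close>

definition Earlier :: "tm \<Rightarrow> tm \<Rightarrow> tm \<Rightarrow> fm" where
  "Earlier s i x = inst [s, i, x] (exs 1
     (let j = Var 0; s = Var 1; i = Var 2; x = Var 3 in Less j i \<^bold>\<and> Entry s j x))"

text \<open>\<open>Derivation R x s\<close>: the number \<open>s\<close> codes a nonempty sequence with last entry \<open>x\<close>, each of whose
  entries \<open>u\<close>, at position \<open>i\<close>, satisfies \<open>R u s i\<close>.  Inductively defined predicates are arithmetized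
  as the existence of a derivation, \<open>R\<close> expressing that \<open>u\<close> is obtained by one of the defining
  clauses from entries of \<open>s\<close> before position \<open>i\<close>.\<close>

definition Derivation :: "(tm \<Rightarrow> tm \<Rightarrow> tm \<Rightarrow> fm) \<Rightarrow> tm \<Rightarrow> tm \<Rightarrow> fm" where
  "Derivation R x s = inst [x, s] (exs 1
     (let l = Var 0; x = Var 1; s = Var 2 in
        Len s (Succ l) \<^bold>\<and> Entry s l x \<^bold>\<and>
        Forall (let i = Var 0; l = Var 1; s = Var 3 in
          Less i (Succ l) \<^bold>\<longrightarrow>
          exs 1 (let u = Var 0; i = Var 1; s = Var 4 in Entry s i u \<^bold>\<and> R u s i))))"

definition Derivable :: "(tm \<Rightarrow> tm \<Rightarrow> tm \<Rightarrow> fm) \<Rightarrow> tm \<Rightarrow> fm" where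
  "Derivable R x = inst [x] (exs 1 (let s = Var 0; x = Var 1 in Derivation R x s))"

text \<open>The counterparts of the constructors on codes.\<close>

definition "QVar i = \<langle>num 0, i\<rangle>"
definition "QZero = \<langle>num 1, num 0\<rangle>"
definition "QSucc x = \<langle>num 2, x\<rangle>"
definition "QPlus x y = \<langle>num 3, \<langle>x, y\<rangle>\<rangle>"
definition "QTimes x y = \<langle>num 4, \<langle>x, y\<rangle>\<rangle>"
definition "QEq x y = \<langle>num 5, \<langle>x, y\<rangle>\<rangle>"
definition "QNeg x = \<langle>num 6, x\<rangle>"
definition "QImp x y = \<langle>num 7, \<langle>x, y\<rangle>\<rangle>"
definition "QForall x = \<langle>num 8, x\<rangle>"

text \<open>\<open>TermBelow k x\<close> and \<open>FormBelow k x\<close>: \<open>x\<close> is the code of a term (formula) all of whose free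
  variables are smaller than \<open>k\<close>.\<close>

definition TermStep :: "tm \<Rightarrow> tm \<Rightarrow> tm \<Rightarrow> fm" where
  "TermStep u s i = inst [u, s, i] (exs 3
     (let k = Var 0; x = Var 1; y = Var 2; u = Var 3; s = Var 4; i = Var 5 in
        (u \<^bold>= \<langle>k, QVar x\<rangle> \<^bold>\<and> Less x k) \<^bold>\<or>
        u \<^bold>= \<langle>k, QZero\<rangle> \<^bold>\<or>
        (u \<^bold>= \<langle>k, QSucc x\<rangle> \<^bold>\<and> Earlier s i \<langle>k, x\<rangle>) \<^bold>\<or>
        ((u \<^bold>= \<langle>k, QPlus x y\<rangle> \<^bold>\<or> u \<^bold>= \<langle>k, QTimes x y\<rangle>) \<^bold>\<and>
           Earlier s i \<langle>k, x\<rangle> \<^bold>\<and> Earlier s i \<langle>k, y\<rangle>)))"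

definition TermBelow :: "tm \<Rightarrow> tm \<Rightarrow> fm"
  where "TermBelow k x = Derivable TermStep \<langle>k, x\<rangle>"

definition Term :: "tm \<Rightarrow> fm" where
  "Term x = inst [x] (exs 1 (let k = Var 0; x = Var 1 in TermBelow k x))"

definition FormStep :: "tm \<Rightarrow> tm \<Rightarrow> tm \<Rightarrow> fm" where
  "FormStep u s i = inst [u, s, i] (exs 3
     (let k = Var 0; x = Var 1; y = Var 2; u = Var 3; s = Var 4; i = Var 5 in
        (u \<^bold>= \<langle>k, QEq x y\<rangle> \<^bold>\<and> TermBelow k x \<^bold>\<and> TermBelow k y) \<^bold>\<or>
        (u \<^bold>= \<langle>k, QNeg x\<rangle> \<^bold>\<and> Earlier s i \<langle>k, x\<rangle>) \<^bold>\<or>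
        (u \<^bold>= \<langle>k, QImp x y\<rangle> \<^bold>\<and> Earlier s i \<langle>k, x\<rangle> \<^bold>\<and> Earlier s i \<langle>k, y\<rangle>) \<^bold>\<or>
        (u \<^bold>= \<langle>k, QForall x\<rangle> \<^bold>\<and> Earlier s i \<langle>Succ k, x\<rangle>)))"

definition FormBelow :: "tm \<Rightarrow> tm \<Rightarrow> fm"
  where "FormBelow k x = Derivable FormStep \<langle>k, x\<rangle>"

definition Form :: "tm \<Rightarrow> fm" where
  "Form x = inst [x] (exs 1 (let k = Var 0; x = Var 1 in FormBelow k x))"

definition Sent :: "tm \<Rightarrow> fm"
  where "Sent x = FormBelow Zero x"

text \<open>Substitution as a relation between codes.  In an entry \<open>\<langle>p, \<langle>k, \<langle>x, y\<rangle>\<rangle>\<rangle>\<close>, \<open>y\<close> is the result of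
  a substitution, with parameter \<open>p\<close>, applied to \<open>x\<close> below \<open>k\<close> quantifiers; \<open>V p k i y\<close> says that it
  maps the variable \<open>i\<close> to the term \<open>y\<close> there.\<close>

definition SubsttStep ::
    "(tm \<Rightarrow> tm \<Rightarrow> tm \<Rightarrow> tm \<Rightarrow> fm) \<Rightarrow> tm \<Rightarrow> tm \<Rightarrow> tm \<Rightarrow> fm" where
  "SubsttStep V u s i = inst [u, s, i] (exs 6
     (let p = Var 0; k = Var 1; x = Var 2; y = Var 3; x' = Var 4; y' = Var 5;
          u = Var 6; s = Var 7; i = Var 8 in
        (u \<^bold>= \<langle>p, \<langle>k, \<langle>QVar x, y\<rangle>\<rangle>\<rangle> \<^bold>\<and> V p k x y) \<^bold>\<or>
        u \<^bold>= \<langle>p, \<langle>k, \<langle>QZero, QZero\<rangle>\<rangle>\<rangle> \<^bold>\<or>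
        (u \<^bold>= \<langle>p, \<langle>k, \<langle>QSucc x, QSucc y\<rangle>\<rangle>\<rangle> \<^bold>\<and> Earlier s i \<langle>p, \<langle>k, \<langle>x, y\<rangle>\<rangle>\<rangle>) \<^bold>\<or>
        ((u \<^bold>= \<langle>p, \<langle>k, \<langle>QPlus x x', QPlus y y'\<rangle>\<rangle>\<rangle> \<^bold>\<or>
          u \<^bold>= \<langle>p, \<langle>k, \<langle>QTimes x x', QTimes y y'\<rangle>\<rangle>\<rangle>) \<^bold>\<and>
           Earlier s i \<langle>p, \<langle>k, \<langle>x, y\<rangle>\<rangle>\<rangle> \<^bold>\<and> Earlier s i \<langle>p, \<langle>k, \<langle>x', y'\<rangle>\<rangle>\<rangle>)))"

definition Substt ::
    "(tm \<Rightarrow> tm \<Rightarrow> tm \<Rightarrow> tm \<Rightarrow> fm) \<Rightarrow> tm \<Rightarrow> tm \<Rightarrow> tm \<Rightarrow> tm \<Rightarrow> fm" where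
  "Substt V p k x y = Derivable (SubsttStep V) \<langle>p, \<langle>k, \<langle>x, y\<rangle>\<rangle>\<rangle>"

definition SubstStep ::
    "(tm \<Rightarrow> tm \<Rightarrow> tm \<Rightarrow> tm \<Rightarrow> fm) \<Rightarrow> tm \<Rightarrow> tm \<Rightarrow> tm \<Rightarrow> fm" where
  "SubstStep V u s i = inst [u, s, i] (exs 6
     (let p = Var 0; k = Var 1; x = Var 2; y = Var 3; x' = Var 4; y' = Var 5;
          u = Var 6; s = Var 7; i = Var 8 in
        (u \<^bold>= \<langle>p, \<langle>k, \<langle>QEq x x', QEq y y'\<rangle>\<rangle>\<rangle> \<^bold>\<and> Substt V p k x y \<^bold>\<and> Substt V p k x' y') \<^bold>\<or>
        (u \<^bold>= \<langle>p, \<langle>k, \<langle>QNeg x, QNeg y\<rangle>\<rangle>\<rangle> \<^bold>\<and> Earlier s i \<langle>p, \<langle>k, \<langle>x, y\<rangle>\<rangle>\<rangle>) \<^bold>\<or>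
        (u \<^bold>= \<langle>p, \<langle>k, \<langle>QImp x x', QImp y y'\<rangle>\<rangle>\<rangle> \<^bold>\<and>
           Earlier s i \<langle>p, \<langle>k, \<langle>x, y\<rangle>\<rangle>\<rangle> \<^bold>\<and> Earlier s i \<langle>p, \<langle>k, \<langle>x', y'\<rangle>\<rangle>\<rangle>) \<^bold>\<or>
        (u \<^bold>= \<langle>p, \<langle>k, \<langle>QForall x, QForall y\<rangle>\<rangle>\<rangle> \<^bold>\<and> Earlier s i \<langle>p, \<langle>Succ k, \<langle>x, y\<rangle>\<rangle>\<rangle>)))"

definition Subst ::
    "(tm \<Rightarrow> tm \<Rightarrow> tm \<Rightarrow> tm \<Rightarrow> fm) \<Rightarrow> tm \<Rightarrow> tm \<Rightarrow> tm \<Rightarrow> tm \<Rightarrow> fm" where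
  "Subst V p k x y = Derivable (SubstStep V) \<langle>p, \<langle>k, \<langle>x, y\<rangle>\<rangle>\<rangle>"

text \<open>\<open>Raise k x y\<close>: \<open>y\<close> is the term \<open>x\<close> with all variables raised by \<open>k\<close>.\<close>

definition Raise :: "tm \<Rightarrow> tm \<Rightarrow> tm \<Rightarrow> fm" where
  "Raise k x y = Substt (\<lambda>p k i y. y \<^bold>= QVar (Plus i k)) Zero k x y"

definition LiftVar :: "tm \<Rightarrow> tm \<Rightarrow> tm \<Rightarrow> tm \<Rightarrow> fm" where
  "LiftVar p k i y =
     ((Less i k \<^bold>\<and> y \<^bold>= QVar i) \<^bold>\<or> (Less k (Succ i) \<^bold>\<and> y \<^bold>= QVar (Succ i)))"

definition Lift :: "tm \<Rightarrow> tm \<Rightarrow> fm"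
  where "Lift x y = Subst LiftVar Zero Zero x y"

definition InstVar :: "tm \<Rightarrow> tm \<Rightarrow> tm \<Rightarrow> tm \<Rightarrow> fm" where
  "InstVar p k i y = inst [p, k, i, y] (exs 1
     (let j = Var 0; p = Var 1; k = Var 2; i = Var 3; y = Var 4 in
        (Less i k \<^bold>\<and> y \<^bold>= QVar i) \<^bold>\<or>
        (i \<^bold>= k \<^bold>\<and> Raise k p y) \<^bold>\<or>
        (Less k i \<^bold>\<and> i \<^bold>= Succ j \<^bold>\<and> y \<^bold>= QVar j)))"

definition Inst :: "tm \<Rightarrow> tm \<Rightarrow> tm \<Rightarrow> fm"
  where "Inst t x y = Subst InstVar t Zero x y"

definition LogAx :: "tm \<Rightarrow> fm" where
  "LogAx u = inst [u] (exs 5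
     (let x = Var 0; y = Var 1; z = Var 2; t = Var 3; t' = Var 4; u = Var 5 in
        (Form x \<^bold>\<and> Form y \<^bold>\<and> u \<^bold>= QImp x (QImp y x)) \<^bold>\<or>
        (Form x \<^bold>\<and> Form y \<^bold>\<and> Form z \<^bold>\<and>
           u \<^bold>= QImp (QImp x (QImp y z)) (QImp (QImp x y) (QImp x z))) \<^bold>\<or>
        (Form x \<^bold>\<and> Form y \<^bold>\<and> u \<^bold>= QImp (QImp (QNeg x) (QNeg y)) (QImp y x)) \<^bold>\<or>
        (Form x \<^bold>\<and> Term t \<^bold>\<and> Inst t x y \<^bold>\<and> u \<^bold>= QImp (QForall x) y) \<^bold>\<or>
        (Form x \<^bold>\<and> Form y \<^bold>\<and> Lift x z \<^bold>\<and>
           u \<^bold>= QImp (QForall (QImp z y)) (QImp x (QForall y))) \<^bold>\<or>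
        (Term t \<^bold>\<and> u \<^bold>= QEq t t) \<^bold>\<or>
        (Form x \<^bold>\<and> Term t \<^bold>\<and> Term t' \<^bold>\<and> Inst t x y \<^bold>\<and> Inst t' x z \<^bold>\<and>
           u \<^bold>= QImp (QEq t t') (QImp y z))))"


section \<open>Provability predicates of numerations\<close>

text \<open>A numeration is a formula with no free variable other than \<open>Var 0\<close>, so \<open>inst [t] \<tau>\<close> is
  \<open>\<tau>(t)\<close>.  \<open>Prf \<tau> x y\<close> refers to the Hilbert calculus \<open>provable\<close> over the set of those sentences that
  satisfy \<open>\<tau>\<close>; numbers satisfying \<open>\<tau>\<close> that are not codes of sentences are not used as axioms.\<close>

definition ProofStep :: "fm \<Rightarrow> tm \<Rightarrow> tm \<Rightarrow> tm \<Rightarrow> fm" where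
  "ProofStep \<tau> u s i = inst [u, s, i] (exs 1
     (let x = Var 0; u = Var 1; s = Var 2; i = Var 3 in
        LogAx u \<^bold>\<or>
        (Sent u \<^bold>\<and> inst [u] \<tau>) \<^bold>\<or>
        (Earlier s i x \<^bold>\<and> Earlier s i (QImp x u)) \<^bold>\<or>
        (Earlier s i x \<^bold>\<and> u \<^bold>= QForall x)))"

definition Prf :: "fm \<Rightarrow> tm \<Rightarrow> tm \<Rightarrow> fm"
  where "Prf \<tau> x y = Derivation (ProofStep \<tau>) x y"

definition Pr :: "fm \<Rightarrow> tm \<Rightarrow> fm" where
  "Pr \<tau> x = inst [x] (exs 1 (let y = Var 0; x = Var 1 in Prf \<tau> x y))"

definition Con :: "fm \<Rightarrow> fm"
  where "Con \<tau> = \<^bold>\<not> Pr \<tau> (quot Falsum)"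

definition numeration :: "fm \<Rightarrow> fm set \<Rightarrow> bool" where
  "numeration \<tau> T \<longleftrightarrow>
     fv \<tau> \<subseteq> {0} \<and> (\<forall>n. (\<exists>\<phi>\<in>T. n = gn \<phi>) \<longleftrightarrow> PA \<turnstile> inst [num n] \<tau>)"

definition Loeb_condition :: "fm \<Rightarrow> bool" where
  "Loeb_condition \<tau> \<longleftrightarrow> (\<forall>\<phi>. PA \<turnstile> Pr \<tau> (quot \<phi>) \<^bold>\<longrightarrow> Pr \<tau> (quot (Pr \<tau> (quot \<phi>))))"

definition extend :: "fm \<Rightarrow> fm \<Rightarrow> fm"
  where "extend \<tau> \<psi> = \<tau> \<^bold>\<or> Var 0 \<^bold>= quot \<psi>"


section \<open>Recursive enumerability\<close>

datatype recf = Z | S | Proj nat | Comp recf "recf list" | Rec recf recf | Mu recf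

inductive computes :: "recf \<Rightarrow> nat list \<Rightarrow> nat \<Rightarrow> bool" where
  "computes Z xs 0"
| "computes S [x] (Suc x)"
| "i < length xs \<Longrightarrow> computes (Proj i) xs (xs ! i)"
| "list_all2 (\<lambda>g y. computes g xs y) gs ys \<Longrightarrow> computes f ys z \<Longrightarrow> computes (Comp f gs) xs z"
| "computes f xs y \<Longrightarrow> computes (Rec f g) (0 # xs) y"
| "computes (Rec f g) (n # xs) r \<Longrightarrow> computes g (n # r # xs) y \<Longrightarrow>
   computes (Rec f g) (Suc n # xs) y"
| "computes f (n # xs) 0 \<Longrightarrow> (\<And>m. m < n \<Longrightarrow> \<exists>y. computes f (m # xs) (Suc y)) \<Longrightarrow>
   computes (Mu f) xs n"

definition rec_enumerable :: "nat set \<Rightarrow> bool" where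
  "rec_enumerable A \<longleftrightarrow>
     A = {} \<or> (\<exists>f. (\<forall>n. \<exists>y. computes f [n] y) \<and> A = {y. \<exists>n. computes f [n] y})"


section \<open>The logic IL\<open>\<^sup>-\<close>(P)\<close>

datatype mfm =
    PVar nat
  | MBot
  | MNeg mfm
  | MConj mfm mfm
  | MDisj mfm mfm
  | MImp mfm mfm  (infixr \<open>\<rightarrow>\<close> 53)
  | Box mfm  (\<open>\<box> _\<close> [58] 58)
  | Rhd mfm mfm  (infix \<open>\<rhd>\<close> 56)

text \<open>Boolean evaluation that treats variables, boxed formulas and \<open>\<rhd>\<close>-formulas as atoms.\<close>

primrec boolean_eval :: "(mfm \<Rightarrow> bool) \<Rightarrow> mfm \<Rightarrow> bool" where
  "boolean_eval v (PVar p) = v (PVar p)"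
| "boolean_eval v MBot = False"
| "boolean_eval v (MNeg A) = (\<not> boolean_eval v A)"
| "boolean_eval v (MConj A B) = (boolean_eval v A \<and> boolean_eval v B)"
| "boolean_eval v (MDisj A B) = (boolean_eval v A \<or> boolean_eval v B)"
| "boolean_eval v (A \<rightarrow> B) = (boolean_eval v A \<longrightarrow> boolean_eval v B)"
| "boolean_eval v (\<box> A) = v (\<box> A)"
| "boolean_eval v (A \<rhd> B) = v (A \<rhd> B)"

definition tautology :: "mfm \<Rightarrow> bool"
  where "tautology A \<longleftrightarrow> (\<forall>v. boolean_eval v A)"

abbreviation MIff :: "mfm \<Rightarrow> mfm \<Rightarrow> mfm"
  where "MIff A B \<equiv> MConj (A \<rightarrow> B) (B \<rightarrow> A)"

inductive ILminusP :: "mfm \<Rightarrow> bool" where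
  taut: "tautology A \<Longrightarrow> ILminusP A"
| K: "ILminusP (\<box> (A \<rightarrow> B) \<rightarrow> (\<box> A \<rightarrow> \<box> B))"
| L: "ILminusP (\<box> (\<box> A \<rightarrow> A) \<rightarrow> \<box> A)"
| J3: "ILminusP (MConj (A \<rhd> C) (B \<rhd> C) \<rightarrow> (MDisj A B \<rhd> C))"
| J6: "ILminusP (MIff (\<box> A) (MNeg A \<rhd> MBot))"
| P: "ILminusP (A \<rhd> B \<rightarrow> \<box> (A \<rhd> B))"
| MP: "ILminusP (A \<rightarrow> B) \<Longrightarrow> ILminusP A \<Longrightarrow> ILminusP B"
| Nec: "ILminusP A \<Longrightarrow> ILminusP (\<box> A)"
| R1: "ILminusP (A \<rightarrow> B) \<Longrightarrow> ILminusP (C \<rhd> A \<rightarrow> C \<rhd> B)"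
| R2: "ILminusP (A \<rightarrow> B) \<Longrightarrow> ILminusP (B \<rhd> C \<rightarrow> A \<rhd> C)"


section \<open>Arithmetical interpretations\<close>

primrec interp :: "(nat \<Rightarrow> fm) \<Rightarrow> fm \<Rightarrow> fm \<Rightarrow> mfm \<Rightarrow> fm" where
  "interp f \<tau>\<^sub>0 \<tau>\<^sub>1 (PVar p) = f p"
| "interp f \<tau>\<^sub>0 \<tau>\<^sub>1 MBot = Falsum"
| "interp f \<tau>\<^sub>0 \<tau>\<^sub>1 (MNeg A) = \<^bold>\<not> interp f \<tau>\<^sub>0 \<tau>\<^sub>1 A"
| "interp f \<tau>\<^sub>0 \<tau>\<^sub>1 (MConj A B) = interp f \<tau>\<^sub>0 \<tau>\<^sub>1 A \<^bold>\<and> interp f \<tau>\<^sub>0 \<tau>\<^sub>1 B"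
| "interp f \<tau>\<^sub>0 \<tau>\<^sub>1 (MDisj A B) = interp f \<tau>\<^sub>0 \<tau>\<^sub>1 A \<^bold>\<or> interp f \<tau>\<^sub>0 \<tau>\<^sub>1 B"
| "interp f \<tau>\<^sub>0 \<tau>\<^sub>1 (A \<rightarrow> B) = interp f \<tau>\<^sub>0 \<tau>\<^sub>1 A \<^bold>\<longrightarrow> interp f \<tau>\<^sub>0 \<tau>\<^sub>1 B"
| "interp f \<tau>\<^sub>0 \<tau>\<^sub>1 (\<box> A) = Pr \<tau>\<^sub>0 (quot (interp f \<tau>\<^sub>0 \<tau>\<^sub>1 A))"
| "interp f \<tau>\<^sub>0 \<tau>\<^sub>1 (A \<rhd> B) =
     Pr \<tau>\<^sub>0 (quot (interp f \<tau>\<^sub>0 \<tau>\<^sub>1 A \<^bold>\<longrightarrow> Con (extend \<tau>\<^sub>1 (interp f \<tau>\<^sub>0 \<tau>\<^sub>1 B))))"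

end

(* All reasoning inside PA is done semantically: by the completeness theorem it suffices to verify a
   formula in every model of PA with universe nat, where the beta function lemma shows that the
   arithmetized inductive definitions are closed under their clauses and admit induction for definable
   predicates.  This yields the derivability conditions, and Loeb's theorem follows from them, the Loeb
   condition and the diagonal lemma.  In rule R1, a proof from tau_1 + B is turned into one from
   tau_1 + A by induction on the proof: A derives B, and the provable formulas are closed under the
   rules, so no formalized deduction theorem is required. *)

theory Submission
  imports Defs "HOL-Library.Countable_Set"
begin

section \<open>Substitution\<close>

text \<open>The numerations are arbitrary formulas, not assumed Sigma_1, so provability need not
  provably imply its own provability. \<open>Loeb_condition\<close> supplies exactly this third
  derivability condition for \<open>\<tau>\<^sub>0\<close>; it enters in the axioms \<open>L\<close>
  and \<open>P\<close> only. The numeration \<open>\<tau>\<^sub>1\<close> occurs only inside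
  \<open>Con\<close>, and two facts about it are used: \<open>Con\<close> of an extension is
  monotone under provable implication (for \<open>R1\<close>), and it is refutable when the added
  sentence is \<open>Falsum\<close> (for \<open>J6\<close>). The obstacle is nonstandard elements. A
  proof in the sense of a model can have nonstandard length and use nonstandard axioms, so an
  induction over it has to be an induction of the model, for a definable predicate. Codes of actual
  formulas, in contrast, are standard, and facts about them are verified by ordinary structural
  induction from outside. For these it is enough that correct syntactic facts are recognized; an
  exact characterization is needed only for the codes of numerals, in the diagonal lemma.\<close>

lemma up_simps [simp]: "up \<sigma> 0 = Var 0" "up \<sigma> (Suc i) = substt (\<lambda>j. Var (Suc j)) (\<sigma> i)"
  by (simp_all add: up_def)

lemma substt_cong: "(\<And>i. i \<in> fvt t \<Longrightarrow> \<sigma> i = \<rho> i) \<Longrightarrow> substt \<sigma> t = substt \<rho> t"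
  by (induction t) auto

lemma subst_cong: "(\<And>i. i \<in> fv \<phi> \<Longrightarrow> \<sigma> i = \<rho> i) \<Longrightarrow> subst \<sigma> \<phi> = subst \<rho> \<phi>"
proof (induction \<phi> arbitrary: \<sigma> \<rho>)
  case (Eq s t)
  then show ?case by (auto intro!: substt_cong)
next
  case (Forall \<phi>)
  have "up \<sigma> i = up \<rho> i" if "i \<in> fv \<phi>" for i
    using that Forall.prems by (cases i) auto
  then have "subst (up \<sigma>) \<phi> = subst (up \<rho>) \<phi>" by (rule Forall.IH)
  then show ?case by simp
next
  case (Neg \<phi>)
  have "subst \<sigma> \<phi> = subst \<rho> \<phi>" using Neg.prems by (intro Neg.IH) auto
  then show ?case by simp
next
  case (Imp \<phi> \<psi>)
  have "subst \<sigma> \<phi> = subst \<rho> \<phi>" "subst \<sigma> \<psi> = subst \<rho> \<psi>"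
    using Imp.prems by (auto intro!: Imp.IH)
  then show ?case by simp
qed

lemma substt_substt: "substt \<sigma> (substt \<rho> t) = substt (\<lambda>i. substt \<sigma> (\<rho> i)) t"
  by (induction t) auto

lemma up_comp: "substt (up \<sigma>) (up \<rho> i) = up (\<lambda>i. substt \<sigma> (\<rho> i)) i"
  by (cases i) (simp_all add: substt_substt)

lemma subst_subst: "subst \<sigma> (subst \<rho> \<phi>) = subst (\<lambda>i. substt \<sigma> (\<rho> i)) \<phi>"
  by (induction \<phi> arbitrary: \<sigma> \<rho>) (simp_all add: substt_substt up_comp)

lemma substt_Var [simp]: "substt Var t = t"
  by (induction t) auto

lemma up_Var: "up Var = Var"
proof
  show "up Var i = Var i" for i by (cases i) auto
qed

lemma subst_Var [simp]: "subst Var \<phi> = \<phi>"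
  by (induction \<phi>) (simp_all add: up_Var)

lemma fvt_substt: "fvt (substt \<sigma> t) = (\<Union>i\<in>fvt t. fvt (\<sigma> i))"
  by (induction t) auto

lemma fv_subst: "fv (subst \<sigma> \<phi>) = (\<Union>i\<in>fv \<phi>. fvt (\<sigma> i))"
proof (induction \<phi> arbitrary: \<sigma>)
  case (Forall \<phi>)
  have "Suc j \<in> fvt (up \<sigma> i) \<longleftrightarrow> (\<exists>k. i = Suc k \<and> j \<in> fvt (\<sigma> k))" for i j
    by (cases i) (auto simp: fvt_substt)
  then show ?case using Forall by fastforce
qed (auto simp: fvt_substt)

lemma finite_fvt: "finite (fvt t)"
  by (induction t) auto

lemma finite_fv: "finite (fv \<phi>)"
proof (induction \<phi>)
  case (Forall \<phi>)
  have "{i. Suc i \<in> fv \<phi>} = Suc -` fv \<phi>" by auto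
  then show ?case using Forall by (simp add: finite_vimageI)
qed (auto simp: finite_fvt)

lemma subst_sentence: "sentence \<phi> \<Longrightarrow> subst \<sigma> \<phi> = \<phi>"
  using subst_cong[of \<phi> \<sigma> Var] by (simp add: sentence_def)

lemma inst1: "inst [t] \<phi> = subst (case_nat t Var) \<phi>"
proof -
  have "(\<lambda>i. if i < length [t] then [t] ! i else Var (i - length [t])) = case_nat t Var"
    by (auto simp: fun_eq_iff split: nat.splits)
  then show ?thesis by (simp add: inst_def)
qed

text \<open>Instantiation undoes the shift made by \<open>up\<close>. Quantifier instances take this
  form both in the renaming arguments and in the truth lemma.\<close>

lemma inst1_subst_up: "inst [t] (subst (up \<sigma>) \<phi>) = subst (case_nat t \<sigma>) \<phi>"
proof -
  have "substt (case_nat t Var) (up \<sigma> i) = case_nat t \<sigma> i" for i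
    by (cases i) (simp_all add: substt_substt)
  then show ?thesis by (simp add: inst1 subst_subst)
qed

lemma subst_inst1: "subst \<sigma> (inst [t] \<phi>) = inst [substt \<sigma> t] (subst (up \<sigma>) \<phi>)"
proof -
  have "(\<lambda>i. substt \<sigma> (case_nat t Var i)) = case_nat (substt \<sigma> t) \<sigma>"
    by (auto simp: fun_eq_iff split: nat.splits)
  then show ?thesis by (simp add: inst1_subst_up) (simp add: inst1 subst_subst)
qed

lemma subst_up_lift: "subst (up \<sigma>) (lift \<phi>) = lift (subst \<sigma> \<phi>)"
  by (simp add: lift_def subst_subst)


section \<open>Derivations\<close>

lemma logical_axiom_subst: "logical_axiom \<phi> \<Longrightarrow> logical_axiom (subst \<sigma> \<phi>)"
  by (cases rule: logical_axiom.cases, assumption)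
    (simp_all add: subst_inst1 subst_up_lift logical_axiom.intros)

text \<open>Free variables of a theorem act as universally quantified, since the axioms are
  sentences and are left alone by \<open>\<sigma>\<close>. The substitution is generalized in the
  induction because crossing a quantifier turns it into \<open>up \<sigma>\<close>.\<close>

lemma provable_subst:
  assumes "T \<turnstile> \<phi>" "\<forall>\<psi>\<in>T. sentence \<psi>"
  shows "T \<turnstile> subst \<sigma> \<phi>"
  using assms
proof (induction arbitrary: \<sigma> rule: provable.induct)
  case (logical \<phi>)
  then show ?case by (simp add: logical_axiom_subst provable.logical)
next
  case (nonlogical \<phi>)
  then show ?case by (simp add: subst_sentence provable.nonlogical)
next
  case (modus_ponens \<phi> \<psi>)
  then show ?case by (metis subst.simps(3) provable.modus_ponens)
next
  case (generalization \<phi>)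
  then show ?case by (simp add: provable.generalization)
qed

lemma provable_mono:
  assumes "A \<turnstile> \<phi>" "\<forall>\<psi>\<in>A. T \<turnstile> \<psi>"
  shows "T \<turnstile> \<phi>"
  using assms by (induction rule: provable.induct) (auto intro: provable.intros)

text \<open>Derivability from hypotheses with free variables: generalization applies only to theorems
  of \<open>T\<close>.\<close>

inductive derivable :: "fm set \<Rightarrow> fm set \<Rightarrow> fm \<Rightarrow> bool" for T H where
  global: "T \<turnstile> \<phi> \<Longrightarrow> derivable T H \<phi>"
| hypothesis: "\<phi> \<in> H \<Longrightarrow> derivable T H \<phi>"
| mp: "derivable T H \<phi> \<Longrightarrow> derivable T H (\<phi> \<^bold>\<longrightarrow> \<psi>) \<Longrightarrow> derivable T H \<psi>"

lemma derivable_axiom: "logical_axiom \<phi> \<Longrightarrow> derivable T H \<phi>"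
  by (simp add: derivable.global provable.logical)

lemma derivable_mono: "derivable T H \<phi> \<Longrightarrow> H \<subseteq> H' \<Longrightarrow> derivable T H' \<phi>"
  by (induction rule: derivable.induct) (auto intro: derivable.intros)

lemma derivable_empty: "derivable T {} \<phi> \<Longrightarrow> T \<turnstile> \<phi>"
  by (induction rule: derivable.induct) (auto intro: provable.intros)

lemma derivable_imp_refl: "derivable T H (\<phi> \<^bold>\<longrightarrow> \<phi>)"
proof -
  have "derivable T H (\<phi> \<^bold>\<longrightarrow> \<phi> \<^bold>\<longrightarrow> \<phi>)" "derivable T H (\<phi> \<^bold>\<longrightarrow> (\<phi> \<^bold>\<longrightarrow> \<phi>) \<^bold>\<longrightarrow> \<phi>)"
    "derivable T H ((\<phi> \<^bold>\<longrightarrow> (\<phi> \<^bold>\<longrightarrow> \<phi>) \<^bold>\<longrightarrow> \<phi>) \<^bold>\<longrightarrow> (\<phi> \<^bold>\<longrightarrow> \<phi> \<^bold>\<longrightarrow> \<phi>) \<^bold>\<longrightarrow> \<phi> \<^bold>\<longrightarrow> \<phi>)"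
    by (intro derivable_axiom logical_axiom.intros)+
  then show ?thesis by (blast intro: derivable.mp)
qed

text \<open>Holds with no proviso on the variables of \<open>\<phi>\<close>: generalization is
  confined to theorems of \<open>T\<close>, so no step that depends on hypotheses binds a
  variable.\<close>

lemma deduction:
  assumes "derivable T (insert \<phi> H) \<psi>"
  shows "derivable T H (\<phi> \<^bold>\<longrightarrow> \<psi>)"
  using assms
proof (induction rule: derivable.induct)
  case (global \<psi>)
  then show ?case by (meson derivable.global derivable.mp derivable_axiom logical_axiom.intros(1))
next
  case (hypothesis \<psi>)
  then show ?case
    using derivable_imp_refl
    by (metis insertE derivable.hypothesis derivable.mp derivable_axiom logical_axiom.intros(1))
next
  case (mp \<psi> \<chi>)
  then show ?case by (meson derivable.mp derivable_axiom logical_axiom.intros(2))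
qed

lemma derivable_deduction_iff: "derivable T H (\<phi> \<^bold>\<longrightarrow> \<psi>) \<longleftrightarrow> derivable T (insert \<phi> H) \<psi>"
proof
  assume "derivable T H (\<phi> \<^bold>\<longrightarrow> \<psi>)"
  then have "derivable T (insert \<phi> H) (\<phi> \<^bold>\<longrightarrow> \<psi>)" by (rule derivable_mono) blast
  then show "derivable T (insert \<phi> H) \<psi>" by (meson derivable.mp derivable.hypothesis insertI1)
qed (rule deduction)

lemma derivable_ex_falso:
  assumes "derivable T H \<phi>" "derivable T H (\<^bold>\<not> \<phi>)"
  shows "derivable T H \<psi>"
proof -
  have "derivable T H (\<^bold>\<not> \<psi> \<^bold>\<longrightarrow> \<^bold>\<not> \<phi>)"
    using assms(2) by (meson derivable.mp derivable_axiom logical_axiom.intros(1))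
  then show ?thesis
    using assms(1) by (meson derivable.mp derivable_axiom logical_axiom.intros(3))
qed

lemma derivable_by_contradiction:
  assumes "derivable T (insert (\<^bold>\<not> \<phi>) H) \<psi>" "derivable T (insert (\<^bold>\<not> \<phi>) H) (\<^bold>\<not> \<psi>)"
  shows "derivable T H \<phi>"
proof -
  \<comment> \<open>With no falsum among the primitives, an arbitrary theorem
    \<open>\<theta>\<close> takes its place: refuting it from the negation of \<open>\<phi>\<close>
    gives \<open>\<phi>\<close> by contraposition.\<close>
  obtain \<theta> where \<theta>: "derivable T H \<theta>" using derivable_imp_refl by blast
  have "derivable T (insert (\<^bold>\<not> \<phi>) H) (\<^bold>\<not> \<theta>)" using derivable_ex_falso[OF assms] .
  then have "derivable T H (\<^bold>\<not> \<phi> \<^bold>\<longrightarrow> \<^bold>\<not> \<theta>)" by (rule deduction)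
  then show ?thesis using \<theta> by (meson derivable.mp derivable_axiom logical_axiom.intros(3))
qed

lemma derivable_finite: "derivable T H \<phi> \<Longrightarrow> \<exists>F\<subseteq>H. finite F \<and> derivable T F \<phi>"
proof (induction rule: derivable.induct)
  case (global \<phi>)
  then show ?case by (meson derivable.global empty_subsetI finite.emptyI)
next
  case (hypothesis \<phi>)
  then show ?case by (intro exI[of _ "{\<phi>}"]) (auto intro: derivable.hypothesis)
next
  case (mp \<phi> \<psi>)
  then obtain F G where "F \<subseteq> H" "finite F" "derivable T F \<phi>"
    "G \<subseteq> H" "finite G" "derivable T G (\<phi> \<^bold>\<longrightarrow> \<psi>)" by blast
  then show ?case
    by (intro exI[of _ "F \<union> G"]) (auto intro: derivable.mp derivable_mono)
qed

text \<open>Distribution is not an axiom. Under one more binder, a lifted universal formula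
  instantiated at \<open>Var 0\<close> gives back its body; after generalization, the
  vacuous-quantifier axiom moves the two lifted antecedents out one after the other.\<close>

lemma provable_Forall_K: "T \<turnstile> Forall (\<phi> \<^bold>\<longrightarrow> \<psi>) \<^bold>\<longrightarrow> Forall \<phi> \<^bold>\<longrightarrow> Forall \<psi>"
proof -
  let ?A = "Forall (\<phi> \<^bold>\<longrightarrow> \<psi>)" and ?B = "Forall \<phi>"
  have ax: "T \<turnstile> lift (Forall \<chi>) \<^bold>\<longrightarrow> \<chi>" for \<chi>
  proof -
    have "case_nat (Var 0) (\<lambda>i. Var (Suc i)) = Var" by (auto split: nat.splits)
    then have "inst [Var 0] (subst (up (\<lambda>i. Var (Suc i))) \<chi>) = \<chi>"
      by (simp add: inst1_subst_up)
    then show ?thesis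
      by (metis lift_def subst.simps(4) logical logical_axiom.intros(4))
  qed
  have "derivable T {lift ?A, lift ?B} \<psi>"
    by (meson ax derivable.hypothesis derivable.mp derivable.global insertI1 insertI2)
  then have "derivable T {} (lift ?A \<^bold>\<longrightarrow> lift ?B \<^bold>\<longrightarrow> \<psi>)"
    by (simp add: derivable_deduction_iff insert_commute)
  then have "T \<turnstile> Forall (lift ?A \<^bold>\<longrightarrow> lift ?B \<^bold>\<longrightarrow> \<psi>)"
    by (simp add: derivable_empty generalization)
  then have "T \<turnstile> ?A \<^bold>\<longrightarrow> Forall (lift ?B \<^bold>\<longrightarrow> \<psi>)"
    by (meson logical logical_axiom.intros(5) modus_ponens)
  then have "derivable T {?B, ?A} (Forall \<psi>)"
    by (meson derivable.hypothesis derivable.mp derivable.global derivable_axiom insertI1 insertI2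
        logical_axiom.intros(5))
  then have "derivable T {} (?A \<^bold>\<longrightarrow> ?B \<^bold>\<longrightarrow> Forall \<psi>)"
    by (simp add: derivable_deduction_iff)
  then show ?thesis by (rule derivable_empty)
qed

text \<open>The substitution \<open>fresh y\<close> renames the variable \<open>y\<close> to the bound variable \<open>0\<close>.\<close>

definition fresh :: "nat \<Rightarrow> nat \<Rightarrow> tm"
  where "fresh y = (\<lambda>i. if i = y then Var 0 else Var (Suc i))"

text \<open>\<open>Forall\<close> binds index 0, so a named variable is first renamed to 0 while the
  others move up. A hypothesis without \<open>y\<close> is merely lifted and its quantifier is
  vacuous; modus ponens passes through by \<open>provable_Forall_K\<close>.\<close>

lemma derivable_generalization:
  assumes "derivable T H \<phi>" "\<forall>\<psi>\<in>T. sentence \<psi>" "\<forall>\<psi>\<in>H. y \<notin> fv \<psi>"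
  shows "derivable T H (Forall (subst (fresh y) \<phi>))"
  using assms(1)
proof (induction rule: derivable.induct)
  case (global \<phi>)
  then show ?case by (simp add: assms(2) derivable.global generalization provable_subst)
next
  case (hypothesis \<phi>)
  have "subst (fresh y) \<phi> = lift \<phi>"
    unfolding lift_def using hypothesis assms(3) by (intro subst_cong) (auto simp: fresh_def)
  moreover have "T \<turnstile> Forall (lift \<phi> \<^bold>\<longrightarrow> lift \<phi>)"
    by (meson derivable_empty derivable_imp_refl generalization)
  then have "T \<turnstile> \<phi> \<^bold>\<longrightarrow> Forall (lift \<phi>)"
    by (meson logical logical_axiom.intros(5) modus_ponens)
  ultimately show ?case
    using hypothesis by (metis derivable.hypothesis derivable.mp derivable.global)
next
  case (mp \<phi> \<psi>)
  then show ?case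
    by (metis derivable.mp derivable.global provable_Forall_K subst.simps(3))
qed

lemma derivable_Forall_fresh:
  assumes "derivable T H (inst [Var y] \<phi>)" "\<forall>\<psi>\<in>T. sentence \<psi>" "\<forall>\<psi>\<in>H. y \<notin> fv \<psi>"
    and "y \<notin> fv (Forall \<phi>)"
  shows "derivable T H (Forall \<phi>)"
proof -
  \<comment> \<open>Renaming \<open>y\<close> to 0 inverts the instantiation at
    \<open>Var y\<close>, because \<open>y\<close> is not free in
    \<open>Forall \<phi>\<close>.\<close>
  have "substt (fresh y) (case_nat (Var y) Var i) = Var i" if "i \<in> fv \<phi>" for i
    using that assms(4) by (cases i) (auto simp: fresh_def)
  then have "subst (fresh y) (inst [Var y] \<phi>) = \<phi>"
    using subst_cong[of \<phi> "\<lambda>i. substt (fresh y) (case_nat (Var y) Var i)" Var]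
    by (simp add: inst1 subst_subst)
  then show ?thesis using derivable_generalization[OF assms(1-3)] by simp
qed


section \<open>Models\<close>

locale arith_structure =
  fixes zero :: 'm and suc :: "'m \<Rightarrow> 'm" and add mul :: "'m \<Rightarrow> 'm \<Rightarrow> 'm"
begin

primrec evalt :: "(nat \<Rightarrow> 'm) \<Rightarrow> tm \<Rightarrow> 'm" where
  "evalt e (Var i) = e i"
| "evalt e Zero = zero"
| "evalt e (Succ t) = suc (evalt e t)"
| "evalt e (Plus s t) = add (evalt e s) (evalt e t)"
| "evalt e (Times s t) = mul (evalt e s) (evalt e t)"

primrec eval :: "(nat \<Rightarrow> 'm) \<Rightarrow> fm \<Rightarrow> bool" where
  "eval e (s \<^bold>= t) \<longleftrightarrow> evalt e s = evalt e t"
| "eval e (\<^bold>\<not> \<phi>) \<longleftrightarrow> \<not> eval e \<phi>"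
| "eval e (\<phi> \<^bold>\<longrightarrow> \<psi>) \<longleftrightarrow> (eval e \<phi> \<longrightarrow> eval e \<psi>)"
| "eval e (Forall \<phi>) \<longleftrightarrow> (\<forall>x. eval (case_nat x e) \<phi>)"

lemma evalt_cong: "(\<And>i. i \<in> fvt t \<Longrightarrow> e i = e' i) \<Longrightarrow> evalt e t = evalt e' t"
  by (induction t) auto

lemma eval_cong: "(\<And>i. i \<in> fv \<phi> \<Longrightarrow> e i = e' i) \<Longrightarrow> eval e \<phi> \<longleftrightarrow> eval e' \<phi>"
proof (induction \<phi> arbitrary: e e')
  case (Eq s t)
  then have "evalt e s = evalt e' s" "evalt e t = evalt e' t"
    by (auto intro!: evalt_cong)
  then show ?case by simp
next
  case (Imp \<phi> \<psi>)
  have "eval e \<phi> = eval e' \<phi>" "eval e \<psi> = eval e' \<psi>"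
    using Imp.prems by (auto intro!: Imp.IH)
  then show ?case by simp
next
  case (Forall \<phi>)
  have "eval (case_nat x e) \<phi> = eval (case_nat x e') \<phi>" for x
    using Forall.prems by (intro Forall.IH) (auto split: nat.splits)
  then show ?case by simp
next
  case (Neg \<phi>)
  have "eval e \<phi> = eval e' \<phi>" using Neg.prems by (intro Neg.IH) auto
  then show ?case by simp
qed

lemma evalt_substt: "evalt e (substt \<sigma> t) = evalt (\<lambda>i. evalt e (\<sigma> i)) t"
  by (induction t) auto

lemma eval_subst: "eval e (subst \<sigma> \<phi>) \<longleftrightarrow> eval (\<lambda>i. evalt e (\<sigma> i)) \<phi>"
proof (induction \<phi> arbitrary: e \<sigma>)
  case (Forall \<phi>)
  have "(\<lambda>i. evalt (case_nat x e) (up \<sigma> i)) = case_nat x (\<lambda>i. evalt e (\<sigma> i))" for x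
  proof
    show "evalt (case_nat x e) (up \<sigma> i) = case_nat x (\<lambda>i. evalt e (\<sigma> i)) i" for i
      by (cases i) (simp_all add: evalt_substt)
  qed
  then show ?case using Forall by simp
qed (simp_all add: evalt_substt)

lemma eval_lift: "eval (case_nat x e) (lift \<phi>) \<longleftrightarrow> eval e \<phi>"
  by (simp add: lift_def eval_subst)

lemma eval_inst1: "eval e (inst [t] \<phi>) \<longleftrightarrow> eval (case_nat (evalt e t) e) \<phi>"
proof -
  have "(\<lambda>i. evalt e (case_nat t Var i)) = case_nat (evalt e t) e"
    by (auto simp: fun_eq_iff split: nat.splits)
  then show ?thesis by (simp add: inst1 eval_subst)
qed

lemma eval_logical_axiom: "logical_axiom \<phi> \<Longrightarrow> eval e \<phi>"
  by (cases rule: logical_axiom.cases, assumption) (auto simp: eval_inst1 eval_lift)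

lemma soundness:
  assumes "T \<turnstile> \<phi>" "\<And>\<psi> e. \<psi> \<in> T \<Longrightarrow> eval e \<psi>"
  shows "eval e \<phi>"
  using assms by (induction arbitrary: e rule: provable.induct) (auto simp: eval_logical_axiom)

end


section \<open>Completeness\<close>

instance tm :: countable by countable_datatype
instance fm :: countable by countable_datatype

definition coherent :: "fm set \<Rightarrow> fm set \<Rightarrow> bool"
  where "coherent T H \<longleftrightarrow> (\<exists>\<phi>. \<not> derivable T H \<phi>)"

lemma coherentD: "coherent T H \<Longrightarrow> derivable T H \<phi> \<Longrightarrow> \<not> derivable T H (\<^bold>\<not> \<phi>)"
  by (meson coherent_def derivable_ex_falso)

lemma coherent_mono: "coherent T H' \<Longrightarrow> H \<subseteq> H' \<Longrightarrow> coherent T H"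
  by (meson coherent_def derivable_mono)

lemma incoherent_insert_neg: "\<not> coherent T (insert (\<^bold>\<not> \<phi>) H) \<Longrightarrow> derivable T H \<phi>"
  by (meson coherent_def derivable_by_contradiction)

lemma incoherent_insert:
  assumes "\<not> coherent T (insert \<phi> H)"
  shows "derivable T H (\<^bold>\<not> \<phi>)"
proof -
  \<comment> \<open>Double negation elimination, which is not among the axioms.\<close>
  have "derivable T (insert (\<^bold>\<not> \<^bold>\<not> \<phi>) H) \<phi>"
  proof (rule derivable_by_contradiction)
    show "derivable T (insert (\<^bold>\<not> \<phi>) (insert (\<^bold>\<not> \<^bold>\<not> \<phi>) H)) (\<^bold>\<not> \<phi>)"
      "derivable T (insert (\<^bold>\<not> \<phi>) (insert (\<^bold>\<not> \<^bold>\<not> \<phi>) H)) (\<^bold>\<not> \<^bold>\<not> \<phi>)"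
      by (simp_all add: derivable.hypothesis)
  qed
  moreover have "derivable T H (\<phi> \<^bold>\<longrightarrow> \<psi>)" for \<psi>
    using assms by (simp add: coherent_def deduction)
  then have "derivable T (insert (\<^bold>\<not> \<^bold>\<not> \<phi>) H) (\<phi> \<^bold>\<longrightarrow> \<psi>)" for \<psi>
    by (meson derivable_mono subset_insertI)
  ultimately have "derivable T (insert (\<^bold>\<not> \<^bold>\<not> \<phi>) H) \<psi>" for \<psi>
    by (meson derivable.mp)
  then show ?thesis by (meson derivable_by_contradiction)
qed

text \<open>Witnesses are free variables, so the language needs no new constants. Keeping the stages
  finite guarantees a variable outside all formulas present; by
  \<open>derivable_Forall_fresh\<close>, a contradiction from its use as witness would already
  refute \<open>\<chi>\<close>.\<close>

lemma Henkin_step: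
  assumes T: "\<forall>\<psi>\<in>T. sentence \<psi>" and "finite H" "coherent T H"
  shows "\<exists>H'. (finite H' \<and> coherent T H') \<and> H \<subseteq> H' \<and> (\<chi> \<in> H' \<or> \<not> coherent T (insert \<chi> H)) \<and>
    (\<forall>\<theta>. \<chi> = \<^bold>\<not> Forall \<theta> \<longrightarrow> \<chi> \<in> H' \<longrightarrow> (\<exists>y. \<^bold>\<not> inst [Var y] \<theta> \<in> H'))"
proof (cases "coherent T (insert \<chi> H)")
  case False
  then have "\<chi> \<notin> H" using assms(3) by (auto simp: insert_absorb)
  then show ?thesis using False assms by blast
next
  case True
  show ?thesis
  proof (cases "\<exists>\<theta>. \<chi> = \<^bold>\<not> Forall \<theta>")
    case False
    then show ?thesis using True assms by (intro exI[of _ "insert \<chi> H"]) auto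
  next
    case ex: True
    then obtain \<theta> where \<theta>: "\<chi> = \<^bold>\<not> Forall \<theta>" by blast
    have "finite (\<Union>\<psi>\<in>insert \<chi> H. fv \<psi>)" using assms(2) by (simp add: finite_fv)
    then obtain y where y: "y \<notin> (\<Union>\<psi>\<in>insert \<chi> H. fv \<psi>)" using ex_new_if_finite by blast
    have "coherent T (insert (\<^bold>\<not> inst [Var y] \<theta>) (insert \<chi> H))"
    proof (rule ccontr)
      assume "\<not> ?thesis"
      then have "derivable T (insert \<chi> H) (inst [Var y] \<theta>)" by (rule incoherent_insert_neg)
      then have "derivable T (insert \<chi> H) (Forall \<theta>)"
        using T y \<theta> by (intro derivable_Forall_fresh) auto
      moreover have "derivable T (insert \<chi> H) (\<^bold>\<not> Forall \<theta>)"
        using \<theta> by (simp add: derivable.hypothesis)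
      ultimately show False using True coherentD by blast
    qed
    then show ?thesis
      using assms(2) \<theta>
      by (intro exI[of _ "insert (\<^bold>\<not> inst [Var y] \<theta>) (insert \<chi> H)"]) auto
  qed
qed

lemma Henkin_extension:
  assumes T: "\<forall>\<psi>\<in>T. sentence \<psi>" and H: "finite H" "coherent T H"
  obtains W where "H \<subseteq> W" "coherent T W" "\<And>\<phi>. coherent T (insert \<phi> W) \<Longrightarrow> \<phi> \<in> W"
    "\<And>\<theta>. \<^bold>\<not> Forall \<theta> \<in> W \<Longrightarrow> \<exists>y. \<^bold>\<not> inst [Var y] \<theta> \<in> W"
proof -
  define Q where "Q = (\<lambda>n H H'. H \<subseteq> H' \<and>
    ((from_nat n :: fm) \<in> H' \<or> \<not> coherent T (insert (from_nat n) H)) \<and>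
    (\<forall>\<theta>. from_nat n = \<^bold>\<not> Forall \<theta> \<longrightarrow> from_nat n \<in> H' \<longrightarrow> (\<exists>y. \<^bold>\<not> inst [Var y] \<theta> \<in> H')))"
  have step: "\<exists>H'. (finite H' \<and> coherent T H') \<and> Q n H H'" if "finite H \<and> coherent T H" for H n
    using Henkin_step[OF T, of H "from_nat n"] that unfolding Q_def by blast
  have "\<exists>g. g 0 = H \<and> (\<forall>n. (finite (g n) \<and> coherent T (g n)) \<and> Q n (g n) (g (Suc n)))"
  proof -
    \<comment> \<open>The conjunct for \<open>n = 0\<close> pins the first stage to
      \<open>H\<close>, which dependent choice would leave open.\<close>
    have "\<exists>g. \<forall>n. ((n = 0 \<longrightarrow> g n = H) \<and> finite (g n) \<and> coherent T (g n)) \<and> Q n (g n) (g (Suc n))"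
      using H step
      by (intro dependent_nat_choice[where P = "\<lambda>n A. (n = 0 \<longrightarrow> A = H) \<and> finite A \<and> coherent T A"])
        auto
    then show ?thesis by auto
  qed
  then obtain g where g0: "g 0 = H" and g: "\<And>n. finite (g n)" "\<And>n. coherent T (g n)"
    "\<And>n. Q n (g n) (g (Suc n))" by blast
  have mono: "g m \<subseteq> g n" if "m \<le> n" for m n
    using g(3) that by (intro lift_Suc_mono_le[of g, OF _ that]) (simp add: Q_def)
  define W where "W = (\<Union>n. g n)"
  have fin: "\<exists>n. F \<subseteq> g n" if "finite F" "F \<subseteq> W" for F
    using that
  proof (induction F)
    case (insert x F)
    then obtain m n where "F \<subseteq> g n" "x \<in> g m" by (auto simp: W_def)
    then show ?case
      using mono[of n "max m n"] mono[of m "max m n"] by (intro exI[of _ "max m n"]) auto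
  qed simp
  show thesis
  proof
    show "H \<subseteq> W" using g0 by (auto simp: W_def)
    show "coherent T W"
    proof (rule ccontr)
      assume "\<not> coherent T W"
      then obtain F where "finite F" "F \<subseteq> W" "derivable T F Falsum"
        and "derivable T W (\<^bold>\<not> Falsum)"
        by (meson coherent_def derivable_finite)
      moreover from this obtain F' where "finite F'" "F' \<subseteq> W" "derivable T F' (\<^bold>\<not> Falsum)"
        by (meson derivable_finite)
      ultimately obtain n where "F \<union> F' \<subseteq> g n" "derivable T (F \<union> F') Falsum"
        "derivable T (F \<union> F') (\<^bold>\<not> Falsum)"
        using fin[of "F \<union> F'"] derivable_mono by (metis Un_subset_iff Un_upper1 Un_upper2 finite_Un)
      then show False using coherentD[OF g(2)] derivable_mono by blast
    qed
    show "\<phi> \<in> W" if "coherent T (insert \<phi> W)" for \<phi>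
    proof -
      \<comment> \<open>Each formula is treated at the stage numbered by its own code; if it is
        coherent with all of \<open>W\<close>, it was coherent with that stage and was
        added.\<close>
      let ?n = "to_nat \<phi>"
      have "insert \<phi> (g ?n) \<subseteq> insert \<phi> W" by (auto simp: W_def)
      then have "coherent T (insert \<phi> (g ?n))" using that coherent_mono by blast
      then have "\<phi> \<in> g (Suc ?n)" using g(3)[of ?n] by (simp add: Q_def)
      then show ?thesis by (auto simp: W_def)
    qed
    show "\<exists>y. \<^bold>\<not> inst [Var y] \<theta> \<in> W" if "\<^bold>\<not> Forall \<theta> \<in> W" for \<theta>
    proof -
      let ?\<chi> = "\<^bold>\<not> Forall \<theta>" let ?n = "to_nat ?\<chi>"
      have "insert ?\<chi> (g ?n) \<subseteq> W" using that by (auto simp: W_def)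
      then have "coherent T (insert ?\<chi> (g ?n))" using \<open>coherent T W\<close> coherent_mono by blast
      then have "\<exists>y. \<^bold>\<not> inst [Var y] \<theta> \<in> g (Suc ?n)" using g(3)[of ?n] by (simp add: Q_def)
      then show ?thesis by (auto simp: W_def)
    qed
  qed
qed

locale Henkin_set =
  fixes T W :: "fm set"
  assumes coherent: "coherent T W"
    and maximal: "coherent T (insert \<phi> W) \<Longrightarrow> \<phi> \<in> W"
    and witness: "\<^bold>\<not> Forall \<phi> \<in> W \<Longrightarrow> \<exists>y. \<^bold>\<not> inst [Var y] \<phi> \<in> W"
begin

lemma derivable_iff: "derivable T W \<phi> \<longleftrightarrow> \<phi> \<in> W"
proof
  assume \<phi>: "derivable T W \<phi>"
  have "\<not> derivable T W (\<^bold>\<not> \<phi>)" using coherentD[OF coherent \<phi>] .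
  then show "\<phi> \<in> W" using incoherent_insert maximal by blast
qed (rule derivable.hypothesis)

lemma neg_iff: "\<^bold>\<not> \<phi> \<in> W \<longleftrightarrow> \<phi> \<notin> W"
proof
  show "\<^bold>\<not> \<phi> \<in> W \<Longrightarrow> \<phi> \<notin> W"
    using coherentD[OF coherent, of \<phi>] by (auto simp: derivable_iff)
  show "\<^bold>\<not> \<phi> \<in> W" if "\<phi> \<notin> W"
    using that maximal incoherent_insert[of T \<phi> W] by (auto simp: derivable_iff)
qed

lemma imp_iff: "\<phi> \<^bold>\<longrightarrow> \<psi> \<in> W \<longleftrightarrow> (\<phi> \<in> W \<longrightarrow> \<psi> \<in> W)"
proof -
  have "\<psi> \<in> W" if "\<phi> \<^bold>\<longrightarrow> \<psi> \<in> W" "\<phi> \<in> W"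
    using that derivable.mp derivable_iff by blast
  moreover have "\<phi> \<^bold>\<longrightarrow> \<psi> \<in> W" if "\<psi> \<in> W"
    using that derivable.mp[of T W \<psi>] derivable_axiom[OF logical_axiom.intros(1)]
    by (simp flip: derivable_iff)
  moreover have "\<phi> \<^bold>\<longrightarrow> \<psi> \<in> W" if "\<phi> \<notin> W"
  proof -
    have "derivable T W (\<^bold>\<not> \<phi>)" using that by (simp add: derivable_iff neg_iff)
    then have "derivable T (insert \<phi> W) (\<^bold>\<not> \<phi>)" by (rule derivable_mono) blast
    then have "derivable T (insert \<phi> W) \<psi>"
      using derivable_ex_falso[of T _ \<phi>] by (meson derivable.hypothesis insertI1)
    then show ?thesis by (simp add: deduction flip: derivable_iff)
  qed
  ultimately show ?thesis by blast
qed

lemma axiom_mem: "logical_axiom \<phi> \<Longrightarrow> \<phi> \<in> W"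
  using derivable_axiom derivable_iff by blast

lemma Forall_iff: "Forall \<phi> \<in> W \<longleftrightarrow> (\<forall>t. inst [t] \<phi> \<in> W)"
proof
  show "Forall \<phi> \<in> W \<Longrightarrow> \<forall>t. inst [t] \<phi> \<in> W"
    using axiom_mem[OF logical_axiom.intros(4)] by (simp add: imp_iff)
  show "\<forall>t. inst [t] \<phi> \<in> W \<Longrightarrow> Forall \<phi> \<in> W"
    using witness[of \<phi>] by (auto simp: neg_iff)
qed

lemma eq_refl: "t \<^bold>= t \<in> W"
  by (simp add: axiom_mem logical_axiom.intros)

lemma eq_Leibniz: "s \<^bold>= t \<in> W \<Longrightarrow> inst [s] \<phi> \<in> W \<Longrightarrow> inst [t] \<phi> \<in> W"
  using axiom_mem[OF logical_axiom.intros(7)[of s t \<phi>]] by (simp add: imp_iff)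

text \<open>Leibniz's axiom for an equation with a hole: \<open>Var 0\<close> marks the places in
  \<open>u\<close> and \<open>v\<close> to be rewritten, and \<open>raise\<close> will protect the
  terms that must stay. Symmetry, transitivity and the congruences are all instances.\<close>

lemma eq_replace:
  assumes "s \<^bold>= t \<in> W" "substt (case_nat s Var) u \<^bold>= substt (case_nat s Var) v \<in> W"
  shows "substt (case_nat t Var) u \<^bold>= substt (case_nat t Var) v \<in> W"
  using eq_Leibniz[OF assms(1), of "u \<^bold>= v"] assms(2) by (simp add: inst1)

abbreviation raise :: "tm \<Rightarrow> tm" where "raise \<equiv> substt (\<lambda>i. Var (Suc i))"

lemma substt_raise: "substt (case_nat s Var) (raise t) = t"
  by (simp add: substt_substt)

lemma eq_sym: "s \<^bold>= t \<in> W \<Longrightarrow> t \<^bold>= s \<in> W"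
  using eq_replace[of s t "Var 0" "raise s"] by (simp add: substt_raise eq_refl)

lemma eq_trans: "s \<^bold>= t \<in> W \<Longrightarrow> t \<^bold>= u \<in> W \<Longrightarrow> s \<^bold>= u \<in> W"
  using eq_replace[of t u "raise s" "Var 0"] by (simp add: substt_raise)

lemma eq_Succ: "s \<^bold>= t \<in> W \<Longrightarrow> Succ s \<^bold>= Succ t \<in> W"
  using eq_replace[of s t "raise (Succ s)" "Succ (Var 0)"] by (simp add: substt_raise eq_refl)

lemma eq_Plus: "s \<^bold>= t \<in> W \<Longrightarrow> s' \<^bold>= t' \<in> W \<Longrightarrow> Plus s s' \<^bold>= Plus t t' \<in> W"
  using eq_replace[of s t "raise (Plus s s')" "Plus (Var 0) (raise s')"]
    eq_replace[of s' t' "raise (Plus s s')" "Plus (raise t) (Var 0)"]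
  by (simp add: substt_raise eq_refl)

lemma eq_Times: "s \<^bold>= t \<in> W \<Longrightarrow> s' \<^bold>= t' \<in> W \<Longrightarrow> Times s s' \<^bold>= Times t t' \<in> W"
  using eq_replace[of s t "raise (Times s s')" "Times (Var 0) (raise s')"]
    eq_replace[of s' t' "raise (Times s s')" "Times (raise t) (Var 0)"]
  by (simp add: substt_raise eq_refl)

end

text \<open>Truth lemma of the Henkin construction. Keeping the naming \<open>c\<close> of elements
  by terms abstract allows a universe other than the set of equality classes; quantifiers match
  because every element has a name.\<close>

lemma (in arith_structure) eval_Henkin:
  assumes "Henkin_set T W" and surj: "surj c" and c: "\<And>t u. c t = c u \<longleftrightarrow> t \<^bold>= u \<in> W"
    and ops: "c Zero = zero" "\<And>t. suc (c t) = c (Succ t)"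
      "\<And>t u. add (c t) (c u) = c (Plus t u)" "\<And>t u. mul (c t) (c u) = c (Times t u)"
  shows "eval (\<lambda>i. c (\<sigma> i)) \<phi> \<longleftrightarrow> subst \<sigma> \<phi> \<in> W"
proof -
  interpret Henkin_set T W by fact
  have evalt: "evalt (\<lambda>i. c (\<sigma> i)) t = c (substt \<sigma> t)" for \<sigma> t
    by (induction t) (simp_all add: ops)
  show ?thesis
  proof (induction \<phi> arbitrary: \<sigma>)
    case (Forall \<phi>)
    have "eval (\<lambda>i. c (\<sigma> i)) (Forall \<phi>) \<longleftrightarrow> (\<forall>t. eval (case_nat (c t) (\<lambda>i. c (\<sigma> i))) \<phi>)"
      using surj by (metis eval.simps(4) surjD)
    also have "\<dots> \<longleftrightarrow> (\<forall>t. eval (\<lambda>i. c (case_nat t \<sigma> i)) \<phi>)"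
    proof -
      have "case_nat (c t) (\<lambda>i. c (\<sigma> i)) = (\<lambda>i. c (case_nat t \<sigma> i))" for t
        by (auto simp: fun_eq_iff split: nat.splits)
      then show ?thesis by simp
    qed
    also have "\<dots> \<longleftrightarrow> (\<forall>t. inst [t] (subst (up \<sigma>) \<phi>) \<in> W)"
      by (simp add: Forall inst1_subst_up)
    finally show ?case by (simp add: Forall_iff)
  qed (simp_all add: evalt c neg_iff imp_iff)
qed

text \<open>The hypotheses on \<open>Succ\<close> make the term model infinite, so that its universe can be taken to be
  the whole type \<open>nat\<close>.\<close>

lemma completeness:
  fixes T :: "fm set"
  assumes T: "\<forall>\<psi>\<in>T. sentence \<psi>"
    and Succ: "T \<turnstile> \<^bold>\<not> (Succ (Var 0) \<^bold>= Zero)"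
      "T \<turnstile> Succ (Var 0) \<^bold>= Succ (Var 1) \<^bold>\<longrightarrow> Var 0 \<^bold>= Var 1"
    and valid: "\<And>(zero :: nat) suc add mul e.
      \<forall>\<psi>\<in>T. \<forall>e. arith_structure.eval zero suc add mul e \<psi> \<Longrightarrow>
      arith_structure.eval zero suc add mul e \<phi>"
  shows "T \<turnstile> \<phi>"
proof (rule ccontr)
  assume "\<not> T \<turnstile> \<phi>"
  then have "coherent T {\<^bold>\<not> \<phi>}" using incoherent_insert_neg[of T \<phi> "{}"] derivable_empty by blast
  then obtain W where W: "{\<^bold>\<not> \<phi>} \<subseteq> W" "coherent T W" "\<And>\<phi>. coherent T (insert \<phi> W) \<Longrightarrow> \<phi> \<in> W"
    "\<And>\<theta>. \<^bold>\<not> Forall \<theta> \<in> W \<Longrightarrow> \<exists>y. \<^bold>\<not> inst [Var y] \<theta> \<in> W"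
    using Henkin_extension[OF T] by (metis finite.emptyI finite.insertI)
  interpret Henkin_set T W by unfold_locales (use W in auto)
  define cl where "cl t = {u. t \<^bold>= u \<in> W}" for t
  have cl: "cl t = cl u \<longleftrightarrow> t \<^bold>= u \<in> W" for t u
    unfolding cl_def using eq_refl eq_sym eq_trans by blast
  have provable: "\<psi> \<in> W" if "T \<turnstile> \<psi>" for \<psi>
    using that derivable.global derivable_iff by blast
  have nz: "cl (Succ t) \<noteq> cl Zero" for t
    using provable[OF provable_subst[OF Succ(1) T, of "\<lambda>_. t"]] by (simp add: cl neg_iff)
  have inj: "cl t = cl u" if "cl (Succ t) = cl (Succ u)" for t u
    using provable[OF provable_subst[OF Succ(2) T, of "case_nat t (\<lambda>_. u)"]] that
    by (simp add: cl imp_iff)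
  \<comment> \<open>Successor induces on the classes an injection that misses the class of
    \<open>Zero\<close>, which is impossible on a finite set.\<close>
  have "infinite (range cl)"
  proof
    assume fin: "finite (range cl)"
    define h where "h X = cl (Succ (SOME t. cl t = X))" for X
    have h: "h (cl t) = cl (Succ t)" for t
    proof -
      have "cl (SOME u. cl u = cl t) = cl t" by (rule someI) (rule refl)
      then show ?thesis by (simp add: h_def cl eq_Succ)
    qed
    have "inj_on h (range cl)"
    proof (rule inj_onI)
      fix X Y assume "X \<in> range cl" "Y \<in> range cl" "h X = h Y"
      then obtain t u where "X = cl t" "Y = cl u" "cl (Succ t) = cl (Succ u)" by (auto simp: h)
      then show "X = Y" using inj[of t u] by simp
    qed
    moreover have "h ` range cl \<subseteq> range cl" using h by auto
    ultimately have "h ` range cl = range cl" using fin by (simp add: endo_inj_surj)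
    then have "cl Zero \<in> h ` range cl" by blast
    then show False using h nz by fastforce
  qed
  then have bij: "bij_betw (to_nat_on (range cl)) (range cl) UNIV"
    by (simp add: to_nat_on_infinite)
  define c where "c t = to_nat_on (range cl) (cl t)" for t
  have c: "c t = c u \<longleftrightarrow> t \<^bold>= u \<in> W" for t u
    using bij by (auto simp: c_def cl[symmetric] bij_betw_def inj_on_eq_iff)
  have surj: "surj c" using bij by (auto simp: c_def bij_betw_def surj_def image_iff)
  \<comment> \<open>\<open>r\<close> picks a term for each number; the operations of the model
    compute on these terms and return to numbers through \<open>c\<close>.\<close>
  define r where "r = inv c"
  have r: "c (r x) = x" for x using surj by (simp add: r_def surj_f_inv_f)
  then have rc: "r (c t) \<^bold>= t \<in> W" for t using c by blast
  interpret arith_structure "c Zero" "\<lambda>x. c (Succ (r x))" "\<lambda>x y. c (Plus (r x) (r y))"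
    "\<lambda>x y. c (Times (r x) (r y))" .
  have eval: "eval (\<lambda>i. c (\<sigma> i)) \<psi> \<longleftrightarrow> subst \<sigma> \<psi> \<in> W" for \<sigma> \<psi>
    by (rule eval_Henkin[OF Henkin_set_axioms surj c]) (simp_all add: c rc eq_Succ eq_Plus eq_Times)
  have "eval e \<psi>" if "\<psi> \<in> T" for e \<psi>
    using eval[of "\<lambda>i. r (e i)" \<psi>] that T by (simp add: r subst_sentence provable nonlogical)
  then have "eval (\<lambda>i. c (Var i)) \<phi>" using valid by blast
  then have "\<phi> \<in> W" using eval[of Var \<phi>] by simp
  then show False using W(1) neg_iff by auto
qed


section \<open>Models of Peano arithmetic\<close>

lemma fv_Foralls: "fv ((Forall ^^ n) \<phi>) = {i. i + n \<in> fv \<phi>}"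
  by (induction n) auto

lemma PA_sentence: "\<psi> \<in> PA \<Longrightarrow> sentence \<psi>"
  by (auto simp: PA_def)

lemma PA_closure:
  assumes "PA_matrix \<phi>"
  obtains n where "(Forall ^^ n) \<phi> \<in> PA"
proof -
  obtain n where n: "fv \<phi> \<subseteq> {..<n}" using finite_nat_bounded[OF finite_fv] by blast
  then have "sentence ((Forall ^^ n) \<phi>)" by (auto simp: sentence_def fv_Foralls)
  then show thesis using assms that[of n] by (auto simp: PA_def)
qed

text \<open>Raising all variables before instantiating at \<open>Var 0\<close> restores the body
  itself, with its free variables in place.\<close>

lemma provable_ForallD:
  assumes "T \<turnstile> Forall \<phi>" "\<forall>\<psi>\<in>T. sentence \<psi>"
  shows "T \<turnstile> \<phi>"
proof -
  have "case_nat (Var 0) (\<lambda>i. Var (Suc i)) = Var" by (auto split: nat.splits)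
  then have "inst [Var 0] (subst (up (\<lambda>i. Var (Suc i))) \<phi>) = \<phi>"
    by (simp add: inst1_subst_up)
  moreover have "T \<turnstile> Forall (subst (up (\<lambda>i. Var (Suc i))) \<phi>)"
    using provable_subst[OF assms] by simp
  ultimately show ?thesis by (metis logical logical_axiom.intros(4) modus_ponens)
qed

lemma PA_matrix_provable:
  assumes "PA_matrix \<phi>"
  shows "PA \<turnstile> \<phi>"
proof -
  obtain n where "(Forall ^^ n) \<phi> \<in> PA" using PA_closure[OF assms] by blast
  then have "PA \<turnstile> (Forall ^^ n) \<phi>" by (rule nonlogical)
  then show ?thesis by (induction n) (auto simp: PA_sentence dest: provable_ForallD)
qed

locale PA_model = arith_structure zero suc add mul
  for zero :: 'm and suc add mul +
  assumes PA: "\<psi> \<in> PA \<Longrightarrow> eval e \<psi>"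
begin

lemma provable_eval: "PA \<turnstile> \<phi> \<Longrightarrow> eval e \<phi>"
  using PA soundness by blast

end

text \<open>A premise that ranges over all models has to fix the type of their elements. Countable
  models suffice, and the two successor axioms make the term model infinite.\<close>

theorem PA_completeness:
  assumes "\<And>(zero :: nat) suc add mul e. PA_model zero suc add mul \<Longrightarrow>
    arith_structure.eval zero suc add mul e \<phi>"
  shows "PA \<turnstile> \<phi>"
  using completeness[of PA \<phi>] PA_matrix_provable[OF PA_matrix.intros(1)]
    PA_matrix_provable[OF PA_matrix.intros(2)] PA_sentence assms
  by (auto simp: PA_model_def)

primrec env :: "'a list \<Rightarrow> (nat \<Rightarrow> 'a) \<Rightarrow> nat \<Rightarrow> 'a" where
  "env [] e = e"
| "env (x # xs) e = case_nat x (env xs e)"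

lemma env_nth: "env xs e i = (if i < length xs then xs ! i else e (i - length xs))"
  by (induction xs arbitrary: i) (auto split: nat.splits)

context PA_model
begin

notation zero (\<open>\<zero>\<close>) and add (infixl \<open>\<oplus>\<close> 65) and mul (infixl \<open>\<otimes>\<close> 70)

abbreviation one (\<open>\<one>\<close>) where "\<one> \<equiv> suc \<zero>"

text \<open>The environment \<open>e\<close> supplies parameters, possibly nonstandard elements, so
  this is definability with parameters.\<close>

definition definable :: "('m \<Rightarrow> bool) \<Rightarrow> bool"
  where "definable P \<longleftrightarrow> (\<exists>\<phi> e. \<forall>x. eval (case_nat x e) \<phi> \<longleftrightarrow> P x)"

text \<open>The parameters \<open>xs\<close> become \<open>Var 1\<close>, \<open>Var 2\<close>, ...
  of the formula, and the induction variable is \<open>Var 0\<close>.\<close>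

lemma definableI: "(\<And>x. eval (case_nat x (env xs (\<lambda>_. \<zero>))) \<phi> \<longleftrightarrow> P x) \<Longrightarrow> definable P"
  unfolding definable_def by blast

lemma PA_axiom: "PA_matrix \<phi> \<Longrightarrow> eval e \<phi>"
  by (simp add: PA_matrix_provable provable_eval)

lemma suc_neq_zero [simp]: "suc x \<noteq> \<zero>" "\<zero> \<noteq> suc x"
  using PA_axiom[OF PA_matrix.intros(1), of "env [x] e" for e] by auto

lemma suc_inject [simp]: "suc x = suc y \<longleftrightarrow> x = y"
  using PA_axiom[OF PA_matrix.intros(2), of "env [x, y] e" for e] by auto

lemma add_zero [simp]: "x \<oplus> \<zero> = x"
  using PA_axiom[OF PA_matrix.intros(3), of "env [x] e" for e] by simp

lemma add_suc [simp]: "x \<oplus> suc y = suc (x \<oplus> y)"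
  using PA_axiom[OF PA_matrix.intros(4), of "env [x, y] e" for e] by simp

lemma mul_zero [simp]: "x \<otimes> \<zero> = \<zero>"
  using PA_axiom[OF PA_matrix.intros(5), of "env [x] e" for e] by simp

lemma mul_suc [simp]: "x \<otimes> suc y = x \<otimes> y \<oplus> x"
  using PA_axiom[OF PA_matrix.intros(6), of "env [x, y] e" for e] by simp

lemma induction [case_names definable zero suc]:
  assumes "definable P" "P \<zero>" "\<And>x. P x \<Longrightarrow> P (suc x)"
  shows "P x"
proof -
  obtain \<phi> e where \<phi>: "\<And>x. eval (case_nat x e) \<phi> \<longleftrightarrow> P x"
    using assms(1) unfolding definable_def by blast
  have "(\<lambda>i. evalt (case_nat x e) (case i of 0 \<Rightarrow> Succ (Var 0) | Suc i \<Rightarrow> Var (Suc i))) =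
      case_nat (suc x) e" for x
    by (auto simp: fun_eq_iff split: nat.splits)
  then show ?thesis
    using PA_axiom[OF PA_matrix.intros(7)[of \<phi>], of e] assms(2,3)
    by (simp add: eval_inst1 eval_subst \<phi>)
qed

section \<open>Semiring laws in a model\<close>

lemma zero_add: "\<zero> \<oplus> x = x"
proof (induction x rule: induction)
  case definable
  show ?case by (rule definableI[of "[]" "Plus Zero (Var 0) \<^bold>= Var 0"]) simp
qed simp_all

lemma suc_add: "suc y \<oplus> x = suc (y \<oplus> x)"
proof (induction x rule: induction)
  case definable
  show ?case
    by (rule definableI[of "[y]" "Plus (Succ (Var 1)) (Var 0) \<^bold>= Succ (Plus (Var 1) (Var 0))"]) simp
qed simp_all

lemma add_commutes: "y \<oplus> x = x \<oplus> y"
proof (induction x rule: induction)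
  case definable
  show ?case
    by (rule definableI[of "[y]" "Plus (Var 1) (Var 0) \<^bold>= Plus (Var 0) (Var 1)"]) simp
qed (simp_all add: zero_add suc_add)

lemma add_associates: "y \<oplus> z \<oplus> x = y \<oplus> (z \<oplus> x)"
proof (induction x rule: induction)
  case definable
  show ?case
    by (rule definableI[of "[y, z]"
          "Plus (Plus (Var 1) (Var 2)) (Var 0) \<^bold>= Plus (Var 1) (Plus (Var 2) (Var 0))"])
      (simp add: numeral_2_eq_2)
qed simp_all

lemma zero_mul: "\<zero> \<otimes> x = \<zero>"
proof (induction x rule: induction)
  case definable
  show ?case by (rule definableI[of "[]" "Times Zero (Var 0) \<^bold>= Zero"]) simp
qed simp_all

lemma suc_mul: "suc y \<otimes> x = y \<otimes> x \<oplus> x"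
proof (induction x rule: induction)
  case definable
  show ?case
    by (rule definableI[of "[y]"
          "Times (Succ (Var 1)) (Var 0) \<^bold>= Plus (Times (Var 1) (Var 0)) (Var 0)"]) simp
next
  case (suc x)
  then show ?case by (simp add: add_associates add_commutes[of x y])
qed simp_all

lemma mul_commutes: "y \<otimes> x = x \<otimes> y"
proof (induction x rule: induction)
  case definable
  show ?case
    by (rule definableI[of "[y]" "Times (Var 1) (Var 0) \<^bold>= Times (Var 0) (Var 1)"]) simp
qed (simp_all add: zero_mul suc_mul)

lemma mul_distributes: "y \<otimes> (z \<oplus> x) = y \<otimes> z \<oplus> y \<otimes> x"
proof (induction x rule: induction)
  case definable
  show ?case
    by (rule definableI[of "[y, z]" "Times (Var 1) (Plus (Var 2) (Var 0)) \<^bold>=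
          Plus (Times (Var 1) (Var 2)) (Times (Var 1) (Var 0))"])
      (simp add: numeral_2_eq_2)
qed (simp_all add: add_associates)

lemma mul_associates: "y \<otimes> z \<otimes> x = y \<otimes> (z \<otimes> x)"
proof (induction x rule: induction)
  case definable
  show ?case
    by (rule definableI[of "[y, z]"
          "Times (Times (Var 1) (Var 2)) (Var 0) \<^bold>= Times (Var 1) (Times (Var 2) (Var 0))"])
      (simp add: numeral_2_eq_2)
qed (simp_all add: mul_distributes)

lemma add_cancels: "y \<oplus> x = z \<oplus> x \<Longrightarrow> y = z"
proof (induction x rule: induction)
  case definable
  show ?case
    by (rule definableI[of "[y, z]" "Plus (Var 1) (Var 0) \<^bold>= Plus (Var 2) (Var 0) \<^bold>\<longrightarrow> Var 1 \<^bold>= Var 2"])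
      (simp add: numeral_2_eq_2)
qed simp_all

lemma zero_or_suc: "x = \<zero> \<or> (\<exists>y. x = suc y)"
proof (induction x rule: induction)
  case definable
  show ?case
    by (rule definableI[of "[]" "Var 0 \<^bold>= Zero \<^bold>\<or> Exists (Var 1 \<^bold>= Succ (Var 0))"]) auto
qed simp_all

lemma suc_exhaust [case_names zero suc]:
  obtains "x = \<zero>" | y where "x = suc y"
  using zero_or_suc by blast

section \<open>Order and truncated subtraction in a model\<close>

definition le (infix \<open>\<preceq>\<close> 50) where "x \<preceq> y \<longleftrightarrow> (\<exists>z. x \<oplus> z = y)"
definition lt (infix \<open>\<prec>\<close> 50) where "x \<prec> y \<longleftrightarrow> (\<exists>z. x \<oplus> suc z = y)"
text \<open>An operation that the class \<open>linordered_semidom\<close> requires; the described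
  element is unique by cancellation.\<close>

definition sub (infixl \<open>\<ominus>\<close> 65) where "x \<ominus> y = (if y \<preceq> x then THE z. y \<oplus> z = x else \<zero>)"

lemma add_left_cancels: "x \<oplus> y = x \<oplus> z \<longleftrightarrow> y = z"
  using add_cancels by (metis add_commutes)

lemma add_eq_zero: "x \<oplus> y = \<zero> \<Longrightarrow> x = \<zero> \<and> y = \<zero>"
  by (cases y rule: suc_exhaust) auto

lemma add_eq_self: "x \<oplus> y = x \<Longrightarrow> y = \<zero>"
  using add_left_cancels[of x y \<zero>] by simp

lemma le_total: "y \<preceq> x \<or> x \<preceq> y"
proof (induction x rule: induction)
  case definable
  show ?case
    by (rule definableI[of "[y]"
          "Exists (Plus (Var 2) (Var 0) \<^bold>= Var 1) \<^bold>\<or> Exists (Plus (Var 1) (Var 0) \<^bold>= Var 2)"])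
      (auto simp add: numeral_2_eq_2 le_def)
next
  case zero
  show ?case by (auto simp: le_def zero_add)
next
  case (suc x)
  show ?case
  proof (cases "y \<preceq> x")
    case True
    then show ?thesis unfolding le_def by (metis add_suc)
  next
    case False
    then obtain z where z: "x \<oplus> z = y" using suc by (auto simp: le_def)
    have "z \<noteq> \<zero>" using False z add_zero[of x] by (metis le_def)
    then obtain w where "z = suc w" using zero_or_suc by blast
    then show ?thesis using z by (auto simp: le_def suc_add)
  qed
qed

lemma le_antisym: "x \<preceq> y \<Longrightarrow> y \<preceq> x \<Longrightarrow> x = y"
  unfolding le_def by (metis add_associates add_eq_self add_eq_zero add_zero)

lemma le_trans: "x \<preceq> y \<Longrightarrow> y \<preceq> z \<Longrightarrow> x \<preceq> z"
  unfolding le_def by (metis add_associates)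

lemma lt_iff: "x \<prec> y \<longleftrightarrow> x \<preceq> y \<and> \<not> y \<preceq> x"
proof
  assume "x \<prec> y"
  then obtain z where z: "x \<oplus> suc z = y" by (auto simp: lt_def)
  then have "x \<preceq> y" by (auto simp: le_def simp del: add_suc)
  moreover have "x \<noteq> y" using z add_eq_self[of x "suc z"] by auto
  ultimately show "x \<preceq> y \<and> \<not> y \<preceq> x" using le_antisym by blast
next
  assume "x \<preceq> y \<and> \<not> y \<preceq> x"
  then obtain z where z: "x \<oplus> z = y" "\<not> y \<preceq> x" by (auto simp: le_def)
  then have "z \<noteq> \<zero>" using add_zero[of x] by (metis le_def)
  then show "x \<prec> y" using z by (cases z rule: suc_exhaust) (auto simp: lt_def)
qed

lemma add_sub: "(x \<oplus> y) \<ominus> x = y"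
  by (auto simp: sub_def le_def add_left_cancels)

lemma sub_eq_zero: "x \<preceq> y \<Longrightarrow> x \<ominus> y = \<zero>"
  using le_antisym[of x y] add_sub[of x \<zero>] by (auto simp: sub_def)

lemma mul_sub: "x \<otimes> (y \<ominus> z) = x \<otimes> y \<ominus> x \<otimes> z"
proof (cases "z \<preceq> y")
  case True
  then obtain v where "y = z \<oplus> v" by (auto simp: le_def)
  then show ?thesis by (simp add: add_sub mul_distributes)
next
  case False
  then obtain v where v: "z = y \<oplus> v" using le_total by (metis le_def)
  then have "x \<otimes> y \<preceq> x \<otimes> z" by (auto simp: le_def mul_distributes)
  moreover have "y \<preceq> z" using v by (auto simp: le_def)
  ultimately show ?thesis by (simp add: sub_eq_zero)
qed

lemma mul_eq_zero: "x \<otimes> y = \<zero> \<Longrightarrow> x = \<zero> \<or> y = \<zero>"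
  by (cases x rule: suc_exhaust; cases y rule: suc_exhaust) auto

lemma mul_lt: "x \<prec> y \<Longrightarrow> \<zero> \<prec> z \<Longrightarrow> z \<otimes> x \<prec> z \<otimes> y"
proof -
  assume "x \<prec> y" "\<zero> \<prec> z"
  then obtain d w where "y = x \<oplus> suc d" "z = suc w" by (auto simp: lt_def)
  then have "z \<otimes> y = z \<otimes> x \<oplus> suc (z \<otimes> d \<oplus> w)"
    by (simp add: mul_distributes add_associates)
  then show ?thesis unfolding lt_def by metis
qed

text \<open>Makes the library's algebra and order reasoning for semirings available for the elements
  of an arbitrary model.\<close>

sublocale ordered: linordered_semidom add sub le lt zero mul one
proof unfold_locales
  show "x \<oplus> y \<oplus> z = x \<oplus> (y \<oplus> z)" for x y z by (rule add_associates)
  show "x \<oplus> y = y \<oplus> x" for x y by (rule add_commutes)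
  show "x \<otimes> y \<otimes> z = x \<otimes> (y \<otimes> z)" for x y z by (rule mul_associates)
  show "x \<otimes> y = y \<otimes> x" for x y by (rule mul_commutes)
  show "(x \<oplus> y) \<otimes> z = x \<otimes> z \<oplus> y \<otimes> z" for x y z
    by (simp add: mul_distributes mul_commutes[of _ z])
  show "x \<ominus> y \<ominus> z = x \<ominus> (y \<oplus> z)" for x y z
  proof (cases "y \<oplus> z \<preceq> x")
    case True
    then obtain w where "x = y \<oplus> (z \<oplus> w)" by (auto simp: le_def add_associates)
    then show ?thesis by (metis add_sub add_associates)
  next
    case False
    then have "x \<ominus> (y \<oplus> z) = \<zero>" by (simp add: sub_def)
    moreover have "v \<ominus> z = \<zero>" if "x = y \<oplus> v" for v
      using False that by (auto simp: sub_def le_def add_associates)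
    moreover have "\<zero> \<ominus> z = \<zero>"
    proof (cases "z = \<zero>")
      case True
      then show ?thesis using add_sub[of \<zero> \<zero>] by simp
    next
      case False
      then have "\<not> z \<preceq> \<zero>" using add_eq_zero by (metis le_def)
      then show ?thesis by (simp add: sub_def)
    qed
    moreover have "x \<ominus> y = \<zero> \<or> (\<exists>v. x = y \<oplus> v \<and> x \<ominus> y = v)"
      using add_sub[of y] le_def[of y x] sub_def[of x y] by metis
    ultimately show ?thesis by metis
  qed
  show "x \<prec> y \<longleftrightarrow> x \<preceq> y \<and> \<not> y \<preceq> x" for x y by (rule lt_iff)
  show "x \<preceq> y \<or> y \<preceq> x" for x y by (rule le_total)
  show "x \<preceq> y \<Longrightarrow> z \<oplus> x \<preceq> z \<oplus> y" for x y z unfolding le_def by (metis add_associates)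
  show "x \<preceq> x" for x unfolding le_def by (metis add_zero)
  show "x \<prec> y \<Longrightarrow> \<zero> \<prec> z \<Longrightarrow> z \<otimes> x \<prec> z \<otimes> y" for x y z by (rule mul_lt)
  show "x \<otimes> (y \<ominus> z) = x \<otimes> y \<ominus> x \<otimes> z" for x y z by (rule mul_sub)
  show "x \<noteq> \<zero> \<Longrightarrow> y \<noteq> \<zero> \<Longrightarrow> x \<otimes> y \<noteq> \<zero>" for x y using mul_eq_zero by blast
  show "\<zero> \<prec> \<one>" unfolding lt_def by (metis zero_add)
  show "y \<preceq> x \<Longrightarrow> x \<ominus> y \<oplus> y = x" for x y using add_sub add_commutes by (metis le_def)
qed (auto simp: zero_add zero_mul suc_mul mul_distributes add_sub intro: le_antisym le_trans)

declare suc_add [simp] suc_mul [simp]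

lemma not_lt_zero [simp]: "\<not> x \<prec> \<zero>"
  by (auto simp: lt_def)

lemma zero_lt_suc [simp]: "\<zero> \<prec> suc x"
  unfolding lt_def by (metis zero_add)

lemma suc_lt_suc [simp]: "suc x \<prec> suc y \<longleftrightarrow> x \<prec> y"
  by (auto simp: lt_def)

lemma lt_suc_iff_le: "x \<prec> suc y \<longleftrightarrow> x \<preceq> y"
  by (auto simp: lt_def le_def)

lemma lt_suc_iff: "x \<prec> suc y \<longleftrightarrow> x \<prec> y \<or> x = y"
  by (simp add: lt_suc_iff_le ordered.le_less)

lemma suc_le_iff: "suc x \<preceq> y \<longleftrightarrow> x \<prec> y"
  by (auto simp: lt_def le_def)

lemma lt_add_suc: "x \<prec> x \<oplus> suc y"
  unfolding lt_def by blast

lemma le_add: "x \<preceq> x \<oplus> y" "x \<preceq> y \<oplus> x"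
  unfolding le_def using add_commutes by metis+


section \<open>The beta function\<close>

text \<open>Used to read off the meaning of each arithmetized predicate, since all of them are
  instances of a fixed body.\<close>

lemma eval_inst: "eval e (inst ts \<phi>) \<longleftrightarrow> eval (env (map (evalt e) ts) e) \<phi>"
proof -
  have "evalt e (if i < length ts then ts ! i else Var (i - length ts)) = env (map (evalt e) ts) e i"
    for i
    by (simp add: env_nth)
  then show ?thesis by (simp add: inst_def eval_subst)
qed

lemma exs_simps [simp]: "exs 0 \<phi> = \<phi>" "exs (Suc n) \<phi> = Exists (exs n \<phi>)"
  "exs (numeral k) \<phi> = Exists (exs (pred_numeral k) \<phi>)"
  by (simp_all add: exs_def numeral_eq_Suc)

lemma eval_Less [simp]: "eval e (Less s t) \<longleftrightarrow> evalt e s \<prec> evalt e t"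
  by (simp add: Less_def eval_inst lt_def Let_def)

lemma division:
  assumes "\<zero> \<prec> m"
  shows "\<exists>q r. x = q \<otimes> m \<oplus> r \<and> r \<prec> m"
proof (induction x rule: induction)
  case definable
  show ?case
    by (rule definableI[of "[m]" "Exists (Exists
          (Var 2 \<^bold>= Plus (Times (Var 1) (Var 3)) (Var 0) \<^bold>\<and> Less (Var 0) (Var 3)))"]) simp
next
  case zero
  show ?case using assms by (intro exI[of _ \<zero>]) (simp add: zero_add)
next
  case (suc x)
  then obtain q r where qr: "x = q \<otimes> m \<oplus> r" "r \<prec> m" by blast
  show ?case
  proof (cases "suc r \<prec> m")
    case True
    then show ?thesis using qr by (intro exI[of _ q] exI[of _ "suc r"]) simp
  next
    case False
    then have "suc r = m" using qr(2) by (meson suc_le_iff ordered.le_less)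
    then have "suc x = suc q \<otimes> m \<oplus> \<zero>" using qr(1) by (metis add_suc add_zero suc_mul)
    then show ?thesis using assms by blast
  qed
qed

lemma remainder_unique:
  assumes "q \<otimes> m \<oplus> r = q' \<otimes> m \<oplus> r'" "r \<prec> m" "r' \<prec> m"
  shows "r = r'"
proof -
  have *: "r = r'" if "q \<otimes> m \<oplus> r = q' \<otimes> m \<oplus> r'" "r \<prec> m" "q \<preceq> q'" for q r q' r'
  proof -
    obtain d where d: "q' = q \<oplus> d" using \<open>q \<preceq> q'\<close> by (auto simp: le_def)
    then have "q \<otimes> m \<oplus> r = q \<otimes> m \<oplus> (d \<otimes> m \<oplus> r')"
      using that(1) by (simp add: algebra_simps)
    then have r: "r = d \<otimes> m \<oplus> r'" by (simp only: add_left_cancels)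
    have "d = \<zero>"
    proof (cases d rule: suc_exhaust)
      case (suc w)
      then have "m \<preceq> r" using r le_add by (simp add: algebra_simps)
      then show ?thesis using that(2) by order
    qed
    then show ?thesis using r by (simp add: zero_add zero_mul)
  qed
  show ?thesis
    using *[of q r q' r'] *[of q' r' q r] assms le_total[of q q'] by auto
qed

definition modulus :: "'m \<Rightarrow> 'm \<Rightarrow> 'm"
  where "modulus b i = suc (suc i \<otimes> b)"

definition beta :: "'m \<Rightarrow> 'm \<Rightarrow> 'm \<Rightarrow> 'm \<Rightarrow> bool"
  where "beta a b i x \<longleftrightarrow> (\<exists>q. a = q \<otimes> modulus b i \<oplus> x \<and> x \<prec> modulus b i)"

lemma eval_Beta [simp]:
  "eval e (Beta a b i x) \<longleftrightarrow> beta (evalt e a) (evalt e b) (evalt e i) (evalt e x)"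
  by (simp add: Beta_def eval_inst beta_def modulus_def Let_def)

lemma beta_total: "\<exists>x. beta a b i x"
  using division[of "modulus b i" a] by (auto simp: beta_def modulus_def)

lemma beta_unique: "beta a b i x \<Longrightarrow> beta a b i y \<Longrightarrow> x = y"
  using remainder_unique by (auto simp: beta_def)

lemma beta_le: "beta a b i x \<Longrightarrow> x \<preceq> a"
  using le_add by (auto simp: beta_def)

text \<open>Invertibility modulo \<open>m\<close>, written without subtraction. It replaces
  coprimality, so that neither common divisors nor primes have to be developed inside the
  model.\<close>

definition unit_mod :: "'m \<Rightarrow> 'm \<Rightarrow> bool"
  where "unit_mod x m \<longleftrightarrow> (\<exists>u v. u \<otimes> x = v \<otimes> m \<oplus> \<one>)"

lemma unit_mod_mul:
  assumes "unit_mod x m" "unit_mod y m"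
  shows "unit_mod (x \<otimes> y) m"
proof -
  obtain u v u' v' where uv: "u \<otimes> x = v \<otimes> m \<oplus> \<one>" "u' \<otimes> y = v' \<otimes> m \<oplus> \<one>"
    using assms by (auto simp: unit_mod_def)
  have "u \<otimes> u' \<otimes> (x \<otimes> y) = (u \<otimes> x) \<otimes> (u' \<otimes> y)" by (simp add: algebra_simps)
  also have "\<dots> = (v \<otimes> v' \<otimes> m \<oplus> v \<oplus> v') \<otimes> m \<oplus> \<one>" unfolding uv by (simp add: algebra_simps)
  finally show ?thesis unfolding unit_mod_def by blast
qed

text \<open>With \<open>k = i + d\<close>, \<open>(k + 1) m\<^sub>i = (i + 1) m\<^sub>k + d\<close>; multiplying by \<open>e\<close>, where \<open>d e = b\<close>, and by
  \<open>k + 1\<close> leaves the remainder \<open>(k + 1) b = m\<^sub>k - 1\<close>, whose square is \<open>1\<close> modulo \<open>m\<^sub>k\<close>.\<close>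

lemma unit_mod_modulus:
  assumes "suc d \<otimes> e = b" "\<zero> \<prec> b"
  shows "unit_mod (modulus b i) (modulus b (i \<oplus> suc d))"
proof -
  let ?k = "i \<oplus> suc d" let ?n = "suc ?k \<otimes> b"
  obtain b' where b': "b = suc b'" using assms(2) by (cases b rule: suc_exhaust) auto
  obtain n where n: "?n = suc n" using b' by simp
  have "e \<otimes> suc ?k \<otimes> suc ?k \<otimes> modulus b i = e \<otimes> suc ?k \<otimes> suc i \<otimes> modulus b ?k \<oplus> suc ?k \<otimes> (suc d \<otimes> e)"
    unfolding modulus_def by (simp add: algebra_simps)
  also have "\<dots> = e \<otimes> suc ?k \<otimes> suc i \<otimes> modulus b ?k \<oplus> suc n"
    unfolding assms(1) n ..
  finally have "suc n \<otimes> (e \<otimes> suc ?k \<otimes> suc ?k \<otimes> modulus b i) =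
      suc n \<otimes> (e \<otimes> suc ?k \<otimes> suc i) \<otimes> modulus b ?k \<oplus> suc n \<otimes> suc n"
    by (simp only: algebra_simps)
  also have "suc n \<otimes> suc n = n \<otimes> modulus b ?k \<oplus> \<one>"
    unfolding modulus_def n by (simp add: algebra_simps)
  finally have "suc n \<otimes> (e \<otimes> suc ?k \<otimes> suc ?k) \<otimes> modulus b i =
      (suc n \<otimes> (e \<otimes> suc ?k \<otimes> suc i) \<oplus> n) \<otimes> modulus b ?k \<oplus> \<one>"
    by (simp only: algebra_simps)
  then show ?thesis unfolding unit_mod_def by blast
qed

text \<open>Takes the place of the factorial in Goedel's choice of moduli, since defining a
  factorial in the model would presuppose the coding of sequences.\<close>

lemma common_multiple: "\<exists>b. B \<prec> b \<and> (\<forall>d. d \<prec> l \<longrightarrow> (\<exists>e. suc d \<otimes> e = b))"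
proof (induction l rule: induction)
  case definable
  show ?case
    by (rule definableI[of "[B]" "Exists (Less (Var 2) (Var 0) \<^bold>\<and>
          Forall (Less (Var 0) (Var 2) \<^bold>\<longrightarrow> Exists (Times (Succ (Var 1)) (Var 0) \<^bold>= Var 2)))"])
      simp
next
  case zero
  show ?case by (intro exI[of _ "suc B"]) (simp add: lt_suc_iff)
next
  case (suc l)
  then obtain b where b: "B \<prec> b" "\<And>d. d \<prec> l \<Longrightarrow> \<exists>e. suc d \<otimes> e = b" by blast
  have "b \<preceq> suc l \<otimes> b" using le_add by simp
  then have "B \<prec> suc l \<otimes> b" using b(1) by order
  moreover have "\<exists>e. suc d \<otimes> e = suc l \<otimes> b" if d: "d \<prec> suc l" for d
  proof (cases "d = l")
    case False
    then obtain e where "suc d \<otimes> e = b" using d b(2)[of d] by (auto simp: lt_suc_iff simp del: suc_mul)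
    then have "suc d \<otimes> (e \<otimes> suc l) = suc l \<otimes> b"
      by (metis mul_associates mul_commutes)
    then show ?thesis by blast
  qed blast
  ultimately show ?case by blast
qed

lemma remainder_step:
  assumes "unit_mod c (suc m)"
  shows "\<exists>k q. a \<oplus> k \<otimes> c = q \<otimes> suc m \<oplus> x"
proof -
  obtain u v where uv: "u \<otimes> c = v \<otimes> suc m \<oplus> \<one>" using assms by (auto simp: unit_mod_def)
  \<comment> \<open>Since \<open>m\<close> is -1 modulo \<open>suc m\<close>, this represents
    \<open>x - a\<close>; as \<open>u\<close> inverts \<open>c\<close>, taking
    \<open>k = u \<otimes> ?w\<close> moves the residue of \<open>a\<close> to
    \<open>x\<close>.\<close>
  let ?w = "x \<oplus> a \<otimes> m"
  have "a \<oplus> (u \<otimes> ?w) \<otimes> c = a \<oplus> (u \<otimes> c) \<otimes> ?w" by (simp add: algebra_simps)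
  also have "\<dots> = (a \<oplus> v \<otimes> ?w) \<otimes> suc m \<oplus> x" unfolding uv by (simp add: algebra_simps)
  finally show ?thesis by blast
qed

text \<open>Supplies the correction term for Chinese remaindering: adding multiples of
  \<open>c\<close> preserves the residues at positions below \<open>j\<close> and, \<open>c\<close>
  being a unit modulo the modulus at \<open>j\<close>, can produce any residue there. The product of
  the first \<open>j\<close> moduli is such a \<open>c\<close>; it is built by induction because
  products of sequences are not yet expressible.\<close>

lemma product_of_moduli:
  assumes b: "\<zero> \<prec> b" "\<And>d. d \<prec> l \<Longrightarrow> \<exists>e. suc d \<otimes> e = b"
  shows "j \<prec> suc l \<Longrightarrow> \<exists>c. (\<forall>i. i \<prec> j \<longrightarrow> (\<exists>q. c = q \<otimes> modulus b i)) \<and>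
    (\<forall>k. j \<prec> suc k \<longrightarrow> k \<prec> suc l \<longrightarrow> unit_mod c (modulus b k))"
proof (induction j rule: induction)
  case definable
  show ?case
    by (rule definableI[of "[b, l]" "Less (Var 0) (Succ (Var 2)) \<^bold>\<longrightarrow> Exists (
          Forall (Less (Var 0) (Var 2) \<^bold>\<longrightarrow>
            Exists (Var 2 \<^bold>= Times (Var 0) (Succ (Times (Succ (Var 1)) (Var 4))))) \<^bold>\<and>
          Forall (Less (Var 2) (Succ (Var 0)) \<^bold>\<longrightarrow> Less (Var 0) (Succ (Var 4)) \<^bold>\<longrightarrow>
            Exists (Exists (Times (Var 1) (Var 3) \<^bold>=
              Plus (Times (Var 0) (Succ (Times (Succ (Var 2)) (Var 5)))) (Succ Zero)))))"])
      (simp add: modulus_def unit_mod_def)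
next
  case zero
  have "unit_mod \<one> (modulus b k)" for k
    unfolding unit_mod_def by (intro exI[of _ \<one>] exI[of _ \<zero>]) (simp add: zero_mul zero_add)
  then show ?case by auto
next
  case (suc j)
  then have j: "j \<prec> l" by simp
  then have "j \<prec> suc l" by (simp add: lt_suc_iff)
  then obtain c where c: "\<And>i. i \<prec> j \<Longrightarrow> \<exists>q. c = q \<otimes> modulus b i"
    "\<And>k. j \<prec> suc k \<Longrightarrow> k \<prec> suc l \<Longrightarrow> unit_mod c (modulus b k)" using suc by blast
  have "\<exists>q. c \<otimes> modulus b j = q \<otimes> modulus b i" if i: "i \<prec> suc j" for i
  proof (cases "i = j")
    case False
    then obtain q where "c = q \<otimes> modulus b i" using i c(1) by (auto simp: lt_suc_iff)
    then have "c \<otimes> modulus b j = q \<otimes> modulus b j \<otimes> modulus b i"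
      by (simp add: algebra_simps)
    then show ?thesis by blast
  qed blast
  moreover have "unit_mod (c \<otimes> modulus b j) (modulus b k)" if k: "suc j \<prec> suc k" "k \<prec> suc l" for k
  proof (rule unit_mod_mul)
    show "unit_mod c (modulus b k)"
      using c(2) k ordered.less_trans[of j "suc j" "suc k"] by (simp add: lt_suc_iff)
    obtain d where d: "k = j \<oplus> suc d" using k(1) by (auto simp: lt_def)
    \<comment> \<open>The gap \<open>suc d\<close> is at most \<open>k\<close>, hence at most
      \<open>l\<close>, so it is one of the numbers dividing \<open>b\<close>.\<close>
    have "suc d \<preceq> k" unfolding d by (rule le_add)
    then have "d \<prec> l" using k(2) by (meson lt_suc_iff_le ordered.less_le_trans suc_le_iff)
    then show "unit_mod (modulus b j) (modulus b k)"
      using unit_mod_modulus b d by blast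
  qed
  ultimately show ?case by blast
qed

text \<open>The moduli depend on \<open>b\<close> and may be too small for the new value, so the
  whole sequence is recoded with a new \<open>b'\<close>, the residues being adjusted one position
  at a time.\<close>

lemma beta_append: "\<exists>a' b'. (\<forall>i v. i \<prec> l \<longrightarrow> beta a b i v \<longrightarrow> beta a' b' i v) \<and> beta a' b' l x"
proof -
  \<comment> \<open>Every old entry is a remainder of \<open>a\<close>, hence at most
    \<open>a\<close>, so \<open>a \<oplus> x\<close> bounds all values and each falls below its new
    modulus.\<close>
  obtain b' where b': "a \<oplus> x \<prec> b'" "\<And>d. d \<prec> l \<Longrightarrow> \<exists>e. suc d \<otimes> e = b'"
    using common_multiple by blast
  \<comment> \<open>The graph of the extended sequence, a relation that the induction formula can
    express through \<open>Beta\<close>.\<close>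
  define V where "V i v \<longleftrightarrow> (i \<prec> l \<and> beta a b i v) \<or> (i = l \<and> v = x)" for i v
  have V_unique: "v = w" if "V i v" "V i w" for i v w
    using that beta_unique by (auto simp: V_def)
  have V_bound: "v \<prec> modulus b' i" if "V i v" for i v
  proof -
    have "v \<preceq> a \<oplus> x" using that beta_le[of a b i v] le_add le_trans by (auto simp: V_def)
    moreover have "b' \<preceq> suc i \<otimes> b'" using le_add by simp
    ultimately have "v \<preceq> suc i \<otimes> b'" using b'(1) by order
    then show ?thesis by (simp only: modulus_def lt_suc_iff_le)
  qed
  have pos: "\<zero> \<prec> b'" using b'(1) by (cases b' rule: suc_exhaust) auto
  have "j \<prec> suc (suc l) \<longrightarrow> (\<exists>a'. \<forall>i v. i \<prec> j \<longrightarrow> V i v \<longrightarrow> beta a' b' i v)" for j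
  proof (induction j rule: induction)
    case definable
    show ?case
      by (rule definableI[of "[b', a, b, l, x]" "Less (Var 0) (Succ (Succ (Var 4))) \<^bold>\<longrightarrow>
            Exists (Forall (Forall (Less (Var 1) (Var 3) \<^bold>\<longrightarrow>
              ((Less (Var 1) (Var 7) \<^bold>\<and> Beta (Var 5) (Var 6) (Var 1) (Var 0)) \<^bold>\<or>
                (Var 1 \<^bold>= Var 7 \<^bold>\<and> Var 0 \<^bold>= Var 8)) \<^bold>\<longrightarrow>
              Beta (Var 2) (Var 4) (Var 1) (Var 0))))"])
        (simp add: V_def disj_imp)
  next
    case (suc j)
    show ?case
    proof
      assume "suc j \<prec> suc (suc l)"
      then have j: "j \<prec> suc l" by simp
      then have "j \<prec> suc (suc l)" by (simp add: lt_suc_iff)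
      then obtain a' where a': "\<And>i v. i \<prec> j \<Longrightarrow> V i v \<Longrightarrow> beta a' b' i v" using suc by blast
      obtain c where c: "\<And>i. i \<prec> j \<Longrightarrow> \<exists>q. c = q \<otimes> modulus b' i" "unit_mod c (modulus b' j)"
        using product_of_moduli[OF pos b'(2) j] j by (auto simp: lt_suc_iff)
      show "\<exists>a'. \<forall>i v. i \<prec> suc j \<longrightarrow> V i v \<longrightarrow> beta a' b' i v"
      proof (cases "\<exists>v. V j v")
        case False
        then show ?thesis using a' by (intro exI[of _ a']) (auto simp: lt_suc_iff)
      next
        case True
        then obtain v where v: "V j v" by blast
        obtain k q where kq: "a' \<oplus> k \<otimes> c = q \<otimes> modulus b' j \<oplus> v"
          using remainder_step[of c "suc j \<otimes> b'" a' v] c(2) by (auto simp only: modulus_def)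
        have "beta (a' \<oplus> k \<otimes> c) b' j v"
          using kq V_bound[OF v] by (auto simp: beta_def)
        moreover have "beta (a' \<oplus> k \<otimes> c) b' i w" if iw: "i \<prec> j" "V i w" for i w
        proof -
          obtain r where "c = r \<otimes> modulus b' i" using c(1) iw by blast
          moreover obtain q where "a' = q \<otimes> modulus b' i \<oplus> w" "w \<prec> modulus b' i"
            using a'[OF iw] by (auto simp: beta_def)
          ultimately have "a' \<oplus> k \<otimes> c = (q \<oplus> k \<otimes> r) \<otimes> modulus b' i \<oplus> w"
            by (simp add: algebra_simps)
          then show ?thesis using \<open>w \<prec> modulus b' i\<close> by (auto simp: beta_def)
        qed
        ultimately show ?thesis
          using V_unique[OF v] by (intro exI[of _ "a' \<oplus> k \<otimes> c"]) (auto simp: lt_suc_iff)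
      qed
    qed
  qed simp
  then obtain a' where "\<And>i v. i \<prec> suc l \<Longrightarrow> V i v \<Longrightarrow> beta a' b' i v"
    by (metis lt_suc_iff)
  then show ?thesis by (intro exI[of _ a'] exI[of _ b']) (auto simp: V_def lt_suc_iff)
qed


section \<open>Sequences\<close>

definition pairing :: "'m \<Rightarrow> 'm \<Rightarrow> 'm"
  where "pairing x y = (x \<oplus> y) \<otimes> (x \<oplus> y) \<oplus> x"

lemma evalt_Pair [simp]: "evalt e \<langle>s, t\<rangle> = pairing (evalt e s) (evalt e t)"
  by (simp add: Pair_def pairing_def)

text \<open>With \<open>s\<close> the sum of the components, the code is at least the square of
  \<open>s\<close> and less than that of \<open>s + 1\<close>; hence it determines the sum, and then
  the first component.\<close>

lemma pairing_inject [simp]: "pairing x y = pairing x' y' \<longleftrightarrow> x = x' \<and> y = y'"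
proof
  assume eq: "pairing x y = pairing x' y'"
  have *: "\<not> x \<oplus> y \<prec> x' \<oplus> y'" if "pairing x y = pairing x' y'" for x y x' y'
  proof
    assume "x \<oplus> y \<prec> x' \<oplus> y'"
    then obtain z where "x' \<oplus> y' = x \<oplus> y \<oplus> suc z" unfolding lt_def by metis
    then have "pairing x' y' = pairing x y \<oplus>
        suc (y \<oplus> x \<oplus> y \<oplus> z \<otimes> suc (suc (x \<oplus> y \<oplus> x \<oplus> y \<oplus> z)) \<oplus> x')"
      unfolding pairing_def by (simp add: algebra_simps)
    then show False using that lt_add_suc[of "pairing x y"] by (metis ordered.less_irrefl)
  qed
  have sum: "x \<oplus> y = x' \<oplus> y'" using *[OF eq] *[OF eq[symmetric]] by order
  then have "x = x'" using eq by (simp add: pairing_def)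
  then show "x = x' \<and> y = y'" using sum by simp
qed simp

definition len :: "'m \<Rightarrow> 'm \<Rightarrow> bool"
  where "len s l \<longleftrightarrow> (\<exists>b a. s = pairing l (pairing a b))"

definition entry :: "'m \<Rightarrow> 'm \<Rightarrow> 'm \<Rightarrow> bool"
  where "entry s i x \<longleftrightarrow> (\<exists>b a l. s = pairing l (pairing a b) \<and> i \<prec> l \<and> beta a b i x)"

definition earlier :: "'m \<Rightarrow> 'm \<Rightarrow> 'm \<Rightarrow> bool"
  where "earlier s i x \<longleftrightarrow> (\<exists>j. j \<prec> i \<and> entry s j x)"

lemma eval_Len [simp]: "eval e (Len s l) \<longleftrightarrow> len (evalt e s) (evalt e l)"
  by (simp add: Len_def eval_inst len_def Let_def)

lemma eval_Entry [simp]: "eval e (Entry s i x) \<longleftrightarrow> entry (evalt e s) (evalt e i) (evalt e x)"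
  by (auto simp: Entry_def eval_inst entry_def Let_def)

lemma eval_Earlier [simp]: "eval e (Earlier s i x) \<longleftrightarrow> earlier (evalt e s) (evalt e i) (evalt e x)"
  by (simp add: Earlier_def eval_inst earlier_def Let_def)

lemma entry_total: "len s l \<Longrightarrow> i \<prec> l \<Longrightarrow> \<exists>x. entry s i x"
  using beta_total by (fastforce simp: len_def entry_def)

lemma entry_unique: "entry s i x \<Longrightarrow> entry s i y \<Longrightarrow> x = y"
  using beta_unique by (auto simp: entry_def)

lemma len_zero: "\<exists>s. len s \<zero>"
  by (auto simp: len_def)

lemma seq_append:
  assumes "len s l"
  shows "\<exists>s'. len s' (suc l) \<and> (\<forall>i v. i \<prec> l \<longrightarrow> entry s i v \<longrightarrow> entry s' i v) \<and> entry s' l x"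
proof -
  obtain a b where s: "s = pairing l (pairing a b)" using assms by (auto simp: len_def)
  obtain a' b' where "\<And>i v. i \<prec> l \<Longrightarrow> beta a b i v \<Longrightarrow> beta a' b' i v" "beta a' b' l x"
    using beta_append by metis
  then show ?thesis
    by (intro exI[of _ "pairing (suc l) (pairing a' b')"])
      (auto simp: s len_def entry_def lt_suc_iff)
qed

text \<open>The entries of \<open>t\<close> are copied behind \<open>s\<close> one by one. This
  serves to join the derivations of two premises.\<close>

lemma seq_concat:
  assumes s: "len s l" and t: "len t m"
  shows "\<exists>r. len r (l \<oplus> m) \<and> (\<forall>i v. i \<prec> l \<longrightarrow> entry s i v \<longrightarrow> entry r i v) \<and>
    (\<forall>i v. i \<prec> m \<longrightarrow> entry t i v \<longrightarrow> entry r (l \<oplus> i) v)"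
proof -
  have "n \<prec> suc m \<longrightarrow> (\<exists>r. len r (l \<oplus> n) \<and> (\<forall>i v. i \<prec> l \<longrightarrow> entry s i v \<longrightarrow> entry r i v) \<and>
    (\<forall>i v. i \<prec> n \<longrightarrow> entry t i v \<longrightarrow> entry r (l \<oplus> i) v))" for n
  proof (induction n rule: induction)
    case definable
    show ?case
      by (rule definableI[of "[m, l, s, t]" "Less (Var 0) (Succ (Var 1)) \<^bold>\<longrightarrow> Exists (
          Len (Var 0) (Plus (Var 3) (Var 1)) \<^bold>\<and>
          Forall (Forall (Less (Var 1) (Var 5) \<^bold>\<longrightarrow>
            Entry (Var 6) (Var 1) (Var 0) \<^bold>\<longrightarrow> Entry (Var 2) (Var 1) (Var 0))) \<^bold>\<and>
          Forall (Forall (Less (Var 1) (Var 3) \<^bold>\<longrightarrow>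
            Entry (Var 7) (Var 1) (Var 0) \<^bold>\<longrightarrow>
            Entry (Var 2) (Plus (Var 5) (Var 1)) (Var 0))))"]) simp
  next
    case zero
    show ?case using s by auto
  next
    case (suc n)
    show ?case
    proof
      assume "suc n \<prec> suc m"
      then have n: "n \<prec> m" by simp
      then have "n \<prec> suc m" by (simp add: lt_suc_iff)
      then obtain r where r: "len r (l \<oplus> n)" "\<And>i v. i \<prec> l \<Longrightarrow> entry s i v \<Longrightarrow> entry r i v"
        "\<And>i v. i \<prec> n \<Longrightarrow> entry t i v \<Longrightarrow> entry r (l \<oplus> i) v" using suc by blast
      obtain x where x: "entry t n x" using entry_total[OF t n] by blast
      obtain r' where r': "len r' (l \<oplus> suc n)" "\<And>i v. i \<prec> l \<oplus> n \<Longrightarrow> entry r i v \<Longrightarrow> entry r' i v"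
        "entry r' (l \<oplus> n) x" using seq_append[OF r(1), of x] by auto
      have "i \<prec> l \<oplus> n" if "i \<prec> l" for i
        using that le_add(1) ordered.less_le_trans by blast
      moreover have "l \<oplus> i \<prec> l \<oplus> n" if "i \<prec> n" for i using that by simp
      ultimately show "\<exists>r. len r (l \<oplus> suc n) \<and> (\<forall>i v. i \<prec> l \<longrightarrow> entry s i v \<longrightarrow> entry r i v) \<and>
          (\<forall>i v. i \<prec> suc n \<longrightarrow> entry t i v \<longrightarrow> entry r (l \<oplus> i) v)"
        using r r' entry_unique[OF x] by (intro exI[of _ r']) (auto simp: lt_suc_iff)
    qed
  qed
  then show ?thesis by (metis lt_suc_iff)
qed

text \<open>The beta values do not depend on the length component, so only the latter has to
  change.\<close>

lemma seq_truncate: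
  assumes "len s l" "n \<preceq> l"
  shows "\<exists>s'. len s' n \<and> (\<forall>i v. i \<prec> n \<longrightarrow> entry s i v \<longrightarrow> entry s' i v)"
proof -
  obtain a b where "s = pairing l (pairing a b)" using assms by (auto simp: len_def)
  then show ?thesis
    by (intro exI[of _ "pairing n (pairing a b)"]) (auto simp: len_def entry_def)
qed


section \<open>Arithmetized inductive definitions\<close>

definition clause :: "(tm \<Rightarrow> tm \<Rightarrow> tm \<Rightarrow> fm) \<Rightarrow> 'm \<Rightarrow> 'm \<Rightarrow> 'm \<Rightarrow> bool"
  where "clause R u s i \<longleftrightarrow> eval (env [u, s, i] (\<lambda>_. \<zero>)) (R (Var 0) (Var 1) (Var 2))"

text \<open>\<open>R\<close> is a function on terms of the syntax. The first conjunct says that its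
  truth depends only on the values of these terms; the second, that it refers to \<open>s\<close>
  and \<open>i\<close> only through the entries before \<open>i\<close>, and monotonically. The
  second allows derivations to be recoded, truncated and shifted.\<close>

definition clausal :: "(tm \<Rightarrow> tm \<Rightarrow> tm \<Rightarrow> fm) \<Rightarrow> bool" where
  "clausal R \<longleftrightarrow>
    (\<forall>e u s i. eval e (R u s i) \<longleftrightarrow> clause R (evalt e u) (evalt e s) (evalt e i)) \<and>
    (\<forall>u s i t j. (\<forall>x. earlier s i x \<longrightarrow> earlier t j x) \<longrightarrow> clause R u s i \<longrightarrow> clause R u t j)"

definition good :: "(tm \<Rightarrow> tm \<Rightarrow> tm \<Rightarrow> fm) \<Rightarrow> 'm \<Rightarrow> 'm \<Rightarrow> bool"
  where "good R s l \<longleftrightarrow> len s l \<and> (\<forall>i. i \<prec> l \<longrightarrow> (\<exists>u. entry s i u \<and> clause R u s i))"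

definition generated :: "(tm \<Rightarrow> tm \<Rightarrow> tm \<Rightarrow> fm) \<Rightarrow> 'm \<Rightarrow> bool"
  where "generated R x \<longleftrightarrow> (\<exists>s l. good R s (suc l) \<and> entry s l x)"

lemma eval_Derivation:
  assumes "clausal R"
  shows "eval e (Derivation R x s) \<longleftrightarrow>
    (\<exists>l. good R (evalt e s) (suc l) \<and> entry (evalt e s) l (evalt e x))"
  using assms unfolding clausal_def
  by (simp add: Derivation_def eval_inst Let_def good_def) blast

lemma eval_Derivable: "clausal R \<Longrightarrow> eval e (Derivable R x) \<longleftrightarrow> generated R (evalt e x)"
  by (simp add: Derivable_def eval_inst Let_def eval_Derivation generated_def)

lemma clause_mono:
  "clausal R \<Longrightarrow> (\<And>x. earlier s i x \<Longrightarrow> earlier t j x) \<Longrightarrow> clause R u s i \<Longrightarrow> clause R u t j"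
  unfolding clausal_def by blast

lemma good_append:
  assumes R: "clausal R" and s: "good R s l" and u: "clause R u s l"
  shows "generated R u"
proof -
  obtain t where t: "len t (suc l)" "\<And>i v. i \<prec> l \<Longrightarrow> entry s i v \<Longrightarrow> entry t i v" "entry t l u"
    using seq_append s unfolding good_def by blast
  have earlier: "earlier t i x" if i: "earlier s i x" "i \<prec> suc l" for i x
  proof -
    obtain j where "j \<prec> i" "entry s j x" using i(1) by (auto simp: earlier_def)
    moreover have "j \<prec> l" using \<open>j \<prec> i\<close> i(2) ordered.less_trans lt_suc_iff by blast
    ultimately show ?thesis using t(2) by (auto simp: earlier_def)
  qed
  have "\<exists>v. entry t i v \<and> clause R v t i" if "i \<prec> suc l" for i
  proof (cases "i = l")
    case True
    then show ?thesis using clause_mono[OF R earlier u] t(3) that by blast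
  next
    case False
    then have "i \<prec> l" using that by (simp add: lt_suc_iff)
    then obtain v where "entry s i v" "clause R v s i" using s by (auto simp: good_def)
    then show ?thesis using clause_mono[OF R earlier] t(2) that \<open>i \<prec> l\<close> by blast
  qed
  then show ?thesis using t unfolding generated_def good_def by blast
qed

lemma lt_add_cases:
  assumes "i \<prec> l \<oplus> m"
  obtains "i \<prec> l" | k where "k \<prec> m" "i = l \<oplus> k"
proof (cases "i \<prec> l")
  case False
  then obtain k where "i = l \<oplus> k" using le_total lt_iff by (metis le_def)
  then show thesis using assms that(2) by simp
qed

text \<open>Two premises cover every defining clause, none of which refers to more than two earlier
  entries. The derivations of the premises are concatenated and the conclusion is appended.\<close>

lemma generated_step:
  assumes R: "clausal R" and xy: "generated R x" "generated R y"
    and u: "\<And>s i. earlier s i x \<Longrightarrow> earlier s i y \<Longrightarrow> clause R u s i"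
  shows "generated R u"
proof -
  obtain s l t m where s: "good R s (suc l)" "entry s l x" and t: "good R t (suc m)" "entry t m y"
    using xy unfolding generated_def by blast
  obtain r where r: "len r (suc l \<oplus> suc m)" "\<And>i v. i \<prec> suc l \<Longrightarrow> entry s i v \<Longrightarrow> entry r i v"
    "\<And>i v. i \<prec> suc m \<Longrightarrow> entry t i v \<Longrightarrow> entry r (suc l \<oplus> i) v"
    using seq_concat[of s "suc l" t "suc m"] s(1) t(1) unfolding good_def by blast
  have earlier_s: "earlier r i v" if "i \<prec> suc l" "earlier s i v" for i v
    using that r(2) ordered.less_trans unfolding earlier_def by blast
  \<comment> \<open>Shifting by \<open>suc l\<close> keeps the earlier entries of \<open>t\<close>
    earlier, so the clauses satisfied in \<open>t\<close> survive by monotonicity.\<close>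
  have earlier_t: "earlier r (suc l \<oplus> i) v" if iv: "i \<prec> suc m" "earlier t i v" for i v
  proof -
    obtain j where "j \<prec> i" "entry t j v" using iv(2) by (auto simp: earlier_def)
    moreover from this have "entry r (suc l \<oplus> j) v" using r(3) iv(1) ordered.less_trans by blast
    moreover have "suc l \<oplus> j \<prec> suc l \<oplus> i" using \<open>j \<prec> i\<close> by simp
    ultimately show ?thesis unfolding earlier_def by blast
  qed
  have "\<exists>v. entry r i v \<and> clause R v r i" if i: "i \<prec> suc l \<oplus> suc m" for i
    using i
  proof (cases i rule: lt_add_cases)
    case 1
    then obtain v where "entry s i v" "clause R v s i" using s(1) by (auto simp: good_def)
    then show ?thesis using clause_mono[OF R earlier_s[OF 1]] r(2)[OF 1] by blast
  next
    case (2 k)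
    then obtain v where "entry t k v" "clause R v t k" using t(1) by (auto simp: good_def)
    then show ?thesis using clause_mono[OF R earlier_t] r(3) 2 by blast
  qed
  then have r_good: "good R r (suc l \<oplus> suc m)" using r(1) by (simp add: good_def)
  have "entry r l x" using r(2) s(2) by (simp add: lt_suc_iff)
  moreover have "l \<prec> suc l \<oplus> suc m"
    unfolding suc_add lt_suc_iff_le by (rule le_add)
  ultimately have "earlier r (suc l \<oplus> suc m) x" unfolding earlier_def by blast
  moreover have "entry r (suc l \<oplus> m) y" using r(3) t(2) lt_suc_iff by blast
  then have "earlier r (suc l \<oplus> suc m) y"
    unfolding earlier_def by (metis add_suc lt_suc_iff)
  ultimately show ?thesis using good_append[OF R r_good] u by blast
qed

lemma generated_base:
  assumes R: "clausal R" and u: "\<And>s i. clause R u s i"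
  shows "generated R u"
proof -
  obtain s where "len s \<zero>" using len_zero by blast
  then have "good R s \<zero>" by (simp add: good_def)
  then show ?thesis using good_append[OF R] u by blast
qed

lemma generated_step1:
  assumes "clausal R" "generated R x" "\<And>s i. earlier s i x \<Longrightarrow> clause R u s i"
  shows "generated R u"
  using generated_step[OF assms(1,2,2)] assms(3) by blast

section \<open>Inversion and induction for generated predicates\<close>

lemma definable_strong_induction:
  assumes P: "definable P" and step: "\<And>i. (\<And>j. j \<prec> i \<Longrightarrow> P j) \<Longrightarrow> P i"
  shows "P i"
proof -
  obtain \<phi> e where \<phi>: "\<And>x. eval (case_nat x e) \<phi> \<longleftrightarrow> P x"
    using P unfolding definable_def by blast
  \<comment> \<open>The bounded quantifier makes \<open>Var 0\<close> the new \<open>j\<close> and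
    \<open>Var 1\<close> its bound, so the parameters of \<open>\<phi>\<close> move up by
    one.\<close>
  let ?\<psi> = "Forall (Less (Var 0) (Var 1) \<^bold>\<longrightarrow> subst (case_nat (Var 0) (\<lambda>i. Var (Suc (Suc i)))) \<phi>)"
  have "(\<lambda>i. evalt (case_nat y (case_nat x e)) (case_nat (Var 0) (\<lambda>i. Var (Suc (Suc i))) i)) =
      case_nat y e" for x y
    by (auto simp: fun_eq_iff split: nat.splits)
  then have "eval (case_nat x e) ?\<psi> \<longleftrightarrow> (\<forall>j. j \<prec> x \<longrightarrow> P j)" for x
    by (simp add: eval_subst \<phi>)
  then have def: "definable (\<lambda>x. \<forall>j. j \<prec> x \<longrightarrow> P j)" unfolding definable_def by blast
  have "\<forall>j. j \<prec> x \<longrightarrow> P j" for x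
  proof (induction x rule: induction)
    case (suc x)
    then show ?case using step[of x] by (auto simp: lt_suc_iff)
  qed (simp_all add: def)
  then show ?thesis using step by blast
qed

text \<open>Cutting the derivation off just before an earlier entry leaves a shorter sequence of the
  same kind, to which that entry can be appended again.\<close>

lemma generated_inversion:
  assumes R: "clausal R" and "generated R x"
  shows "\<exists>s i. clause R x s i \<and> (\<forall>y. earlier s i y \<longrightarrow> generated R y)"
proof -
  obtain s l where s: "good R s (suc l)" "entry s l x" using assms(2) by (auto simp: generated_def)
  have "generated R y" if y: "earlier s l y" for y
  proof -
    obtain j where j: "j \<prec> l" "entry s j y" using y by (auto simp: earlier_def)
    have jl: "j \<prec> suc l" using j(1) by (simp add: lt_suc_iff)
    then have "j \<preceq> suc l" by order
    then obtain t where t: "len t j" "\<And>i v. i \<prec> j \<Longrightarrow> entry s i v \<Longrightarrow> entry t i v"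
      using seq_truncate[of s "suc l" j] s(1) unfolding good_def by blast
    have earlier: "earlier t i v" if "i \<preceq> j" "earlier s i v" for i v
      using that t(2) ordered.less_le_trans unfolding earlier_def by blast
    have "\<exists>v. entry t i v \<and> clause R v t i" if i: "i \<prec> j" for i
    proof -
      have "i \<prec> suc l" using i jl by order
      then obtain v where "entry s i v" "clause R v s i" using s(1) unfolding good_def by blast
      moreover have "i \<preceq> j" using i by order
      ultimately show ?thesis using t(2)[OF i] clause_mono[OF R earlier] by blast
    qed
    then have "good R t j" using t(1) by (simp add: good_def)
    moreover have "clause R y s j"
      using s(1) jl entry_unique[OF j(2)] unfolding good_def by blast
    then have "clause R y t j" using clause_mono[OF R earlier] by blast
    ultimately show ?thesis using good_append[OF R] by blast
  qed
  moreover have "clause R x s l"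
    using s entry_unique[OF s(2)] lt_suc_iff unfolding good_def by blast
  ultimately show ?thesis by blast
qed

text \<open>A derivation may have nonstandard length, so the induction runs over its positions
  inside the model; this is why \<open>P\<close> must be definable.\<close>

lemma generated_induct:
  assumes P: "definable P"
    and step: "\<And>u s i. clause R u s i \<Longrightarrow> (\<And>y. earlier s i y \<Longrightarrow> P y) \<Longrightarrow> P u"
    and "generated R x"
  shows "P x"
proof -
  obtain s l where s: "good R s (suc l)" "entry s l x" using assms(3) by (auto simp: generated_def)
  obtain \<phi> e where \<phi>: "\<And>x. eval (case_nat x e) \<phi> \<longleftrightarrow> P x"
    using P unfolding definable_def by blast
  have "\<forall>u. i \<prec> suc l \<longrightarrow> entry s i u \<longrightarrow> P u" for i
  proof (induction i rule: definable_strong_induction)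
    case 1
    \<comment> \<open>With \<open>s\<close> and \<open>l\<close> as additional parameters, the
      variables 0 to 3 inside \<open>?\<psi>\<close> are \<open>u\<close>, \<open>i\<close>,
      \<open>s\<close>, \<open>l\<close>, and those of \<open>e\<close> start at 4.\<close>
    let ?e = "case_nat s (case_nat l e)"
    let ?\<psi> = "Forall (Less (Var 1) (Succ (Var 3)) \<^bold>\<longrightarrow> Entry (Var 2) (Var 1) (Var 0) \<^bold>\<longrightarrow>
      subst (case_nat (Var 0) (\<lambda>i. Var (Suc (Suc (Suc (Suc i)))))) \<phi>)"
    have "(\<lambda>j. evalt (case_nat u (case_nat i ?e))
        (case_nat (Var 0) (\<lambda>i. Var (Suc (Suc (Suc (Suc i))))) j)) = case_nat u e" for u i
      by (auto simp: fun_eq_iff split: nat.splits)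
    then have "eval (case_nat i ?e) ?\<psi> \<longleftrightarrow> (\<forall>u. i \<prec> suc l \<longrightarrow> entry s i u \<longrightarrow> P u)" for i
      by (simp add: eval_subst \<phi>)
    then show ?case unfolding definable_def by blast
  next
    case (2 i)
    show ?case
    proof (intro allI impI)
      fix u assume i: "i \<prec> suc l" and u: "entry s i u"
      have "clause R u s i" using s(1) i entry_unique[OF u] unfolding good_def by blast
      moreover have "P y" if "earlier s i y" for y
        using that 2 i ordered.less_trans unfolding earlier_def by blast
      ultimately show "P u" by (rule step)
    qed
  qed
  then show ?thesis using s(2) lt_suc_iff by blast
qed


section \<open>Codes of standard syntax\<close>

primrec numeral_value :: "nat \<Rightarrow> 'm" where
  "numeral_value 0 = \<zero>"
| "numeral_value (Suc n) = suc (numeral_value n)"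

abbreviation nm where "nm \<equiv> numeral_value"

lemma evalt_num [simp]: "evalt e (num n) = nm n"
  by (induction n) auto

lemma nm_add: "nm (m + n) = nm m \<oplus> nm n"
  by (induction m) (simp_all add: zero_add)

lemma nm_mul: "nm (m * n) = nm m \<otimes> nm n"
  by (induction m) (simp_all add: zero_mul nm_add algebra_simps)

lemma nm_lt [simp]: "nm m \<prec> nm n \<longleftrightarrow> m < n"
proof (induction m arbitrary: n)
  case 0
  then show ?case by (cases n) auto
next
  case (Suc m)
  then show ?case by (cases n) auto
qed

lemma nm_eq [simp]: "nm m = nm n \<longleftrightarrow> m = n"
  by (metis nm_lt ordered.less_irrefl nat_neq_iff)

lemma nm_lt_suc [simp]: "nm m \<prec> suc (nm n) \<longleftrightarrow> m < Suc n"
  using nm_lt[of m "Suc n"] by simp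

lemma nm_pair [simp]: "nm (pair x y) = pairing (nm x) (nm y)"
  by (simp add: pair_def pairing_def nm_add nm_mul)

lemma evalt_Q [simp]:
  "evalt e (QVar t) = pairing (nm 0) (evalt e t)"
  "evalt e QZero = pairing (nm 1) (nm 0)"
  "evalt e (QSucc t) = pairing (nm 2) (evalt e t)"
  "evalt e (QPlus s t) = pairing (nm 3) (pairing (evalt e s) (evalt e t))"
  "evalt e (QTimes s t) = pairing (nm 4) (pairing (evalt e s) (evalt e t))"
  "evalt e (QEq s t) = pairing (nm 5) (pairing (evalt e s) (evalt e t))"
  "evalt e (QNeg t) = pairing (nm 6) (evalt e t)"
  "evalt e (QImp s t) = pairing (nm 7) (pairing (evalt e s) (evalt e t))"
  "evalt e (QForall t) = pairing (nm 8) (evalt e t)"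
  by (simp_all add: QVar_def QZero_def QSucc_def QPlus_def QTimes_def QEq_def QNeg_def QImp_def
      QForall_def)

lemma clausal_TermStep: "clausal TermStep"
  unfolding clausal_def clause_def TermStep_def eval_inst Let_def by simp blast

text \<open>Structural induction from outside: in every model a standard term has a derivation
  witnessing that it is a term. The later facts about standard codes follow the same
  pattern.\<close>

lemma term_below: "fvt t \<subseteq> {..<k} \<Longrightarrow> generated TermStep (pairing (nm k) (nm (gnt t)))"
proof (induction t)
  case (Var i)
  then show ?case
    by (intro generated_base[OF clausal_TermStep])
      (auto simp: clause_def TermStep_def eval_inst Let_def ex_disj_distrib)
next
  case Zero
  then show ?case
    by (intro generated_base[OF clausal_TermStep])
      (auto simp: clause_def TermStep_def eval_inst Let_def ex_disj_distrib)
next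
  case (Succ t)
  then have "generated TermStep (pairing (nm k) (nm (gnt t)))" by simp
  then show ?case
    by (rule generated_step1[OF clausal_TermStep])
      (auto simp: clause_def TermStep_def eval_inst Let_def ex_disj_distrib)
next
  case (Plus s t)
  then have "generated TermStep (pairing (nm k) (nm (gnt s)))"
    "generated TermStep (pairing (nm k) (nm (gnt t)))" by simp_all
  then show ?case
    by (rule generated_step[OF clausal_TermStep])
      (auto simp: clause_def TermStep_def eval_inst Let_def ex_disj_distrib)
next
  case (Times s t)
  then have "generated TermStep (pairing (nm k) (nm (gnt s)))"
    "generated TermStep (pairing (nm k) (nm (gnt t)))" by simp_all
  then show ?case
    by (rule generated_step[OF clausal_TermStep])
      (auto simp: clause_def TermStep_def eval_inst Let_def ex_disj_distrib)
qed

lemma eval_TermBelow [simp]: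
  "eval e (TermBelow k x) \<longleftrightarrow> generated TermStep (pairing (evalt e k) (evalt e x))"
  by (simp add: TermBelow_def eval_Derivable[OF clausal_TermStep])

lemma clausal_FormStep: "clausal FormStep"
  unfolding clausal_def clause_def FormStep_def eval_inst Let_def by simp blast

lemma eval_FormBelow [simp]:
  "eval e (FormBelow k x) \<longleftrightarrow> generated FormStep (pairing (evalt e k) (evalt e x))"
  by (simp add: FormBelow_def eval_Derivable[OF clausal_FormStep])

lemma form_below: "fv \<phi> \<subseteq> {..<k} \<Longrightarrow> generated FormStep (pairing (nm k) (nm (gn \<phi>)))"
proof (induction \<phi> arbitrary: k)
  case (Eq s t)
  then show ?case
    by (intro generated_base[OF clausal_FormStep])
      (auto simp: clause_def FormStep_def eval_inst Let_def term_below ex_disj_distrib)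
next
  case (Neg \<phi>)
  then have "generated FormStep (pairing (nm k) (nm (gn \<phi>)))" by simp
  then show ?case
    by (rule generated_step1[OF clausal_FormStep])
      (auto simp: clause_def FormStep_def eval_inst Let_def ex_disj_distrib)
next
  case (Imp \<phi> \<psi>)
  then have "generated FormStep (pairing (nm k) (nm (gn \<phi>)))"
    "generated FormStep (pairing (nm k) (nm (gn \<psi>)))" by simp_all
  then show ?case
    by (rule generated_step[OF clausal_FormStep])
      (auto simp: clause_def FormStep_def eval_inst Let_def ex_disj_distrib)
next
  case (Forall \<phi>)
  have "i < Suc k" if "i \<in> fv \<phi>" for i
    using that Forall.prems by (cases i) auto
  then have "fv \<phi> \<subseteq> {..<Suc k}" by blast
  then have "generated FormStep (pairing (nm (Suc k)) (nm (gn \<phi>)))" by (rule Forall.IH)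
  then show ?case
    by (rule generated_step1[OF clausal_FormStep])
      (auto simp: clause_def FormStep_def eval_inst Let_def ex_disj_distrib)
qed

lemma eval_Form: "eval e (Form (num (gn \<phi>)))"
proof -
  obtain k where "fv \<phi> \<subseteq> {..<k}" using finite_nat_bounded[OF finite_fv] by blast
  then show ?thesis using form_below by (auto simp: Form_def eval_inst Let_def)
qed

lemma eval_Term: "eval e (Term (num (gnt t)))"
proof -
  obtain k where "fvt t \<subseteq> {..<k}" using finite_nat_bounded[OF finite_fvt] by blast
  then show ?thesis using term_below by (auto simp: Term_def eval_inst Let_def)
qed

section \<open>Substitution on codes\<close>

definition value_clause :: "(tm \<Rightarrow> tm \<Rightarrow> tm \<Rightarrow> tm \<Rightarrow> fm) \<Rightarrow> 'm \<Rightarrow> 'm \<Rightarrow> 'm \<Rightarrow> 'm \<Rightarrow> bool" where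
  "value_clause V p k i y \<longleftrightarrow>
    eval (env [p, k, i, y] (\<lambda>_. \<zero>)) (V (Var 0) (Var 1) (Var 2) (Var 3))"

text \<open>The analogue for \<open>V\<close> of the first conjunct of
  \<open>clausal\<close>.\<close>

definition extensional :: "(tm \<Rightarrow> tm \<Rightarrow> tm \<Rightarrow> tm \<Rightarrow> fm) \<Rightarrow> bool" where
  "extensional V \<longleftrightarrow> (\<forall>e p k i y. eval e (V p k i y) \<longleftrightarrow>
    value_clause V (evalt e p) (evalt e k) (evalt e i) (evalt e y))"

lemma eval_value_clause:
  "extensional V \<Longrightarrow>
    eval e (V p k i y) \<longleftrightarrow> value_clause V (evalt e p) (evalt e k) (evalt e i) (evalt e y)"
  unfolding extensional_def by blast

lemma clausal_SubsttStep: "extensional V \<Longrightarrow> clausal (SubsttStep V)"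
  unfolding clausal_def clause_def SubsttStep_def eval_inst Let_def
  by (simp add: eval_value_clause) blast

lemma eval_Substt:
  "extensional V \<Longrightarrow> eval e (Substt V p k x y) \<longleftrightarrow> generated (SubsttStep V)
    (pairing (evalt e p) (pairing (evalt e k) (pairing (evalt e x) (evalt e y))))"
  by (simp add: Substt_def eval_Derivable[OF clausal_SubsttStep])

lemma clausal_SubstStep: "extensional V \<Longrightarrow> clausal (SubstStep V)"
  unfolding clausal_def clause_def SubstStep_def eval_inst Let_def
  by (simp add: eval_Substt) blast

lemma eval_Subst:
  "extensional V \<Longrightarrow> eval e (Subst V p k x y) \<longleftrightarrow> generated (SubstStep V)
    (pairing (evalt e p) (pairing (evalt e k) (pairing (evalt e x) (evalt e y))))"
  by (simp add: Subst_def eval_Derivable[OF clausal_SubstStep])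

lemma substt_generated:
  assumes V: "extensional V" "\<And>i. value_clause V p k (nm i) (nm (gnt (\<sigma> i)))"
  shows "generated (SubsttStep V)
    (pairing p (pairing k (pairing (nm (gnt t)) (nm (gnt (substt \<sigma> t))))))"
proof (induction t)
  case (Var i)
  then show ?case using V
    by (intro generated_base[OF clausal_SubsttStep[OF V(1)]])
      (auto simp: clause_def SubsttStep_def eval_inst Let_def eval_value_clause ex_disj_distrib)
next
  case Zero
  then show ?case using V
    by (intro generated_base[OF clausal_SubsttStep[OF V(1)]])
      (auto simp: clause_def SubsttStep_def eval_inst Let_def eval_value_clause ex_disj_distrib)
next
  case (Succ t)
  then show ?case
    by (rule generated_step1[OF clausal_SubsttStep[OF V(1)]])
      (auto simp: clause_def SubsttStep_def eval_inst Let_def eval_value_clause V(1) ex_disj_distrib)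
next
  case (Plus s t)
  then show ?case
    by (rule generated_step[OF clausal_SubsttStep[OF V(1)]])
      (auto simp: clause_def SubsttStep_def eval_inst Let_def eval_value_clause V(1) ex_disj_distrib)
next
  case (Times s t)
  then show ?case
    by (rule generated_step[OF clausal_SubsttStep[OF V(1)]])
      (auto simp: clause_def SubsttStep_def eval_inst Let_def eval_value_clause V(1) ex_disj_distrib)
qed

text \<open>The depth is generalized because each quantifier crossed adds one \<open>up\<close>,
  matching the \<open>Succ k\<close> in the last clause of \<open>SubstStep\<close>.\<close>

lemma subst_generated:
  assumes V: "extensional V" "\<And>k i. value_clause V p (nm k) (nm i) (nm (gnt ((up ^^ k) \<sigma> i)))"
  shows "generated (SubstStep V)
    (pairing p (pairing (nm k) (pairing (nm (gn \<phi>)) (nm (gn (subst ((up ^^ k) \<sigma>) \<phi>))))))"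
proof (induction \<phi> arbitrary: k)
  case (Eq s t)
  then show ?case using substt_generated[OF V(1), of p "nm k" "(up ^^ k) \<sigma>"] V
    by (intro generated_base[OF clausal_SubstStep[OF V(1)]])
      (auto simp: clause_def SubstStep_def eval_inst Let_def eval_Substt ex_disj_distrib)
next
  case (Neg \<phi>)
  then show ?case
    by (rule generated_step1[OF clausal_SubstStep[OF V(1)], of _ "pairing _ (pairing _ _)"])
      (auto simp: clause_def SubstStep_def eval_inst Let_def eval_Substt V(1) ex_disj_distrib)
next
  case (Imp \<phi> \<psi>)
  show ?case
    by (rule generated_step[OF clausal_SubstStep[OF V(1)] Imp])
      (auto simp: clause_def SubstStep_def eval_inst Let_def eval_Substt V(1) ex_disj_distrib)
next
  case (Forall \<phi>)
  show ?case
    by (rule generated_step1[OF clausal_SubstStep[OF V(1)] Forall[of "Suc k"]])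
      (auto simp: clause_def SubstStep_def eval_inst Let_def eval_Substt V(1) ex_disj_distrib)
qed

lemma up_iterate:
  "(up ^^ k) \<sigma> i = (if i < k then Var i else substt (\<lambda>j. Var (j + k)) (\<sigma> (i - k)))"
proof (induction k arbitrary: i)
  case (Suc k)
  then show ?case by (cases i) (auto simp: substt_substt)
qed simp

lemma eval_Raise: "eval e (Raise (num k) (num (gnt t)) (num (gnt (substt (\<lambda>j. Var (j + k)) t))))"
proof -
  let ?V = "\<lambda>p k i y. y \<^bold>= QVar (Plus i k)"
  have "extensional ?V" by (simp add: extensional_def value_clause_def)
  then show ?thesis
    using substt_generated[of ?V \<zero> "nm k" "\<lambda>j. Var (j + k)" t]
    by (simp add: Raise_def eval_Substt value_clause_def nm_add)
qed

lemma extensional_LiftVar: "extensional LiftVar"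
  by (simp add: extensional_def value_clause_def LiftVar_def)

lemma extensional_InstVar: "extensional InstVar"
proof -
  have R: "extensional (\<lambda>p k i y. y \<^bold>= QVar (Plus i k))"
    by (simp add: extensional_def value_clause_def)
  show ?thesis
    by (auto simp: extensional_def value_clause_def InstVar_def eval_inst Let_def Raise_def
        eval_Substt[OF R])
qed

lemma eval_Lift: "eval e (Lift (num (gn \<phi>)) (num (gn (lift \<phi>))))"
proof -
  note V = extensional_LiftVar
  have "value_clause LiftVar \<zero> (nm k) (nm i) (nm (gnt ((up ^^ k) (\<lambda>i. Var (Suc i)) i)))" for k i
    by (auto simp: value_clause_def LiftVar_def up_iterate)
  from subst_generated[OF V this, of 0 \<phi>] show ?thesis
    by (simp add: Lift_def eval_Subst[OF V] lift_def)
qed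

lemma eval_Inst: "eval e (Inst (num (gnt t)) (num (gn \<phi>)) (num (gn (inst [t] \<phi>))))"
proof -
  have R: "extensional (\<lambda>p k i y. y \<^bold>= QVar (Plus i k))" by (simp add: extensional_def value_clause_def)
  note V = extensional_InstVar
  have "value_clause InstVar (nm (gnt t)) (nm k) (nm i) (nm (gnt ((up ^^ k) (case_nat t Var) i)))"
    for k i
  proof -
    \<comment> \<open>The three disjuncts of \<open>InstVar\<close>: bound variables stay, the
      instantiated one becomes \<open>t\<close> raised past the \<open>k\<close> binders, and higher
      ones drop by one.\<close>
    consider "i < k" | "i = k" | j where "i = Suc j" "k \<le> j" 
      by (cases i k rule: linorder_cases) (auto dest: less_imp_Suc_add)
    then show ?thesis
    proof cases
      case 2
      then show ?thesis using eval_Raise[of _ k t]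
        by (auto simp: value_clause_def InstVar_def eval_inst Let_def up_iterate Raise_def
            eval_Substt[OF R] ex_disj_distrib)
    next
      case (3 j)
      then have "i - k = Suc (j - k)" by simp
      then show ?thesis using 3
        by (auto simp: value_clause_def InstVar_def eval_inst Let_def up_iterate ex_disj_distrib)
    qed (auto simp: value_clause_def InstVar_def eval_inst Let_def up_iterate ex_disj_distrib)
  qed
  from subst_generated[OF V this, of 0 \<phi>] show ?thesis
    by (simp add: Inst_def eval_Subst[OF V] inst1)
qed

lemma eval_inst_closed: "fv \<phi> \<subseteq> {0} \<Longrightarrow> eval e (inst [t] \<phi>) \<longleftrightarrow> eval (\<lambda>_. evalt e t) \<phi>"
  unfolding eval_inst1 by (rule eval_cong) auto

end

section \<open>Free variables of the arithmetized predicates\<close>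

text \<open>Reduces the free variables of an arithmetized predicate to those of its body. The bounds
  obtained in this way show that \<open>Pr\<close> of a quoted formula is a sentence.\<close>

lemma fv_inst: "fv \<phi> \<subseteq> {..<length ts} \<Longrightarrow> fv (inst ts \<phi>) \<subseteq> (\<Union>t\<in>set ts. fvt t)"
  unfolding inst_def fv_subst by (intro UN_least) (auto intro!: bexI[OF _ nth_mem])

lemma fv_exs [simp]: "fv (exs n \<phi>) = {i. i + n \<in> fv \<phi>}"
  unfolding exs_def by (induction n) auto

lemma fvt_num [simp]: "fvt (num n) = {}"
  by (induction n) auto

lemma fvt_Pair [simp]: "fvt \<langle>s, t\<rangle> = fvt s \<union> fvt t"
  by (auto simp: Pair_def)

lemma fvt_Q [simp]:
  "fvt (QVar t) = fvt t" "fvt QZero = {}" "fvt (QSucc t) = fvt t"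
  "fvt (QPlus s t) = fvt s \<union> fvt t" "fvt (QTimes s t) = fvt s \<union> fvt t"
  "fvt (QEq s t) = fvt s \<union> fvt t" "fvt (QNeg t) = fvt t"
  "fvt (QImp s t) = fvt s \<union> fvt t" "fvt (QForall t) = fvt t"
  by (simp_all add: QVar_def QZero_def QSucc_def QPlus_def QTimes_def QEq_def QNeg_def QImp_def
      QForall_def)

lemma fv_Less: "i \<in> fv (Less x y) \<Longrightarrow> i \<in> fvt x \<union> fvt y"
  unfolding Less_def Let_def by (erule subsetD[OF order_trans[OF fv_inst], rotated 2]) auto

lemma fv_Beta: "j \<in> fv (Beta a b i x) \<Longrightarrow> j \<in> fvt a \<union> fvt b \<union> fvt i \<union> fvt x"
  unfolding Beta_def Let_def
  by (erule subsetD[OF order_trans[OF fv_inst], rotated 2]) (auto dest!: fv_Less)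

lemma fv_Len: "i \<in> fv (Len s l) \<Longrightarrow> i \<in> fvt s \<union> fvt l"
  unfolding Len_def Let_def by (erule subsetD[OF order_trans[OF fv_inst], rotated 2]) auto

lemma fv_Entry: "j \<in> fv (Entry s i x) \<Longrightarrow> j \<in> fvt s \<union> fvt i \<union> fvt x"
  unfolding Entry_def Let_def
  by (erule subsetD[OF order_trans[OF fv_inst], rotated 2]) (auto dest!: fv_Less fv_Beta)

lemma fv_Earlier: "j \<in> fv (Earlier s i x) \<Longrightarrow> j \<in> fvt s \<union> fvt i \<union> fvt x"
  unfolding Earlier_def Let_def
  by (erule subsetD[OF order_trans[OF fv_inst], rotated 2]) (auto dest!: fv_Less fv_Entry)

definition closed_clause :: "(tm \<Rightarrow> tm \<Rightarrow> tm \<Rightarrow> fm) \<Rightarrow> bool"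
  where "closed_clause R \<longleftrightarrow> (\<forall>u s i. fv (R u s i) \<subseteq> fvt u \<union> fvt s \<union> fvt i)"

lemma fv_Derivation:
  assumes "closed_clause R" "i \<in> fv (Derivation R x s)"
  shows "i \<in> fvt x \<union> fvt s"
proof -
  have R: "j \<in> fvt u \<union> fvt s \<union> fvt i" if "j \<in> fv (R u s i)" for u s i j
    using assms(1) that unfolding closed_clause_def by blast
  show ?thesis
    using assms(2) unfolding Derivation_def Let_def
    by (elim subsetD[OF order_trans[OF fv_inst], rotated 2])
      (auto dest!: R fv_Less fv_Len fv_Entry)
qed

lemma fv_Derivable: "closed_clause R \<Longrightarrow> i \<in> fv (Derivable R x) \<Longrightarrow> i \<in> fvt x"
  unfolding Derivable_def Let_def
  by (erule subsetD[OF order_trans[OF fv_inst], rotated 2]) (auto dest!: fv_Derivation)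

lemma closed_TermStep: "closed_clause TermStep"
  unfolding closed_clause_def TermStep_def Let_def
  by (intro allI order_trans[OF fv_inst]) (auto dest!: fv_Less fv_Earlier)

lemma fv_TermBelow: "i \<in> fv (TermBelow k x) \<Longrightarrow> i \<in> fvt k \<union> fvt x"
  using fv_Derivable[OF closed_TermStep] by (fastforce simp: TermBelow_def)

lemma fv_Term: "i \<in> fv (Term x) \<Longrightarrow> i \<in> fvt x"
  unfolding Term_def Let_def
  by (erule subsetD[OF order_trans[OF fv_inst], rotated 2]) (auto dest!: fv_TermBelow)

lemma closed_FormStep: "closed_clause FormStep"
  unfolding closed_clause_def FormStep_def Let_def
  by (intro allI order_trans[OF fv_inst]) (auto dest!: fv_TermBelow fv_Earlier)

lemma fv_FormBelow: "i \<in> fv (FormBelow k x) \<Longrightarrow> i \<in> fvt k \<union> fvt x"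
  using fv_Derivable[OF closed_FormStep] by (fastforce simp: FormBelow_def)

lemma fv_Form: "i \<in> fv (Form x) \<Longrightarrow> i \<in> fvt x"
  unfolding Form_def Let_def
  by (erule subsetD[OF order_trans[OF fv_inst], rotated 2]) (auto dest!: fv_FormBelow)

definition closed_value :: "(tm \<Rightarrow> tm \<Rightarrow> tm \<Rightarrow> tm \<Rightarrow> fm) \<Rightarrow> bool"
  where "closed_value V \<longleftrightarrow> (\<forall>p k i y. fv (V p k i y) \<subseteq> fvt p \<union> fvt k \<union> fvt i \<union> fvt y)"

lemma closed_valueD:
  "closed_value V \<Longrightarrow> j \<in> fv (V p k i y) \<Longrightarrow> j \<in> fvt p \<union> fvt k \<union> fvt i \<union> fvt y"
  unfolding closed_value_def by blast

lemma closed_SubsttStep: "closed_value V \<Longrightarrow> closed_clause (SubsttStep V)"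
  unfolding closed_clause_def SubsttStep_def Let_def
  by (intro allI order_trans[OF fv_inst]) (auto dest!: closed_valueD fv_Earlier)

lemma fv_Substt:
  "closed_value V \<Longrightarrow> j \<in> fv (Substt V p k x y) \<Longrightarrow> j \<in> fvt p \<union> fvt k \<union> fvt x \<union> fvt y"
  using fv_Derivable[OF closed_SubsttStep] by (fastforce simp: Substt_def)

lemma closed_SubstStep:
  assumes "closed_value V"
  shows "closed_clause (SubstStep V)"
  unfolding closed_clause_def SubstStep_def Let_def
  by (intro allI order_trans[OF fv_inst]) (auto dest!: fv_Substt[OF assms] fv_Earlier)

lemma fv_Subst:
  "closed_value V \<Longrightarrow> j \<in> fv (Subst V p k x y) \<Longrightarrow> j \<in> fvt p \<union> fvt k \<union> fvt x \<union> fvt y"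
  using fv_Derivable[OF closed_SubstStep] by (fastforce simp: Subst_def)

lemma fv_Lift: "i \<in> fv (Lift x y) \<Longrightarrow> i \<in> fvt x \<union> fvt y"
proof -
  have "closed_value LiftVar" by (auto simp: closed_value_def LiftVar_def dest!: fv_Less)
  then show "i \<in> fv (Lift x y) \<Longrightarrow> i \<in> fvt x \<union> fvt y" by (auto simp: Lift_def dest!: fv_Subst)
qed

lemma fv_Raise: "i \<in> fv (Raise k x y) \<Longrightarrow> i \<in> fvt k \<union> fvt x \<union> fvt y"
proof -
  have "closed_value (\<lambda>p k i y. y \<^bold>= QVar (Plus i k))" by (auto simp: closed_value_def)
  then show "i \<in> fv (Raise k x y) \<Longrightarrow> i \<in> fvt k \<union> fvt x \<union> fvt y"
    by (auto simp: Raise_def dest!: fv_Substt)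
qed

lemma fv_Inst: "i \<in> fv (Inst t x y) \<Longrightarrow> i \<in> fvt t \<union> fvt x \<union> fvt y"
proof -
  have "closed_value InstVar"
    unfolding closed_value_def InstVar_def Let_def
    by (intro allI order_trans[OF fv_inst]) (auto dest!: fv_Less fv_Raise)
  then show "i \<in> fv (Inst t x y) \<Longrightarrow> i \<in> fvt t \<union> fvt x \<union> fvt y"
    by (auto simp: Inst_def dest!: fv_Subst)
qed

lemma fv_LogAx: "i \<in> fv (LogAx u) \<Longrightarrow> i \<in> fvt u"
  unfolding LogAx_def Let_def
  by (erule subsetD[OF order_trans[OF fv_inst], rotated 2])
    (auto dest!: fv_Form fv_Term fv_Inst fv_Lift)

lemma fv_inst_closed: "fv \<tau> \<subseteq> {0} \<Longrightarrow> i \<in> fv (inst [t] \<tau>) \<Longrightarrow> i \<in> fvt t"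
  using fv_inst[of \<tau> "[t]"] by auto

lemma closed_ProofStep: "fv \<tau> \<subseteq> {0} \<Longrightarrow> closed_clause (ProofStep \<tau>)"
  unfolding closed_clause_def ProofStep_def Sent_def Let_def
  by (intro allI order_trans[OF fv_inst])
    (auto dest!: fv_LogAx fv_FormBelow fv_Earlier fv_inst_closed)

lemma fv_Pr: "fv \<tau> \<subseteq> {0} \<Longrightarrow> fv (Pr \<tau> t) \<subseteq> fvt t"
  unfolding Pr_def Prf_def Let_def
  by (intro order_trans[OF fv_inst]) (auto dest!: fv_Derivation[OF closed_ProofStep])

lemma sentence_Pr: "fv \<tau> \<subseteq> {0} \<Longrightarrow> sentence (Pr \<tau> (quot \<phi>))"
  using fv_Pr[of \<tau> "quot \<phi>"] by (simp add: sentence_def quot_def)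


section \<open>Provability predicates in models\<close>

context PA_model
begin

definition is_form where "is_form x \<longleftrightarrow> (\<exists>k. generated FormStep (pairing k x))"
definition is_term where "is_term x \<longleftrightarrow> (\<exists>k. generated TermStep (pairing k x))"
definition is_lift where
  "is_lift x y \<longleftrightarrow> generated (SubstStep LiftVar) (pairing \<zero> (pairing \<zero> (pairing x y)))"
definition is_inst where
  "is_inst t x y \<longleftrightarrow> generated (SubstStep InstVar) (pairing t (pairing \<zero> (pairing x y)))"

lemma eval_is_form: "eval e (Form x) \<longleftrightarrow> is_form (evalt e x)"
  by (simp add: Form_def eval_inst Let_def is_form_def)

lemma eval_is_term: "eval e (Term x) \<longleftrightarrow> is_term (evalt e x)"
  by (simp add: Term_def eval_inst Let_def is_term_def)

lemma eval_is_lift: "eval e (Lift x y) \<longleftrightarrow> is_lift (evalt e x) (evalt e y)"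
  by (simp add: Lift_def eval_Subst[OF extensional_LiftVar] is_lift_def)

lemma eval_is_inst: "eval e (Inst t x y) \<longleftrightarrow> is_inst (evalt e t) (evalt e x) (evalt e y)"
  by (simp add: Inst_def eval_Subst[OF extensional_InstVar] is_inst_def)

lemma is_form_gn [simp]: "is_form (nm (gn \<phi>))"
  using eval_Form[of undefined \<phi>] by (simp add: eval_is_form)

lemma is_term_gnt [simp]: "is_term (nm (gnt t))"
  using eval_Term[of undefined t] by (simp add: eval_is_term)

lemma is_lift_gn [simp]: "is_lift (nm (gn \<phi>)) (nm (gn (lift \<phi>)))"
  using eval_Lift[of undefined \<phi>] by (simp add: eval_is_lift)

lemma is_inst_gn [simp]: "is_inst (nm (gnt t)) (nm (gn \<phi>)) (nm (gn (inst [t] \<phi>)))"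
  using eval_Inst[of undefined t \<phi>] by (simp add: eval_is_inst)

definition is_logax where "is_logax u \<longleftrightarrow> eval (\<lambda>_. u) (LogAx (Var 0))"

lemmas eval_LogAx_simps =
  LogAx_def eval_inst Let_def eval_is_form eval_is_term eval_is_lift eval_is_inst

lemma eval_LogAx: "eval e (LogAx u) \<longleftrightarrow> is_logax (evalt e u)"
  by (simp add: is_logax_def eval_LogAx_simps)

lemma is_logax_gn: "logical_axiom \<phi> \<Longrightarrow> is_logax (nm (gn \<phi>))"
proof (induction rule: logical_axiom.induct)
  case (4 \<phi> t)
  show ?case
    by (simp add: is_logax_def eval_LogAx_simps ex_disj_distrib)
      (use is_inst_gn[of t \<phi>] is_term_gnt[of t] in blast)
next
  case (7 s t \<phi>)
  show ?case
    by (simp add: is_logax_def eval_LogAx_simps ex_disj_distrib)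
      (use is_inst_gn[of t \<phi>] is_inst_gn[of s \<phi>] is_form_gn[of \<phi>]
        is_term_gnt[of s] is_term_gnt[of t] in blast)
qed (simp_all add: is_logax_def eval_LogAx_simps ex_disj_distrib)

lemma clausal_ProofStep: "fv \<tau> \<subseteq> {0} \<Longrightarrow> clausal (ProofStep \<tau>)"
  unfolding clausal_def clause_def ProofStep_def Sent_def Let_def
  by (simp add: eval_inst_closed eval_LogAx eval_inst[of _ "[_, _, _]"]) blast

text \<open>The meaning of \<open>Pr\<close> in the model, as opposed to actual provability: its
  witnesses may be nonstandard proofs.\<close>

definition proved where "proved \<tau> = generated (ProofStep \<tau>)"

lemma eval_Pr: "fv \<tau> \<subseteq> {0} \<Longrightarrow> eval e (Pr \<tau> t) \<longleftrightarrow> proved \<tau> (evalt e t)"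
  by (simp add: Pr_def Prf_def eval_inst Let_def eval_Derivation[OF clausal_ProofStep]
      generated_def proved_def)

text \<open>The tags 7 and 8 are those of implication and universal quantification in
  \<open>gn\<close>.\<close>

lemma clause_ProofStep:
  assumes "fv \<tau> \<subseteq> {0}"
  shows "clause (ProofStep \<tau>) u s i \<longleftrightarrow>
    is_logax u \<or> (generated FormStep (pairing \<zero> u) \<and> eval (\<lambda>_. u) \<tau>) \<or>
    (\<exists>x. earlier s i x \<and> earlier s i (pairing (nm 7) (pairing x u))) \<or>
    (\<exists>x. earlier s i x \<and> u = pairing (nm 8) x)"
  using assms unfolding clause_def ProofStep_def Sent_def Let_def
  by (simp add: eval_inst_closed eval_LogAx eval_inst[of _ "[_, _, _]"] ex_disj_distrib)

lemma proved_logical: "fv \<tau> \<subseteq> {0} \<Longrightarrow> is_logax u \<Longrightarrow> proved \<tau> u"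
  unfolding proved_def by (rule generated_base[OF clausal_ProofStep]) (simp_all add: clause_ProofStep)

lemma proved_axiom:
  "fv \<tau> \<subseteq> {0} \<Longrightarrow> generated FormStep (pairing \<zero> u) \<Longrightarrow> eval (\<lambda>_. u) \<tau> \<Longrightarrow> proved \<tau> u"
  unfolding proved_def by (rule generated_base[OF clausal_ProofStep]) (simp_all add: clause_ProofStep)

lemma proved_mp:
  assumes "fv \<tau> \<subseteq> {0}" "proved \<tau> (pairing (nm 7) (pairing x u))" "proved \<tau> x"
  shows "proved \<tau> u"
  using assms(2,3) unfolding proved_def
  by (rule generated_step[OF clausal_ProofStep[OF assms(1)]])
    (use assms(1) in \<open>auto simp: clause_ProofStep\<close>)

lemma proved_gen:
  assumes "fv \<tau> \<subseteq> {0}" "proved \<tau> x"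
  shows "proved \<tau> (pairing (nm 8) x)"
  using assms(2) unfolding proved_def
  by (rule generated_step1[OF clausal_ProofStep[OF assms(1)]])
    (use assms(1) in \<open>auto simp: clause_ProofStep\<close>)

lemma sentence_generated: "sentence \<phi> \<Longrightarrow> generated FormStep (pairing \<zero> (nm (gn \<phi>)))"
  using form_below[of \<phi> 0] by (simp add: sentence_def)

text \<open>An actual proof is replayed in the model step by step, each step being a closure
  property of \<open>proved\<close> at standard codes.\<close>

lemma provable_proved:
  assumes \<tau>: "fv \<tau> \<subseteq> {0}" and T: "\<And>\<phi>. \<phi> \<in> T \<Longrightarrow> sentence \<phi> \<and> eval (\<lambda>_. nm (gn \<phi>)) \<tau>"
    and "T \<turnstile> \<phi>"
  shows "proved \<tau> (nm (gn \<phi>))"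
  using assms(3)
proof (induction rule: provable.induct)
  case (logical \<phi>)
  then show ?case by (simp add: \<tau> is_logax_gn proved_logical)
next
  case (nonlogical \<phi>)
  then show ?case using T by (simp add: \<tau> sentence_generated proved_axiom)
next
  case (modus_ponens \<phi> \<psi>)
  then show ?case using proved_mp[OF \<tau>] by simp
next
  case (generalization \<phi>)
  then show ?case using proved_gen[OF \<tau>] by simp
qed

lemma definable_proved:
  assumes "fv \<tau> \<subseteq> {0}"
  shows "definable (proved \<tau>)"
  by (rule definableI[of "[]" "Pr \<tau> (Var 0)"]) (simp add: eval_Pr[OF assms])

text \<open>Counterpart of \<open>provable_mono\<close> inside the model. Since the proof may be
  nonstandard, the induction is \<open>generated_induct\<close>, for the predicate
  \<open>proved \<tau>\<close> that \<open>Pr\<close> defines.\<close>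

lemma proved_cut:
  assumes fv: "fv \<sigma> \<subseteq> {0}" "fv \<tau> \<subseteq> {0}"
    and ax: "\<And>u. generated FormStep (pairing \<zero> u) \<Longrightarrow> eval (\<lambda>_. u) \<sigma> \<Longrightarrow> proved \<tau> u"
    and "proved \<sigma> x"
  shows "proved \<tau> x"
  using definable_proved[OF fv(2)] _ assms(4)[unfolded proved_def]
proof (rule generated_induct)
  fix u s i
  assume "clause (ProofStep \<sigma>) u s i" and IH: "\<And>y. earlier s i y \<Longrightarrow> proved \<tau> y"
  then consider "is_logax u" | "generated FormStep (pairing \<zero> u)" "eval (\<lambda>_. u) \<sigma>"
    | x where "earlier s i x" "earlier s i (pairing (nm 7) (pairing x u))"
    | x where "earlier s i x" "u = pairing (nm 8) x"
    unfolding clause_ProofStep[OF fv(1)] by blast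
  then show "proved \<tau> u"
    using proved_logical[OF fv(2)] ax proved_mp[OF fv(2)] proved_gen[OF fv(2)] IH by cases blast+
qed

lemma fv_extend: "fv \<tau> \<subseteq> {0} \<Longrightarrow> fv (extend \<tau> \<phi>) \<subseteq> {0}"
  by (auto simp: extend_def quot_def)

lemma eval_extend: "eval e (extend \<tau> \<phi>) \<longleftrightarrow> eval e \<tau> \<or> e 0 = nm (gn \<phi>)"
  by (auto simp: extend_def quot_def)

lemma proved_extend_cut:
  assumes \<tau>: "fv \<tau> \<subseteq> {0}" and "proved (extend \<tau> \<phi>) (nm (gn \<psi>))" "proved (extend \<tau> \<psi>) x"
  shows "proved (extend \<tau> \<phi>) x"
proof (rule proved_cut[OF fv_extend[OF \<tau>] fv_extend[OF \<tau>] _ assms(3)])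
  fix u assume "generated FormStep (pairing \<zero> u)" "eval (\<lambda>_. u) (extend \<tau> \<psi>)"
  then show "proved (extend \<tau> \<phi>) u"
    using assms(2) proved_axiom[OF fv_extend[OF \<tau>]] by (auto simp: eval_extend)
qed

end


section \<open>Derivability conditions\<close>

text \<open>Collects what is drawn from a numeration, for \<open>\<tau>\<^sub>0\<close> and
  \<open>\<tau>\<^sub>1\<close> alike. Provability of the instances in \<open>PA\<close> makes
  \<open>\<tau>\<close> true of each axiom in every model; axioms must be sentences because
  \<open>ProofStep\<close> tests for that.\<close>

locale provability =
  fixes T :: "fm set" and \<tau> :: fm
  assumes closed: "fv \<tau> \<subseteq> {0}"
    and axioms: "\<phi> \<in> T \<Longrightarrow> sentence \<phi> \<and> PA \<turnstile> inst [quot \<phi>] \<tau>"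
    and extends_PA: "\<phi> \<in> PA \<Longrightarrow> T \<turnstile> \<phi>"

lemma (in PA_model) proved_theorem:
  assumes "provability T \<tau>" "PA \<turnstile> \<phi>"
  shows "proved \<tau> (nm (gn \<phi>))"
proof -
  interpret provability T \<tau> by fact
  have "T \<turnstile> \<phi>" using assms(2) extends_PA provable_mono by blast
  moreover have "sentence \<psi> \<and> eval (\<lambda>_. nm (gn \<psi>)) \<tau>" if "\<psi> \<in> T" for \<psi>
    using provable_eval[of "inst [quot \<psi>] \<tau>"] axioms[OF that] eval_inst_closed[OF closed]
    by (simp add: quot_def)
  ultimately show ?thesis using provable_proved closed by blast
qed

lemma (in PA_model) proved_imp:
  assumes "provability T \<tau>" "PA \<turnstile> \<phi> \<^bold>\<longrightarrow> \<psi>" "proved \<tau> (nm (gn \<phi>))"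
  shows "proved \<tau> (nm (gn \<psi>))"
  using proved_theorem[OF assms(1,2)] proved_mp[OF provability.closed[OF assms(1)]] assms(3)
  by simp

lemma (in PA_model) eval_sentence: "sentence \<phi> \<Longrightarrow> eval e \<phi> \<longleftrightarrow> eval e' \<phi>"
  by (rule eval_cong) (simp add: sentence_def)

lemma (in PA_model) eval_Pr_quot:
  "fv \<tau> \<subseteq> {0} \<Longrightarrow> eval e (Pr \<tau> (quot \<phi>)) \<longleftrightarrow> proved \<tau> (nm (gn \<phi>))"
  by (simp add: eval_Pr quot_def)

lemma (in provability) necessitation:
  assumes "PA \<turnstile> \<phi>"
  shows "PA \<turnstile> Pr \<tau> (quot \<phi>)"
proof (rule PA_completeness)
  fix zero :: nat and suc add mul e
  assume "PA_model zero suc add mul"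
  then interpret PA_model zero suc add mul .
  show "eval e (Pr \<tau> (quot \<phi>))"
    using proved_theorem[OF provability_axioms assms] by (simp add: eval_Pr_quot[OF closed])
qed


section \<open>The diagonal lemma\<close>

text \<open>Generates the pairs of a number and the code of its numeral; this expresses the numeral
  function for the diagonal lemma.\<close>

definition NumeralStep :: "tm \<Rightarrow> tm \<Rightarrow> tm \<Rightarrow> fm" where
  "NumeralStep u s i = inst [u, s, i] (exs 2
     (let x = Var 0; y = Var 1; u = Var 2; s = Var 3; i = Var 4 in
        u \<^bold>= \<langle>Zero, QZero\<rangle> \<^bold>\<or> (u \<^bold>= \<langle>Succ x, QSucc y\<rangle> \<^bold>\<and> Earlier s i \<langle>x, y\<rangle>)))"

context PA_model
begin

lemma clausal_NumeralStep: "clausal NumeralStep"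
  unfolding clausal_def clause_def NumeralStep_def eval_inst Let_def by simp blast

lemma clause_NumeralStep:
  "clause NumeralStep u s i \<longleftrightarrow> u = pairing \<zero> (pairing (nm 1) (nm 0)) \<or>
    (\<exists>x y. u = pairing (suc x) (pairing (nm 2) y) \<and> earlier s i (pairing x y))"
  unfolding clause_def NumeralStep_def eval_inst Let_def by simp blast

text \<open>Uniqueness comes from external induction on the standard \<open>n\<close> by
  \<open>generated_inversion\<close>; the diagonal lemma takes for \<open>n\<close> the code of an
  actual formula.\<close>

lemma generated_NumeralStep: "generated NumeralStep (pairing (nm n) y) \<longleftrightarrow> y = nm (gnt (num n))"
proof
  show "generated NumeralStep (pairing (nm n) y) \<Longrightarrow> y = nm (gnt (num n))"
  proof (induction n arbitrary: y)
    case 0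
    then show ?case
      by (auto dest!: generated_inversion[OF clausal_NumeralStep] simp: clause_NumeralStep)
  next
    case (Suc n)
    then show ?case
      by (auto dest!: generated_inversion[OF clausal_NumeralStep] simp: clause_NumeralStep)
  qed
  have "generated NumeralStep (pairing (nm n) (nm (gnt (num n))))"
  proof (induction n)
    case 0
    show ?case by (rule generated_base[OF clausal_NumeralStep]) (simp add: clause_NumeralStep)
  next
    case (Suc n)
    then show ?case
      by (rule generated_step1[OF clausal_NumeralStep]) (simp add: clause_NumeralStep)
  qed
  then show "y = nm (gnt (num n)) \<Longrightarrow> generated NumeralStep (pairing (nm n) y)" by simp
qed

end

text \<open>The sentence \<open>\<forall>x. x = n \<longrightarrow> \<theta>(x)\<close>, where \<open>n\<close> is the code of \<open>\<theta>\<close>, plays the role of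
  \<open>\<theta>(n)\<close>: its code is computed from \<open>n\<close> and the code of the numeral of \<open>n\<close> without substitution.\<close>

lemma diagonal:
  assumes B: "fv B \<subseteq> {0}"
  obtains \<psi> where "PA \<turnstile> \<psi> \<^bold>\<longrightarrow> inst [quot \<psi>] B" "PA \<turnstile> inst [quot \<psi>] B \<^bold>\<longrightarrow> \<psi>"
proof -
  \<comment> \<open>Under the quantifier, \<open>Var 1\<close> is the argument of
    \<open>\<theta>\<close> and \<open>Var 0\<close> the code of its numeral;
    \<open>QVar Zero\<close> codes the bound variable of \<open>\<psi>\<close>. When the argument is
    the code of \<open>\<theta>\<close>, what \<open>B\<close> receives is the code of
    \<open>\<psi>\<close>.\<close>
  define \<theta> where "\<theta> = Forall (Derivable NumeralStep \<langle>Var 1, Var 0\<rangle> \<^bold>\<longrightarrow>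
    inst [QForall (QImp (QEq (QVar Zero) (Var 0)) (Var 1))] B)"
  define \<psi> where "\<psi> = Forall (Var 0 \<^bold>= quot \<theta> \<^bold>\<longrightarrow> \<theta>)"
  have "arith_structure.eval zero suc add mul e \<psi> \<longleftrightarrow>
      arith_structure.eval zero suc add mul e (inst [quot \<psi>] B)"
    if "PA_model zero suc add mul" for zero :: nat and suc add mul e
  proof -
    interpret PA_model zero suc add mul by fact
    have "eval (case_nat (nm n) e) \<theta> \<longleftrightarrow> eval (\<lambda>_. pairing (nm 8) (pairing (nm 7)
        (pairing (pairing (nm 5) (pairing (pairing zero zero) (nm (gnt (num n))))) (nm n)))) B" for n
      by (simp add: \<theta>_def eval_Derivable[OF clausal_NumeralStep] generated_NumeralStep
          eval_inst_closed[OF B])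
    then show ?thesis by (simp add: \<psi>_def quot_def eval_inst_closed[OF B])
  qed
  then have "PA \<turnstile> \<psi> \<^bold>\<longrightarrow> inst [quot \<psi>] B" "PA \<turnstile> inst [quot \<psi>] B \<^bold>\<longrightarrow> \<psi>"
    by (auto intro!: PA_completeness simp: arith_structure.eval.simps)
  then show thesis by (rule that)
qed


section \<open>Loeb's theorem\<close>

text \<open>The fixed point \<open>\<psi>\<close> asserts that \<open>\<phi>\<close> follows from
  the provability of \<open>\<psi>\<close>. The third derivability condition is used once, at
  \<open>\<psi>\<close>: it yields that provability of \<open>\<psi>\<close> implies that of
  \<open>\<phi>\<close>. Hence reflection for \<open>\<phi>\<close> provably implies
  \<open>\<psi>\<close>, and this implication can be placed under \<open>Pr\<close>.\<close>

lemma (in provability) Loeb: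
  assumes "Loeb_condition \<tau>" and a: "sentence \<phi>"
  shows "PA \<turnstile> Pr \<tau> (quot (Pr \<tau> (quot \<phi>) \<^bold>\<longrightarrow> \<phi>)) \<^bold>\<longrightarrow> Pr \<tau> (quot \<phi>)"
proof -
  have "fv (Pr \<tau> (Var 0) \<^bold>\<longrightarrow> \<phi>) \<subseteq> {0}"
    using fv_Pr[OF closed, of "Var 0"] a by (simp add: sentence_def)
  then obtain \<psi> where \<psi>: "PA \<turnstile> \<psi> \<^bold>\<longrightarrow> inst [quot \<psi>] (Pr \<tau> (Var 0) \<^bold>\<longrightarrow> \<phi>)"
    "PA \<turnstile> inst [quot \<psi>] (Pr \<tau> (Var 0) \<^bold>\<longrightarrow> \<phi>) \<^bold>\<longrightarrow> \<psi>" by (rule diagonal)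
  \<comment> \<open>Truth values are compared instead of formulas: it suffices that both sides agree
    in all models, and the truth of the sentence \<open>\<phi>\<close> is unaffected by the
    instantiation.\<close>
  have inst: "arith_structure.eval zero suc add mul e (inst [quot \<psi>] (Pr \<tau> (Var 0) \<^bold>\<longrightarrow> \<phi>)) \<longleftrightarrow>
      arith_structure.eval zero suc add mul e (Pr \<tau> (quot \<psi>) \<^bold>\<longrightarrow> \<phi>)"
    if "PA_model zero suc add mul" for zero :: nat and suc add mul e
  proof -
    interpret PA_model zero suc add mul by fact
    show ?thesis
      using eval_sentence[OF a, of "case_nat (nm (gn \<psi>)) e" e]
      by (simp add: eval_inst1 eval_Pr[OF closed] quot_def)
  qed
  have fix1: "PA \<turnstile> \<psi> \<^bold>\<longrightarrow> Pr \<tau> (quot \<psi>) \<^bold>\<longrightarrow> \<phi>"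
  proof (rule PA_completeness)
    fix zero :: nat and suc add mul e
    assume M: "PA_model zero suc add mul"
    then interpret PA_model zero suc add mul .
    show "eval e (\<psi> \<^bold>\<longrightarrow> Pr \<tau> (quot \<psi>) \<^bold>\<longrightarrow> \<phi>)"
      using provable_eval[OF \<psi>(1)] inst[OF M] by simp
  qed
  have fix2: "PA \<turnstile> (Pr \<tau> (quot \<psi>) \<^bold>\<longrightarrow> \<phi>) \<^bold>\<longrightarrow> \<psi>"
  proof (rule PA_completeness)
    fix zero :: nat and suc add mul e
    assume M: "PA_model zero suc add mul"
    then interpret PA_model zero suc add mul .
    show "eval e ((Pr \<tau> (quot \<psi>) \<^bold>\<longrightarrow> \<phi>) \<^bold>\<longrightarrow> \<psi>)"
      using provable_eval[OF \<psi>(2)] inst[OF M] by simp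
  qed
  have key: "PA \<turnstile> Pr \<tau> (quot \<psi>) \<^bold>\<longrightarrow> Pr \<tau> (quot \<phi>)"
  proof (rule PA_completeness)
    fix zero :: nat and suc add mul e
    assume M: "PA_model zero suc add mul"
    then interpret PA_model zero suc add mul .
    have "proved \<tau> (nm (gn \<phi>))" if "proved \<tau> (nm (gn \<psi>))"
    proof -
      have "proved \<tau> (nm (gn (Pr \<tau> (quot \<psi>) \<^bold>\<longrightarrow> \<phi>)))"
        using proved_imp[OF provability_axioms fix1] that by blast
      moreover have "PA \<turnstile> Pr \<tau> (quot \<psi>) \<^bold>\<longrightarrow> Pr \<tau> (quot (Pr \<tau> (quot \<psi>)))"
        using assms(1) by (simp add: Loeb_condition_def)
      then have "proved \<tau> (nm (gn (Pr \<tau> (quot \<psi>))))"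
        using provable_eval that by (fastforce simp: eval_Pr_quot[OF closed])
      ultimately show ?thesis using proved_mp[OF closed] by simp
    qed
    then show "eval e (Pr \<tau> (quot \<psi>) \<^bold>\<longrightarrow> Pr \<tau> (quot \<phi>))" by (simp add: eval_Pr_quot[OF closed])
  qed
  \<comment> \<open>If \<open>\<phi>\<close> follows from its own provability, then by
    \<open>key\<close> it follows from the provability of \<open>\<psi>\<close>, which is what
    \<open>\<psi>\<close> asserts.\<close>
  have step: "PA \<turnstile> (Pr \<tau> (quot \<phi>) \<^bold>\<longrightarrow> \<phi>) \<^bold>\<longrightarrow> \<psi>"
  proof (rule PA_completeness)
    fix zero :: nat and suc add mul e
    assume M: "PA_model zero suc add mul"
    then interpret PA_model zero suc add mul .
    show "eval e ((Pr \<tau> (quot \<phi>) \<^bold>\<longrightarrow> \<phi>) \<^bold>\<longrightarrow> \<psi>)"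
      using provable_eval[OF key, of e] provable_eval[OF fix2, of e] by simp
  qed
  show ?thesis
  proof (rule PA_completeness)
    fix zero :: nat and suc add mul e
    assume M: "PA_model zero suc add mul"
    then interpret PA_model zero suc add mul .
    show "eval e (Pr \<tau> (quot (Pr \<tau> (quot \<phi>) \<^bold>\<longrightarrow> \<phi>)) \<^bold>\<longrightarrow> Pr \<tau> (quot \<phi>))"
      using proved_imp[OF provability_axioms step] provable_eval[OF key]
      by (simp add: eval_Pr_quot[OF closed])
  qed
qed


section \<open>Arithmetical soundness\<close>

lemma sentence_interp:
  assumes "fv \<tau>\<^sub>0 \<subseteq> {0}" "\<forall>p. sentence (f p)"
  shows "sentence (interp f \<tau>\<^sub>0 \<tau>\<^sub>1 A)"
proof (induction A)
  case (Box A)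
  then show ?case using sentence_Pr[OF assms(1)] by simp
next
  case (Rhd A B)
  then show ?case using sentence_Pr[OF assms(1)] by simp
qed (use assms(2) in \<open>auto simp: sentence_def\<close>)

text \<open>Truth in a model gives a Boolean valuation of the modal atoms; this disposes of the
  tautologies.\<close>

lemma (in PA_model) eval_interp_boolean:
  "eval e (interp f \<tau>\<^sub>0 \<tau>\<^sub>1 A) \<longleftrightarrow> boolean_eval (\<lambda>B. eval e (interp f \<tau>\<^sub>0 \<tau>\<^sub>1 B)) A"
  by (induction A) auto

text \<open>The content of \<open>R1\<close>. As a sentence, \<open>\<phi>\<close> counts as an
  axiom of its own extension; with the provable implication it yields \<open>\<psi>\<close>, and
  \<open>proved_extend_cut\<close> transfers a contradiction.\<close>

lemma PA_Con_mono:
  assumes \<tau>: "provability T \<tau>" and "sentence \<phi>" "PA \<turnstile> \<phi> \<^bold>\<longrightarrow> \<psi>"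
  shows "PA \<turnstile> Con (extend \<tau> \<phi>) \<^bold>\<longrightarrow> Con (extend \<tau> \<psi>)"
proof (rule PA_completeness)
  fix zero :: nat and suc add mul e
  assume M: "PA_model zero suc add mul"
  then interpret PA_model zero suc add mul .
  interpret provability T \<tau> by fact
  note ext = fv_extend[OF closed]
  have "proved (extend \<tau> \<phi>) (nm (gn \<phi>))"
    using assms(2) ext by (intro proved_axiom) (simp_all add: sentence_generated eval_extend)
  moreover have "proved (extend \<tau> \<phi>) (nm (gn (\<phi> \<^bold>\<longrightarrow> \<psi>)))"
    using proved_cut[OF closed ext proved_axiom[OF ext]] proved_theorem[OF \<tau> assms(3)]
    by (simp add: eval_extend)
  ultimately have "proved (extend \<tau> \<phi>) (nm (gn \<psi>))" using proved_mp[OF ext] by simp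
  then show "eval e (Con (extend \<tau> \<phi>) \<^bold>\<longrightarrow> Con (extend \<tau> \<psi>))"
    using proved_extend_cut[OF closed] by (simp add: Con_def eval_Pr_quot[OF ext]) blast
qed

text \<open>Needed for \<open>J6\<close>: that the negation of a sentence implies something
  refutable amounts to the sentence itself.\<close>

lemma PA_not_Con_Falsum:
  assumes "fv \<tau> \<subseteq> {0}"
  shows "PA \<turnstile> \<^bold>\<not> Con (extend \<tau> Falsum)"
proof (rule PA_completeness)
  fix zero :: nat and suc add mul e
  assume M: "PA_model zero suc add mul"
  then interpret PA_model zero suc add mul .
  have "sentence Falsum" by (simp add: sentence_def)
  then have "proved (extend \<tau> Falsum) (nm (gn Falsum))"
    by (intro proved_axiom fv_extend[OF assms] sentence_generated) (simp_all add: eval_extend)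
  then show "eval e (\<^bold>\<not> Con (extend \<tau> Falsum))"
    by (simp add: Con_def eval_Pr_quot[OF fv_extend[OF assms]] del: gn.simps)
qed

lemma (in PA_model) proved_imp2:
  assumes "provability T \<tau>" "PA \<turnstile> \<phi> \<^bold>\<longrightarrow> \<psi> \<^bold>\<longrightarrow> \<chi>" "proved \<tau> (nm (gn \<phi>))" "proved \<tau> (nm (gn \<psi>))"
  shows "proved \<tau> (nm (gn \<chi>))"
  using proved_imp[OF assms(1-3)] proved_mp[OF provability.closed[OF assms(1)]] assms(4) by simp

text \<open>Propositional reasoning over \<open>PA\<close>, with atoms and quantified formulas kept
  opaque: truth in a model is one such \<open>v\<close>.\<close>

lemma PA_tautI:
  assumes "\<And>v. (\<And>\<phi>. v (\<^bold>\<not> \<phi>) \<longleftrightarrow> \<not> v \<phi>) \<Longrightarrow> (\<And>\<phi> \<psi>. v (\<phi> \<^bold>\<longrightarrow> \<psi>) \<longleftrightarrow> (v \<phi> \<longrightarrow> v \<psi>)) \<Longrightarrow>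
    (\<And>\<psi>. PA \<turnstile> \<psi> \<Longrightarrow> v \<psi>) \<Longrightarrow> v \<phi>"
  shows "PA \<turnstile> \<phi>"
proof (rule PA_completeness)
  fix zero :: nat and suc add mul e
  assume M: "PA_model zero suc add mul"
  then interpret PA_model zero suc add mul .
  show "eval e \<phi>" by (rule assms) (simp_all add: provable_eval)
qed

text \<open>\<open>R1\<close> and \<open>R2\<close> act on theorems, so the induction hypothesis is
  an implication provable in \<open>PA\<close>; the implication derived from it is carried under
  \<open>Pr \<tau>\<^sub>0\<close> by \<open>proved_imp\<close>.\<close>

lemma soundness_ILminusP:
  assumes \<tau>: "provability T \<tau>\<^sub>0" "provability T \<tau>\<^sub>1" and "Loeb_condition \<tau>\<^sub>0"
    and f: "\<forall>p. sentence (f p)" and "ILminusP A"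
  shows "PA \<turnstile> interp f \<tau>\<^sub>0 \<tau>\<^sub>1 A"
  using assms(5)
proof induction
  let ?f = "interp f \<tau>\<^sub>0 \<tau>\<^sub>1"
  note fv = provability.closed[OF \<tau>(1)]
  note sent = sentence_interp[OF fv f]
  {
    case (taut A)
    show ?case
    proof (rule PA_completeness)
      fix zero :: nat and suc add mul e
      assume M: "PA_model zero suc add mul"
      then interpret PA_model zero suc add mul .
      show "eval e (?f A)" using taut by (simp add: eval_interp_boolean[of _ _ _ _ A] tautology_def)
    qed
  next
    case (K A B)
    show ?case
    proof (rule PA_completeness)
      fix zero :: nat and suc add mul e
      assume M: "PA_model zero suc add mul"
      then interpret PA_model zero suc add mul .
      show "eval e (?f (\<box> (A \<rightarrow> B) \<rightarrow> (\<box> A \<rightarrow> \<box> B)))"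
        using proved_mp[OF fv] by (simp add: eval_Pr_quot[OF fv])
    qed
  next
    case (L A)
    show ?case using provability.Loeb[OF \<tau>(1) assms(3) sent] by simp
  next
    case (J3 A C B)
    show ?case
    proof (rule PA_completeness)
      fix zero :: nat and suc add mul e
      assume M: "PA_model zero suc add mul"
      then interpret PA_model zero suc add mul .
      let ?C = "Con (extend \<tau>\<^sub>1 (?f C))"
      \<comment> \<open>\<open>A \<rhd> C\<close> and \<open>B \<rhd> C\<close> lead to the same
        consistency statement, so \<open>J3\<close> is a case distinction inside
        \<open>Pr\<close>.\<close>
      have "PA \<turnstile> (?f A \<^bold>\<longrightarrow> ?C) \<^bold>\<longrightarrow> (?f B \<^bold>\<longrightarrow> ?C) \<^bold>\<longrightarrow> (?f A \<^bold>\<or> ?f B) \<^bold>\<longrightarrow> ?C"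
        by (rule PA_tautI) (simp, blast)
      from proved_imp2[OF \<tau>(1) this]
      show "eval e (?f (MConj (A \<rhd> C) (B \<rhd> C) \<rightarrow> (MDisj A B \<rhd> C)))"
        by (simp add: eval_Pr_quot[OF fv] del: gn.simps)
    qed
  next
    case (J6 A)
    show ?case
    proof (rule PA_completeness)
      fix zero :: nat and suc add mul e
      assume M: "PA_model zero suc add mul"
      then interpret PA_model zero suc add mul .
      let ?C = "Con (extend \<tau>\<^sub>1 Falsum)"
      have "PA \<turnstile> ?f A \<^bold>\<longrightarrow> \<^bold>\<not> ?f A \<^bold>\<longrightarrow> ?C"
        by (rule PA_tautI) simp
      moreover have "PA \<turnstile> (\<^bold>\<not> ?f A \<^bold>\<longrightarrow> ?C) \<^bold>\<longrightarrow> ?f A"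
        using PA_not_Con_Falsum[OF provability.closed[OF \<tau>(2)]] by (intro PA_tautI) (metis)
      ultimately show "eval e (?f (MIff (\<box> A) (MNeg A \<rhd> MBot)))"
        using proved_imp[OF \<tau>(1)] by (simp add: eval_Pr_quot[OF fv] del: gn.simps)
    qed
  next
    case (P A B)
    \<comment> \<open>The interpretation of a \<open>\<rhd>\<close>-formula is itself
      \<open>Pr\<close> of a quoted formula, so this is an instance of the Loeb condition.\<close>
    show ?case using assms(3) by (simp add: Loeb_condition_def)
  next
    case (MP A B)
    then show ?case using modus_ponens[of PA "?f A" "?f B"] by simp
  next
    case (Nec A)
    then show ?case using provability.necessitation[OF \<tau>(1)] by simp
  next
    case (R1 A B C)
    show ?case
    proof (rule PA_completeness)
      fix zero :: nat and suc add mul e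
      assume M: "PA_model zero suc add mul"
      then interpret PA_model zero suc add mul .
      have "PA \<turnstile> Con (extend \<tau>\<^sub>1 (?f A)) \<^bold>\<longrightarrow> Con (extend \<tau>\<^sub>1 (?f B))"
        using PA_Con_mono[OF \<tau>(2) sent] R1.IH by simp
      then have "PA \<turnstile> (?f C \<^bold>\<longrightarrow> Con (extend \<tau>\<^sub>1 (?f A))) \<^bold>\<longrightarrow> ?f C \<^bold>\<longrightarrow> Con (extend \<tau>\<^sub>1 (?f B))"
        by (intro PA_tautI) metis
      from proved_imp[OF \<tau>(1) this] show "eval e (?f (C \<rhd> A \<rightarrow> C \<rhd> B))"
        by (simp add: eval_Pr_quot[OF fv] del: gn.simps)
    qed
  next
    case (R2 A B C)
    show ?case
    proof (rule PA_completeness)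
      fix zero :: nat and suc add mul e
      assume M: "PA_model zero suc add mul"
      then interpret PA_model zero suc add mul .
      let ?C = "Con (extend \<tau>\<^sub>1 (?f C))"
      have "PA \<turnstile> ?f A \<^bold>\<longrightarrow> ?f B" using R2.IH by simp
      then have "PA \<turnstile> (?f B \<^bold>\<longrightarrow> ?C) \<^bold>\<longrightarrow> ?f A \<^bold>\<longrightarrow> ?C"
        by (intro PA_tautI) metis
      from proved_imp[OF \<tau>(1) this] show "eval e (?f (B \<rhd> C \<rightarrow> A \<rhd> C))"
        by (simp add: eval_Pr_quot[OF fv] del: gn.simps)
    qed
  }
qed

theorem proposition5p2:
  fixes T :: "fm set" and A :: mfm and \<tau>\<^sub>0 \<tau>\<^sub>1 :: fm and f :: "nat \<Rightarrow> fm"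
  assumes "\<forall>\<phi>\<in>T. sentence \<phi>"
    and "consistent T"
    and "rec_enumerable (gn ` T)"
    and "\<forall>\<phi>\<in>PA. T \<turnstile> \<phi>"
    and "numeration \<tau>\<^sub>0 T" and "numeration \<tau>\<^sub>1 T"
    and "ILminusP A"
    and "Loeb_condition \<tau>\<^sub>0"
    and "\<forall>p. sentence (f p)"
  shows "PA \<turnstile> interp f \<tau>\<^sub>0 \<tau>\<^sub>1 A"
proof -
  \<comment> \<open>As \<open>quot\<close> is the numeral of the Goedel number, the numeration
    property at that number is the locale assumption \<open>axioms\<close>.\<close>
  have "provability T \<tau>" if "numeration \<tau> T" for \<tau>
    using that assms(1,4) by unfold_locales (auto simp: numeration_def quot_def)
  from this[OF assms(5)] this[OF assms(6)] show ?thesis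
    by (rule soundness_ILminusP) (use assms in simp_all)
qed

end
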